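(* Let $\alpha\in\mathbb{R}$, let $m$ be a positive integer, let $(s_j)_{j=0}^m\in\mathcal{K}^{\ge}_{q,m,\alpha}$ with first $\alpha$-S-transform $(s_j^{[1,\alpha]})_{j=0}^{m-1}$, and let $F\in\mathcal{S}_{q,\alpha}[(s_j)_{j=0}^m,\le]$. Then the function $F^{[+,\alpha,s_0]}$ belongs to $\mathcal{S}_{q,\alpha}[(s_j^{[1,\alpha]})_{j=0}^{m-1},\le]$.
   Context: Notation: $q$ is a positive integer; $A^*$ is the conjugate transpose and $A^\dagger$ the Moore-Penrose inverse of a complex matrix $A$; $A\ge0$ means non-negative Hermitian; $\operatorname{Im}A=\frac1{2i}(A-A^* )$; $\|\cdot\|$ is the operator norm. Class of sequences. For complex $q\times q$ matrices put $H_n=(s_{j+k})_{j,k=0}^n$ and $K_n=(s_{j+k+1})_{j,k=0}^n$ (block Hankel matrices). $\mathcal{K}^{\ge}_{q,0,\alpha}$ is the set of $(s_0)$ with $s_0\ge0$; for $n\ge1$, $\mathcal{K}^{\ge}_{q,2n,\alpha}$ is the set of $(s_j)_{j=0}^{2n}$ with $H_n\ge0$ and $-\alpha H_{n-1}+K_{n-1}\ge0$; for $n\ge0$, $\mathcal{K}^{\ge}_{q,2n+1,\alpha}$ is the set of $(s_j)_{j=0}^{2n+1}$ with $H_n\ge0$ and $-\alpha H_n+K_n\ge0$. First $\alpha$-S-transform. Put $u_j=-\alpha s_{j-1}+s_j$ for $0\le j\le m$, with $s_{-1}=0$; let $u_0^\sharp=u_0^\dagger$, $u_j^\sharp=-u_0^\dagger\sum_{l=0}^{j-1}u_{j-l}u_l^\sharp$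 for $1\le j\le m$; then $s_j^{[1,\alpha]}=-s_0u_{j+1}^\sharp s_0$ for $0\le j\le m-1$. Transform of functions. For $A\in\mathbb{C}^{q\times q}$ and $F:\mathbb{C}\setminus[\alpha,\infty)\to\mathbb{C}^{q\times q}$, $F^{[+,\alpha,A]}(z)=-A\bigl(I_q+(z-\alpha)^{-1}[F(z)]^\dagger A\bigr)$ for $z\in\mathbb{C}\setminus[\alpha,\infty)$. Classes of functions. $\mathcal{S}_{q,\alpha}$ is the set of holomorphic $F:\mathbb{C}\setminus[\alpha,\infty)\to\mathbb{C}^{q\times q}$ with $\operatorname{Im}F(w)\ge0$ whenever $\operatorname{Im}w>0$ and $F(w)\ge0$ for $w\in(-\infty,\alpha)$. $\mathcal{S}_{0,q,\alpha}$ is the set of $F\in\mathcal{S}_{q,\alpha}$ with $\sup_{y\in[1,\infty)}y\|F(iy)\|<\infty$. For each $F\in\mathcal{S}_{0,q,\alpha}$ there is a unique non-negative Hermitian $q\times q$ measure $\sigma_F$ (a $\sigma$-additive map from the Borel subsets of $[\alpha,\infty)$ to the non-negative Hermitian matrices) with $F(z)=\int_{[\alpha,\infty)}(t-z)^{-1}\sigma_F(dt)$ (known fact). For a sequence $(t_j)_{j=0}^n$ of complex $q\times q$ matrices, $\mathcal{S}_{q,\alpha}[(t_j)_{j=0}^n,\le]$ is the set of $F\in\mathcal{S}_{0,q,\alpha}$ such that the moments $s_j^{(\sigma_F)}=\int_{[\alpha,\infty)}t^j\sigma_F(dt)$ exist for $j=0,\dots,n$, $s_j^{(\sigma_F)}=t_j$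 for $0\le j\le n-1$, and $t_n-s_n^{(\sigma_F)}\ge0$. *)

theory Defs
  imports "HOL-Analysis.Analysis"
begin

section \<open>Complex matrices\<close>

type_synonym 'q cmat = "complex ^ 'q ^ 'q"

definition cmat_scale :: "complex \<Rightarrow> 'q::finite cmat \<Rightarrow> 'q cmat"  (infixr \<open>*\<^sub>C\<close> 75)
  where "c *\<^sub>C A = (\<chi> i j. c * A $ i $ j)"

definition ctransp :: "'q::finite cmat \<Rightarrow> 'q cmat"
  where "ctransp A = (\<chi> i j. cnj (A $ j $ i))"

definition matrix_Im :: "'q::finite cmat \<Rightarrow> 'q cmat"
  where "matrix_Im A = (1 / (2 * \<i>)) *\<^sub>C (A - ctransp A)"

text \<open>Matrices are indexed by an arbitrary set here, so that one notion serves both for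
  \<open>q \<times> q\<close> matrices and for block matrices whose size varies with a natural number; it is
  only used for finite index sets.\<close>

definition nonneg_hermitian_on :: "'i set \<Rightarrow> ('i \<Rightarrow> 'i \<Rightarrow> complex) \<Rightarrow> bool"
  where "nonneg_hermitian_on I M \<longleftrightarrow>
    (\<forall>i\<in>I. \<forall>j\<in>I. M i j = cnj (M j i)) \<and>
    (\<forall>x. 0 \<le> Re (\<Sum>i\<in>I. \<Sum>j\<in>I. cnj (x i) * M i j * x j))"

definition nonneg_hermitian :: "'q::finite cmat \<Rightarrow> bool"
  where "nonneg_hermitian A \<longleftrightarrow> nonneg_hermitian_on UNIV (\<lambda>i j. A $ i $ j)"

definition is_moore_penrose :: "'q::finite cmat \<Rightarrow> 'q cmat \<Rightarrow> bool"
  where "is_moore_penrose A X \<longleftrightarrow>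
    A ** X ** A = A \<and> X ** A ** X = X \<and>
    ctransp (A ** X) = A ** X \<and> ctransp (X ** A) = X ** A"

definition mp_inverse :: "'q::finite cmat \<Rightarrow> 'q cmat"
  where "mp_inverse A = (THE X. is_moore_penrose A X)"

definition operator_norm :: "'q::finite cmat \<Rightarrow> real"
  where "operator_norm A = onorm (\<lambda>v. A *v v)"


section \<open>Sequences of matrices\<close>

text \<open>A finite sequence \<open>(s\<^sub>j)\<close>, \<open>0 \<le> j \<le> m\<close>, is given by a function on all natural numbers
  whose values at arguments greater than \<open>m\<close> are irrelevant.

  The block Hankel matrices \<open>H\<^sub>n\<close> and \<open>K\<^sub>n\<close> are the restrictions of the following infinite
  matrices to the index set \<open>block_index n\<close>; the index \<open>(j, a)\<close> stands for row (or column)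
  \<open>a\<close> within block row (or block column) \<open>j\<close>.\<close>

definition block_index :: "nat \<Rightarrow> (nat \<times> 'q::finite) set"
  where "block_index n = {0..n} \<times> UNIV"

definition hankel_H :: "(nat \<Rightarrow> 'q::finite cmat) \<Rightarrow> nat \<times> 'q \<Rightarrow> nat \<times> 'q \<Rightarrow> complex"
  where "hankel_H s = (\<lambda>(j, a) (k, b). s (j + k) $ a $ b)"

definition hankel_K :: "(nat \<Rightarrow> 'q::finite cmat) \<Rightarrow> nat \<times> 'q \<Rightarrow> nat \<times> 'q \<Rightarrow> complex"
  where "hankel_K s = (\<lambda>(j, a) (k, b). s (j + k + 1) $ a $ b)"

definition hankel_nonneg :: "nat \<Rightarrow> (nat \<Rightarrow> 'q::finite cmat) \<Rightarrow> bool"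
  where "hankel_nonneg n s \<longleftrightarrow> nonneg_hermitian_on (block_index n) (hankel_H s)"

definition shifted_hankel_nonneg :: "real \<Rightarrow> nat \<Rightarrow> (nat \<Rightarrow> 'q::finite cmat) \<Rightarrow> bool"
  where "shifted_hankel_nonneg \<alpha> n s \<longleftrightarrow>
    nonneg_hermitian_on (block_index n)
      (\<lambda>p r. - complex_of_real \<alpha> * hankel_H s p r + hankel_K s p r)"

definition K_ge :: "nat \<Rightarrow> real \<Rightarrow> (nat \<Rightarrow> 'q::finite cmat) set"
  where "K_ge m \<alpha> = {s.
    (m = 0 \<longrightarrow> nonneg_hermitian (s 0)) \<and>
    (\<forall>n\<ge>1. m = 2 * n \<longrightarrow> hankel_nonneg n s \<and> shifted_hankel_nonneg \<alpha> (n - 1) s) \<and>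
    (\<forall>n. m = 2 * n + 1 \<longrightarrow> hankel_nonneg n s \<and> shifted_hankel_nonneg \<alpha> n s)}"

definition shifted_seq :: "real \<Rightarrow> (nat \<Rightarrow> 'q::finite cmat) \<Rightarrow> nat \<Rightarrow> 'q cmat"
  where "shifted_seq \<alpha> s j = - (\<alpha> *\<^sub>R (if j = 0 then 0 else s (j - 1))) + s j"

fun reciprocal_seq :: "(nat \<Rightarrow> 'q::finite cmat) \<Rightarrow> nat \<Rightarrow> 'q cmat" where
  "reciprocal_seq u 0 = mp_inverse (u 0)"
| "reciprocal_seq u (Suc i) =
    - (mp_inverse (u 0) ** (\<Sum>l=0..i. u (Suc i - l) ** reciprocal_seq u l))"

definition S_transform :: "real \<Rightarrow> (nat \<Rightarrow> 'q::finite cmat) \<Rightarrow> nat \<Rightarrow> 'q cmat"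
  where "S_transform \<alpha> s j = - (s 0 ** reciprocal_seq (shifted_seq \<alpha> s) (j + 1) ** s 0)"


section \<open>Non-negative Hermitian measures\<close>

text \<open>The \<open>\<sigma>\<close>-algebra of Borel subsets of \<open>[\<alpha>,\<infinity>)\<close> is \<open>sets (half_line \<alpha>)\<close>. The values of
  a set function outside this \<open>\<sigma>\<close>-algebra are irrelevant.\<close>

definition half_line :: "real \<Rightarrow> real measure"
  where "half_line \<alpha> = restrict_space borel {\<alpha>..}"

definition nonneg_hermitian_measure :: "real \<Rightarrow> (real set \<Rightarrow> 'q::finite cmat) \<Rightarrow> bool"
  where "nonneg_hermitian_measure \<alpha> \<sigma> \<longleftrightarrow>
    (\<forall>B\<in>sets (half_line \<alpha>). nonneg_hermitian (\<sigma> B)) \<and>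
    (\<forall>B::nat \<Rightarrow> real set. range B \<subseteq> sets (half_line \<alpha>) \<longrightarrow> disjoint_family B \<longrightarrow>
      (\<lambda>n. \<sigma> (B n)) sums \<sigma> (\<Union>n. B n))"

text \<open>Integration with respect to a non-negative Hermitian measure \<open>\<sigma>\<close> is defined as usual
  through the trace measure \<open>\<tau>\<close> of \<open>\<sigma>\<close> and the matrix-valued Radon--Nikodym derivative
  of \<open>\<sigma>\<close> with respect to \<open>\<tau>\<close>, which exists and is unique up to \<open>\<tau>\<close>-null sets.
  Entrywise this is integration with respect to the complex measures formed by the
  entries of \<open>\<sigma>\<close>.\<close>

definition trace_measure :: "real \<Rightarrow> (real set \<Rightarrow> 'q::finite cmat) \<Rightarrow> real measure"
  where "trace_measure \<alpha> \<sigma> =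
    measure_of {\<alpha>..} (sets (half_line \<alpha>)) (\<lambda>B. ennreal (Re (trace (\<sigma> B))))"

definition is_trace_density ::
    "real \<Rightarrow> (real set \<Rightarrow> 'q::finite cmat) \<Rightarrow> (real \<Rightarrow> 'q cmat) \<Rightarrow> bool"
  where "is_trace_density \<alpha> \<sigma> D \<longleftrightarrow>
    integrable (trace_measure \<alpha> \<sigma>) D \<and>
    (\<forall>B\<in>sets (half_line \<alpha>). \<sigma> B = set_lebesgue_integral (trace_measure \<alpha> \<sigma>) B D)"

definition trace_density :: "real \<Rightarrow> (real set \<Rightarrow> 'q::finite cmat) \<Rightarrow> real \<Rightarrow> 'q cmat"
  where "trace_density \<alpha> \<sigma> = (SOME D. is_trace_density \<alpha> \<sigma> D)"

definition matrix_integrable ::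
    "real \<Rightarrow> (real set \<Rightarrow> 'q::finite cmat) \<Rightarrow> (real \<Rightarrow> complex) \<Rightarrow> bool"
  where "matrix_integrable \<alpha> \<sigma> f \<longleftrightarrow>
    integrable (trace_measure \<alpha> \<sigma>) (\<lambda>t. f t *\<^sub>C trace_density \<alpha> \<sigma> t)"

definition matrix_integral ::
    "real \<Rightarrow> (real set \<Rightarrow> 'q::finite cmat) \<Rightarrow> (real \<Rightarrow> complex) \<Rightarrow> 'q cmat"
  where "matrix_integral \<alpha> \<sigma> f =
    integral\<^sup>L (trace_measure \<alpha> \<sigma>) (\<lambda>t. f t *\<^sub>C trace_density \<alpha> \<sigma> t)"

definition moment_exists :: "real \<Rightarrow> (real set \<Rightarrow> 'q::finite cmat) \<Rightarrow> nat \<Rightarrow> bool"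
  where "moment_exists \<alpha> \<sigma> j \<longleftrightarrow> matrix_integrable \<alpha> \<sigma> (\<lambda>t. complex_of_real t ^ j)"

definition moment :: "real \<Rightarrow> (real set \<Rightarrow> 'q::finite cmat) \<Rightarrow> nat \<Rightarrow> 'q cmat"
  where "moment \<alpha> \<sigma> j = matrix_integral \<alpha> \<sigma> (\<lambda>t. complex_of_real t ^ j)"


section \<open>Matrix functions on the slit plane\<close>

text \<open>A function defined on the slit plane is given by a function on all of \<open>\<complex>\<close> whose values
  on \<open>[\<alpha>,\<infinity>)\<close> are irrelevant.\<close>

definition slit_plane :: "real \<Rightarrow> complex set"
  where "slit_plane \<alpha> = UNIV - complex_of_real ` {\<alpha>..}"

definition S_class :: "real \<Rightarrow> (complex \<Rightarrow> 'q::finite cmat) set"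
  where "S_class \<alpha> = {F.
    (\<forall>i j. (\<lambda>z. F z $ i $ j) holomorphic_on slit_plane \<alpha>) \<and>
    (\<forall>w. Im w > 0 \<longrightarrow> nonneg_hermitian (matrix_Im (F w))) \<and>
    (\<forall>x::real. x < \<alpha> \<longrightarrow> nonneg_hermitian (F (complex_of_real x)))}"

definition S0_class :: "real \<Rightarrow> (complex \<Rightarrow> 'q::finite cmat) set"
  where "S0_class \<alpha> = {F \<in> S_class \<alpha>.
    bdd_above ((\<lambda>y::real. y * operator_norm (F (\<i> * complex_of_real y))) ` {1..})}"

definition represents ::
    "real \<Rightarrow> (real set \<Rightarrow> 'q::finite cmat) \<Rightarrow> (complex \<Rightarrow> 'q cmat) \<Rightarrow> bool"
  where "represents \<alpha> \<sigma> F \<longleftrightarrow> nonneg_hermitian_measure \<alpha> \<sigma> \<and>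
    (\<forall>z\<in>slit_plane \<alpha>. F z = matrix_integral \<alpha> \<sigma> (\<lambda>t. inverse (complex_of_real t - z)))"

text \<open>For \<open>F\<close> in \<open>S0_class \<alpha>\<close> the representing measure exists and is uniquely determined on
  \<open>sets (half_line \<alpha>)\<close>; since its values on other sets are not determined, it is chosen
  with \<open>SOME\<close> instead of \<open>THE\<close>.\<close>

definition stieltjes_measure :: "real \<Rightarrow> (complex \<Rightarrow> 'q::finite cmat) \<Rightarrow> real set \<Rightarrow> 'q cmat"
  where "stieltjes_measure \<alpha> F = (SOME \<sigma>. represents \<alpha> \<sigma> F)"

definition S_class_le :: "real \<Rightarrow> nat \<Rightarrow> (nat \<Rightarrow> 'q::finite cmat) \<Rightarrow> (complex \<Rightarrow> 'q cmat) set"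
  where "S_class_le \<alpha> n t = {F \<in> S0_class \<alpha>.
    (\<forall>j\<le>n. moment_exists \<alpha> (stieltjes_measure \<alpha> F) j) \<and>
    (\<forall>j<n. moment \<alpha> (stieltjes_measure \<alpha> F) j = t j) \<and>
    nonneg_hermitian (t n - moment \<alpha> (stieltjes_measure \<alpha> F) n)}"

definition plus_transform ::
    "real \<Rightarrow> 'q::finite cmat \<Rightarrow> (complex \<Rightarrow> 'q cmat) \<Rightarrow> complex \<Rightarrow> 'q cmat"
  where "plus_transform \<alpha> A F z =
    - (A ** (mat 1 + inverse (z - complex_of_real \<alpha>) *\<^sub>C (mp_inverse (F z) ** A)))"

end

theory Submission
  imports Defs "HOL-Probability.Probability" "HOL-Complex_Analysis.Complex_Analysis"
begin

text \<open>Let \<open>\<sigma>\<close> represent \<open>F\<close>, put \<open>M z = (z - \<alpha>) F z\<close> and let \<open>s0\<close> be the total mass of \<open>\<sigma>\<close>. Then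
  \<open>M = N - s0\<close>, where \<open>N\<close> is the integral of \<open>(t - \<alpha>) / (t - z)\<close>, and the transform is
  \<open>G = - s0 - s0 M\<^sup>\<dagger> s0 = N - N M\<^sup>\<dagger> N\<close>. The first form shows that \<open>Im G\<close> is non-negative in the upper
  half-plane, the second one that \<open>G\<close> is non-negative on \<open>(-\<infinity>, \<alpha>)\<close>. As \<open>z \<rightarrow> -\<infinity>\<close>, the moments of \<open>\<sigma>\<close> are
  the coefficients of an asymptotic expansion of \<open>F\<close>, inverting it gives the expansion of \<open>G\<close> whose
  coefficients are the \<open>\<alpha>\<close>-S-transform of the moments, and an expansion of \<open>G\<close> up to some order forces the
  corresponding moments of its measure to exist. Replacing the last moment of \<open>\<sigma>\<close> by a larger matrix
  changes the last coefficient by \<open>P \<Delta> P\<close> with \<open>\<Delta> \<ge> 0\<close>, \<open>P\<close> being the projection onto the range of \<open>s0\<close>.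

  The existence of representing measures is reduced to the Hausdorff moment problem on \<open>[0, 1]\<close>, which is
  solved by weak limits of discrete measures with Bernstein weights; the scalar measures of the quadratic
  forms of \<open>F\<close> are assembled to a matrix measure by polarization and uniqueness.\<close>



section \<open>Positivity of the Taylor coefficients\<close>

text \<open>The Moore-Penrose inverse is discontinuous in general. It is tame here because range and
  kernel of \<open>F z\<close> do not depend on \<open>z\<close>: they are those of
  \<open>s0\<close>, so \<open>mp_inverse (F z)\<close> is an honest inverse on one fixed subspace.
  This yields holomorphy of the transform and the identities
  \<open>M z ** X z = P = X z ** M z\<close> behind both forms of \<open>G\<close>. A finite first
  moment, available since m is positive, makes \<open>N\<close> decay like \<open>1 / y\<close> at
  \<open>\<i> y\<close>, and with it \<open>G = - s0 X N\<close>. Membership in the target class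
  speaks of the measure that \<open>stieltjes_measure\<close> selects, and nothing is known about
  this selection until some representing measure exists. So the integral representation is needed
  for \<open>F\<close> and again for \<open>G\<close>. In the scalar case no boundary behaviour at
  the cut is given; positivity of the functional built from Taylor coefficients is therefore
  obtained from contours off the cut, and the growth bound enters afterwards, to deal with the point
  that corresponds to infinity.\<close>

lemma boundary_limit:
  fixes F \<Phi> :: "complex \<Rightarrow> complex" and J :: "real set"
  assumes J: "convex J" "open J"
    and hol: "\<Phi> holomorphic_on {z. Re z \<in> J}"
    and real: "\<And>x. x \<in> J \<Longrightarrow> Im (\<Phi> (of_real x)) = 0"
    and F: "\<And>z. Im z > 0 \<Longrightarrow> (F has_field_derivative \<Phi> z) (at z)"
  obtains l \<kappa> where "\<And>x. x \<in> J \<Longrightarrow> (F \<longlongrightarrow> l x) (at (of_real x) within {z. Im z > 0})"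
    and "\<And>x. x \<in> J \<Longrightarrow> Im (l x) = \<kappa>"
proof -
  let ?D = "{z. Re z \<in> J}" and ?H = "{z. Im z > 0}"
  have D: "?D = Re -` J" by auto
  have oD: "open ?D" unfolding D by (intro continuous_open_vimage J continuous_intros)
  have cD: "convex ?D" unfolding D by (intro convex_linear_vimage J bounded_linear.linear bounded_linear_Re)
  have oH: "open ?H" and cH: "convex ?H"
    by (simp_all add: open_halfspace_Im_gt convex_halfspace_Im_gt)
  \<comment> \<open>\<open>F\<close> is controlled only above the axis, while \<open>\<Phi>\<close>
    is holomorphic across it on the convex strip over \<open>J\<close>. A primitive on the strip
    extends \<open>F\<close> up to a constant, and its imaginary part is constant on
    \<open>J\<close> because \<open>\<Phi>\<close> is real there.\<close>
  obtain G where G: "\<And>z. z \<in> ?D \<Longrightarrow> (G has_field_derivative \<Phi> z) (at z within ?D)"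
    using holomorphic_convex_primitive'[OF cD oD hol] by blast
  have G': "(G has_field_derivative \<Phi> z) (at z)" if "z \<in> ?D" for z
    using G[OF that] at_within_open[OF that oD] by simp
  have "((\<lambda>z. F z - G z) has_field_derivative 0) (at z within ?D \<inter> ?H)" if "z \<in> ?D \<inter> ?H" for z
  proof -
    have "((\<lambda>z. F z - G z) has_field_derivative \<Phi> z - \<Phi> z) (at z)"
      using that by (intro DERIV_diff F G') auto
    then show ?thesis by (simp add: has_field_derivative_at_within)
  qed
  then obtain c where c: "\<And>z. z \<in> ?D \<inter> ?H \<Longrightarrow> F z - G z = c"
    using has_field_derivative_zero_constant[of "?D \<inter> ?H" "\<lambda>z. F z - G z", OF convex_Int[OF cD cH]]
    by blast
  have c': "G z + c = F z" if "z \<in> ?D" "z \<in> ?H" for z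
  proof -
    have "F z - G z = c" using c that by blast
    then show ?thesis by (simp add: algebra_simps)
  qed
  have "((\<lambda>x. Im (G (of_real x))) has_field_derivative 0) (at x within J)" if "x \<in> J" for x
  proof -
    have "((\<lambda>x. G (of_real x)) has_vector_derivative \<Phi> (of_real x)) (at x)"
      using has_vector_derivative_real_field[OF G', of x UNIV] that by simp
    then have "((\<lambda>x. Im (G (of_real x))) has_vector_derivative Im (\<Phi> (of_real x))) (at x)"
      by (rule bounded_linear.has_vector_derivative[OF bounded_linear_Im])
    then show ?thesis using real[OF that]
      by (simp add: has_real_derivative_iff_has_vector_derivative has_vector_derivative_at_within)
  qed
  then obtain k where k: "\<And>x. x \<in> J \<Longrightarrow> Im (G (of_real x)) = k"
    using has_field_derivative_zero_constant[OF J(1), of "\<lambda>x. Im (G (of_real x))"] by blast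
  show ?thesis
  proof (rule that[of "\<lambda>x. G (of_real x) + c" "k + Im c"])
    fix x assume x: "x \<in> J"
    show "Im (G (of_real x) + c) = k + Im c" using k[OF x] by simp
    have "isCont G (of_real x)" using G'[of "of_real x"] x DERIV_isCont by fastforce
    then have "((\<lambda>z. G z + c) \<longlongrightarrow> G (of_real x) + c) (at (of_real x) within ?H)"
      unfolding isCont_def by (intro tendsto_intros) (rule tendsto_within_subset, auto)
    moreover have "eventually (\<lambda>z. G z + c = F z) (at (of_real x) within ?H)"
    proof -
      have "eventually (\<lambda>z. z \<in> ?D \<and> z \<in> ?H) (at (of_real x) within ?H)"
        unfolding eventually_at_topological by (rule exI[of _ ?D]) (use oD x in simp)
      then show ?thesis by (rule eventually_mono) (use c' in blast)
    qed
    ultimately show "(F \<longlongrightarrow> G (of_real x) + c) (at (of_real x) within ?H)"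
      by (rule Lim_transform_eventually)
  qed
qed

text \<open>On the semicircle of radius \<open>R\<close> one has \<open>dz = \<i> z dt\<close>, so
  the imaginary part of the integral of \<open>z ^ k * g z\<close> is the integral of
  \<open>Re (z ^ (k+1) * g z)\<close> over \<open>[0, pi]\<close>. With real coefficients this is a
  cosine series with integer frequencies, and only the constant term, \<open>j = k + 1\<close>,
  survives the integration.\<close>

lemma semicircle_integral:
  fixes F g :: "complex \<Rightarrow> complex" and a :: "nat \<Rightarrow> complex"
  assumes F: "\<And>z. Im z > 0 \<Longrightarrow> (F has_field_derivative z ^ k * g z) (at z)"
    and R: "R > 1"
    and a: "\<And>z. norm z > 1 \<Longrightarrow> (\<lambda>j. a j * inverse z ^ j) sums g z"
    and ar: "\<And>j. Im (a j) = 0"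
    and l: "(F \<longlongrightarrow> l) (at (of_real R) within {z. Im z > 0})"
           "(F \<longlongrightarrow> l') (at (- of_real R) within {z. Im z > 0})"
  shows "Im l' - Im l = pi * Re (a (k + 1))"
proof -
  let ?H = "{z. Im z > 0}"
  define c where "c t = of_real R * cis t" for t :: real
  have R0: "R > 0" using R by simp
  have nc: "norm (c t) = R" for t using R0 by (simp add: c_def norm_mult)
  \<comment> \<open>The end points of the arc lie on the real axis, where the values of
    \<open>F\<close> are arbitrary; they are replaced by the boundary limits.\<close>
  define E where "E t = (if t = 0 then Im l else if t = pi then Im l' else Im (F (c t)))" for t
  define \<phi> where "\<phi> t = Re (c t ^ (k+1) * g (c t))" for t
  have Hc: "c t \<in> ?H" if "0 < t" "t < pi" for t
    using that R0 by (simp add: c_def sin_gt_zero)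
  have der: "((\<lambda>t. Im (F (c t))) has_vector_derivative \<phi> t) (at t)" if "0 < t" "t < pi" for t
  proof -
    have "((\<lambda>z. of_real R * exp (\<i> * z)) has_field_derivative \<i> * c t) (at (of_real t))"
      unfolding c_def cis_conv_exp by (auto intro!: derivative_eq_intros)
    then have "(c has_vector_derivative \<i> * c t) (at t)"
      unfolding c_def cis_conv_exp
      by (rule has_vector_derivative_real_field)
    then have "((F \<circ> c) has_vector_derivative (\<i> * c t) * (c t ^ k * g (c t))) (at t)"
      by (rule field_vector_diff_chain_at) (use F Hc that in auto)
    then have "((\<lambda>t. Im (F (c t))) has_vector_derivative Im ((\<i> * c t) * (c t ^ k * g (c t)))) (at t)"
      unfolding o_def by (rule bounded_linear.has_vector_derivative[OF bounded_linear_Im])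
    then show ?thesis by (simp add: \<phi>_def algebra_simps)
  qed
  have cont_c: "isCont c t" for t unfolding c_def cis_conv_exp by (intro continuous_intros)
  have lim: "((\<lambda>t. Im (F (c t))) \<longlongrightarrow> Im w) (at t0 within {0<..<pi})"
    if "(F \<longlongrightarrow> w) (at (c t0) within ?H)" "t0 = 0 \<or> t0 = pi" for t0 w
  proof -
    have "filterlim c (at (c t0) within ?H) (at t0 within {0<..<pi})"
    unfolding filterlim_at
    proof (intro conjI)
      show "(c \<longlongrightarrow> c t0) (at t0 within {0<..<pi})"
        using cont_c[of t0] unfolding isCont_def by (rule tendsto_within_subset) simp
      have *: "c t \<in> ?H \<and> c t \<noteq> c t0" if "t \<in> {0<..<pi}" for t
        using Hc[of t] that \<open>t0 = 0 \<or> t0 = pi\<close> by (auto simp: c_def complex_eq_iff)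
      have "eventually (\<lambda>t. t \<in> {0<..<pi}) (at t0 within {0<..<pi})"
        by (simp add: eventually_at_filter)
      then show "eventually (\<lambda>t. c t \<in> ?H \<and> c t \<noteq> c t0) (at t0 within {0<..<pi})"
        by eventually_elim (use * in blast)
    qed
    from filterlim_compose[OF that(1) this] show ?thesis by (intro tendsto_intros)
  qed
  have contE: "continuous_on {0..pi} E"
  proof (rule continuous_on_IccI)
    have ev: "eventually (\<lambda>t. Im (F (c t)) = E t) (at t0 within {0<..<pi})" for t0
      by (auto simp: E_def eventually_at_filter)
    have E0: "E 0 = Im l" "E pi = Im l'" by (simp_all add: E_def)
    have "((\<lambda>t. Im (F (c t))) \<longlongrightarrow> Im l) (at 0 within {0<..<pi})"
      using lim[of l 0] l(1) by (simp add: c_def)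
    from Lim_transform_eventually[OF this ev] show "(E \<longlongrightarrow> E 0) (at_right 0)"
      unfolding E0
      by (subst at_within_nhd[of 0 "{..<pi}" "{0<..}" "{0<..<pi}"]) auto
    have "((\<lambda>t. Im (F (c t))) \<longlongrightarrow> Im l') (at pi within {0<..<pi})"
      using lim[of l' pi] l(2) by (simp add: c_def)
    from Lim_transform_eventually[OF this ev] show "(E \<longlongrightarrow> E pi) (at_left pi)"
      unfolding E0
      by (subst at_within_nhd[of pi "{0<..}" "{..<pi}" "{0<..<pi}"]) auto
    fix t assume t: "0 < t" "t < pi"
    have "isCont (\<lambda>t. Im (F (c t))) t"
      using der[OF t] by (rule has_vector_derivative_continuous)
    then have "((\<lambda>t. Im (F (c t))) \<longlongrightarrow> E t) (at t)"
      using t by (simp add: isCont_def E_def)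
    moreover have "eventually (\<lambda>s. s \<in> {0<..<pi}) (at t)"
      using t by (intro eventually_at_in_open') auto
    then have "eventually (\<lambda>s. Im (F (c s)) = E s) (at t)" by eventually_elim (auto simp: E_def)
    ultimately show "(E \<longlongrightarrow> E t) (at t)" by (rule Lim_transform_eventually)
  qed simp
  have "(\<phi> has_integral (E pi - E 0)) {0..pi}"
  proof (rule fundamental_theorem_of_calculus_interior[OF _ contE])
    fix t assume "t \<in> {0<..<pi}"
    then have t: "0 < t" "t < pi" by auto
    show "(E has_vector_derivative \<phi> t) (at t)"
      by (rule has_vector_derivative_transform_within_open[OF der[OF t], of "{0<..<pi}"])
        (use t in \<open>auto simp: E_def\<close>)
  qed auto
  moreover have "(\<phi> has_integral (pi * Re (a (k+1)))) {0..pi}"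
  proof -
    define w where "w j = Re (a j) * R ^ (k+1) * inverse R ^ j" for j
    define d where "d j = real (k+1) - real j" for j
    define f where "f j t = w j * cos (d j * t)" for j t
    have sums: "(\<lambda>j. f j t) sums \<phi> t" for t
    proof -
      have "(\<lambda>j. Re (c t ^ (k+1) * (a j * inverse (c t) ^ j))) sums \<phi> t"
        unfolding \<phi>_def using a[of "c t"] nc R by (intro sums_Re sums_mult) auto
      moreover have "Re (c t ^ (k+1) * (a j * inverse (c t) ^ j)) = f j t" for j
      proof -
        have "c t ^ (k+1) * (a j * inverse (c t) ^ j) = 
            a j * of_real (R ^ (k+1) * inverse R ^ j) * (cis t ^ (k+1) * cis (-t) ^ j)"
          unfolding c_def power_mult_distrib inverse_mult_distrib
          by (simp add: cis_inverse of_real_inverse mult_ac del: power_Suc)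
        also have "cis t ^ (k+1) * cis (-t) ^ j = cis (d j * t)"
        proof -
          have "cis t ^ (k+1) = cis (real (k+1) * t)" "cis (-t) ^ j = cis (real j * (-t))"
            by (rule Complex.DeMoivre)+
          then show ?thesis
            by (simp only: cis_mult) (simp add: d_def left_diff_distrib)
        qed
        finally have e: "c t ^ (k+1) * (a j * inverse (c t) ^ j) = 
            a j * of_real (R ^ (k+1) * inverse R ^ j) * cis (d j * t)" .
        have "Re (a j * of_real r * cis x) = Re (a j) * r * cos x" for r x
          using ar[of j] by simp
        then show ?thesis unfolding e f_def w_def by (simp only: mult.assoc)
      qed
      ultimately show ?thesis by simp
    qed
    \<comment> \<open>The series converges at the smaller radius \<open>(1 + R) / 2\<close>, still
      greater than 1; this gives absolute convergence at \<open>R\<close> and hence a majorant that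
      is uniform in \<open>t\<close>.\<close>
    have "summable (\<lambda>j. norm (a j * inverse (of_real R) ^ j))"
    proof (rule powser_insidea)
      show "summable (\<lambda>j. a j * inverse (of_real ((1+R)/2)) ^ j)"
        using a[of "of_real ((1+R)/2)"] R by (intro sums_summable[of _ "g (of_real ((1+R)/2))"] a) (simp only: norm_of_real, simp)
      show "norm (inverse (of_real R) :: complex) < norm (inverse (of_real ((1 + R) / 2)) :: complex)"
        using R unfolding norm_inverse norm_of_real by (simp add: field_simps)
    qed
    then have "summable (\<lambda>j. norm (a j * inverse (of_real R) ^ j) * R ^ (k+1))"
      by (rule summable_mult2)
    then have "uniform_limit {0..pi} (\<lambda>n t. \<Sum>j<n. f j t) (\<lambda>t. suminf (\<lambda>j. f j t)) sequentially"
    proof (rule Weierstrass_m_test[rotated])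
      fix j t
      have "\<bar>f j t\<bar> \<le> \<bar>w j\<bar>" by (simp add: f_def abs_mult mult_left_le)
      also have "\<dots> \<le> norm (a j * inverse (of_real R) ^ j) * R ^ (k+1)"
        using R0 abs_Re_le_cmod[of "a j"]
        by (simp add: w_def abs_mult norm_mult norm_power norm_inverse mult_right_mono)
      finally show "norm (f j t) \<le> norm (a j * inverse (of_real R) ^ j) * R ^ (k+1)" by simp
    qed
    then have U: "uniform_limit {0..pi} (\<lambda>n t. \<Sum>j<n. f j t) \<phi> sequentially"
      using sums by (simp add: sums_iff)
    have If: "(f j has_integral (if j = k + 1 then pi * Re (a (k+1)) else 0)) {0..pi}" for j
    proof (cases "j = k + 1")
      case True
      then have "f j = (\<lambda>t. Re (a (k+1)))" using R0 by (simp add: f_def w_def d_def fun_eq_iff field_simps)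
      then show ?thesis using True has_integral_const_real[of "Re (a (k+1))" 0 pi] by simp
    next
      case False
      then have d0: "d j \<noteq> 0" by (simp add: d_def)
      have "sin (d j * pi) = 0"
        unfolding sin_times_pi_eq_0 d_def by (intro Ints_diff Ints_of_nat)
      moreover have "(f j has_integral (w j * sin (d j * pi) / d j - w j * sin (d j * 0) / d j)) {0..pi}"
        by (rule fundamental_theorem_of_calculus)
          (use d0 in \<open>auto intro!: derivative_eq_intros simp: f_def simp flip: has_real_derivative_iff_has_vector_derivative\<close>)
      ultimately show ?thesis using False by simp
    qed
    have Iu: "((\<lambda>t. \<Sum>j<n. f j t) has_integral (if k + 1 < n then pi * Re (a (k+1)) else 0)) {0..pi}" for n
    proof -
      have "((\<lambda>t. \<Sum>j<n. f j t) has_integral (\<Sum>j<n. if j = k + 1 then pi * Re (a (k+1)) else 0)) {0..pi}"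
        by (intro has_integral_sum If) auto
      then show ?thesis by simp
    qed
    have cu: "continuous_on {0..pi} (\<lambda>t. \<Sum>j<n. f j t)" for n
      unfolding f_def by (intro continuous_intros)
    from uniform_limit_integral[OF U cu] obtain I K where IK: "\<And>n. ((\<lambda>t. \<Sum>j<n. f j t) has_integral I n) {0..pi}"
      "(\<phi> has_integral K) {0..pi}" "I \<longlonglongrightarrow> K" by auto
    have I: "I n = (if k + 1 < n then pi * Re (a (k+1)) else 0)" for n
      using IK(1) Iu has_integral_unique by blast
    have "eventually (\<lambda>n. I n = pi * Re (a (k+1))) sequentially"
      using eventually_gt_at_top[of "k+1"] by eventually_elim (simp add: I)
    then have "K = pi * Re (a (k+1))" using IK(3) LIMSEQ_unique tendsto_eventually by blast
    then show ?thesis using IK(2) by simp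
  qed
  ultimately have "E pi - E 0 = pi * Re (a (k+1))" by (rule has_integral_unique)
  then show ?thesis by (simp add: E_def)
qed

text \<open>The coefficient sum is the integral of \<open>p g\<close> over a path in the upper half-plane from \<open>B\<close> to \<open>A\<close>,
  here expressed by primitives. On the line \<open>Im w = h\<close> the real polynomial \<open>p (Re w)\<close> is rewritten by
  \<open>x^n = (w - \<i> h)^n\<close>; all terms but the leading one vanish as \<open>h \<rightarrow> 0\<close>, so no growth bound for \<open>g\<close>
  near \<open>[0, 1]\<close> is needed.\<close>

lemma laurent_coefficients_nonneg_aux:
  fixes g :: "complex \<Rightarrow> complex" and a :: "nat \<Rightarrow> complex" and p :: "real poly"
  assumes hol: "g holomorphic_on - (of_real ` {0..1})"
    and neg: "\<And>z. Im z > 0 \<Longrightarrow> Im (g z) \<le> 0"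
    and real: "\<And>x. x \<notin> {0..1} \<Longrightarrow> Im (g (of_real x)) = 0"
    and a: "\<And>z. norm z > 1 \<Longrightarrow> (\<lambda>j. a j * inverse z ^ j) sums g z"
    and ar: "\<And>j. Im (a j) = 0"
    and AB: "A < 0" "1 < B"
    and p: "\<And>x. x \<in> {A..B} \<Longrightarrow> poly p x \<ge> 0"
  shows "0 \<le> (\<Sum>n\<le>degree p. coeff p n * Re (a (n + 1)))"
proof -
  let ?H = "{z::complex. Im z > 0}"
  have hol': "(\<lambda>z. z ^ k * g z) holomorphic_on S" if "\<And>z. z \<in> S \<Longrightarrow> z \<notin> of_real ` {0..1}" for S k
    using that by (intro holomorphic_intros holomorphic_on_subset[OF hol]) auto
  have real': "Im (of_real x ^ k * g (of_real x)) = 0" if "x \<notin> {0..1}" for x :: real and k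
    using real[OF that] by (simp flip: of_real_power)
  have "\<exists>F. \<forall>z. Im z > 0 \<longrightarrow> (F has_field_derivative z ^ k * g z) (at z)" for k
  proof -
    have o: "open ?H" by (simp add: open_halfspace_Im_gt)
    have h: "(\<lambda>z. z ^ k * g z) holomorphic_on ?H" by (rule hol') auto
    obtain F where "\<And>z. z \<in> ?H \<Longrightarrow> (F has_field_derivative z ^ k * g z) (at z within ?H)"
      using holomorphic_convex_primitive'[OF convex_halfspace_Im_gt o h] by blast
    then show ?thesis using at_within_open[OF _ o] by (intro exI[of _ F]) auto
  qed
  then obtain F where F: "\<And>k z. Im z > 0 \<Longrightarrow> (F k has_field_derivative z ^ k * g z) (at z)"
    by metis
  have "\<exists>l \<kappa>. \<forall>x<0. (F k \<longlongrightarrow> l x) (at (of_real x) within ?H) \<and> Im (l x) = \<kappa>" for k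
  proof -
    have R: "Im (of_real x ^ k * g (of_real x)) = 0" if "x \<in> {..<0}" for x using real'[of x k] that by simp
    have h: "(\<lambda>z. z ^ k * g z) holomorphic_on {z. Re z \<in> {..<0}}" by (rule hol') auto
    have "convex {..<0::real}" "open {..<0::real}" by auto
    then obtain l \<kappa> where "\<And>x. x \<in> {..<0} \<Longrightarrow> (F k \<longlongrightarrow> l x) (at (of_real x) within ?H)"
        "\<And>x. x \<in> {..<0} \<Longrightarrow> Im (l x) = \<kappa>"
      using boundary_limit[OF _ _ h R F] by blast
    then show ?thesis by (intro exI[of _ l] exI[of _ \<kappa>]) auto
  qed
  then obtain l \<kappa> where l: "\<And>k x. x < 0 \<Longrightarrow> (F k \<longlongrightarrow> l k x) (at (of_real x) within ?H)" "\<And>k x. x < 0 \<Longrightarrow> Im (l k x) = \<kappa> k"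
    by metis
  have "\<exists>l \<kappa>. \<forall>x>1. (F k \<longlongrightarrow> l x) (at (of_real x) within ?H) \<and> Im (l x) = \<kappa>" for k
  proof -
    have R: "Im (of_real x ^ k * g (of_real x)) = 0" if "x \<in> {1<..}" for x using real'[of x k] that by simp
    have h: "(\<lambda>z. z ^ k * g z) holomorphic_on {z. Re z \<in> {1<..}}" by (rule hol') auto
    have "convex {1::real<..}" "open {1::real<..}" by auto
    then obtain l \<kappa> where "\<And>x. x \<in> {1<..} \<Longrightarrow> (F k \<longlongrightarrow> l x) (at (of_real x) within ?H)"
        "\<And>x. x \<in> {1<..} \<Longrightarrow> Im (l x) = \<kappa>"
      using boundary_limit[OF _ _ h R F] by blast
    then show ?thesis by (intro exI[of _ l] exI[of _ \<kappa>]) auto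
  qed
  then obtain l' \<kappa>' where l': "\<And>k x. x > 1 \<Longrightarrow> (F k \<longlongrightarrow> l' k x) (at (of_real x) within ?H)" "\<And>k x. x > 1 \<Longrightarrow> Im (l' k x) = \<kappa>' k"
    by metis
  \<comment> \<open>The boundary values of \<open>Im (F k)\<close> are constant on each of the two
    real half-lines, so the semicircle of radius 2 also yields the jump between \<open>A\<close> and
    \<open>B\<close>, which may be as close to \<open>[0, 1]\<close> as desired.\<close>
  have jump: "Im (l k A) - Im (l' k B) = pi * Re (a (k + 1))" for k
  proof -
    have "Im (l k (-2)) - Im (l' k 2) = pi * Re (a (k + 1))"
      by (rule semicircle_integral[OF F _ a ar, where R = 2]) (use l(1)[of "-2" k] l'(1)[of 2 k] in auto)
    then show ?thesis using l(2) l'(2) AB by simp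
  qed
  define T where "T n h = (\<Sum>k\<le>n. of_nat (n choose k) * (- (\<i> * of_real h)) ^ (n - k) *
      (F k (of_real B + \<i> * of_real h) - F k (of_real A + \<i> * of_real h)))" for n and h :: real
  have int: "((\<lambda>x. of_real x ^ n * g (of_real x + \<i> * of_real h)) has_integral T n h) {A..B}"
    if h: "h > 0" for n h
  proof -
    let ?z = "\<lambda>x. of_real x + \<i> * of_real h"
    have "((\<lambda>x. ?z x ^ k * g (?z x)) has_integral (F k (?z B) - F k (?z A))) {A..B}" for k
    proof (rule fundamental_theorem_of_calculus)
      fix x assume "x \<in> {A..B}"
      have "((\<lambda>w. F k (w + \<i> * of_real h)) has_field_derivative ?z x ^ k * g (?z x)) (at (of_real x))"
        using F[of "?z x" k] h by (simp add: DERIV_shift)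
      then show "((\<lambda>x. F k (?z x)) has_vector_derivative ?z x ^ k * g (?z x)) (at x within {A..B})"
        by (rule has_vector_derivative_real_field)
    qed (use AB in auto)
    then have "((\<lambda>x. \<Sum>k\<le>n. (of_nat (n choose k) * (- (\<i> * of_real h)) ^ (n - k)) * (?z x ^ k * g (?z x))) has_integral T n h) {A..B}"
      unfolding T_def by (intro has_integral_sum has_integral_mult_right) auto
    moreover have "(\<Sum>k\<le>n. (of_nat (n choose k) * (- (\<i> * of_real h)) ^ (n - k)) * (?z x ^ k * g (?z x))) = of_real x ^ n * g (?z x)" for x
    proof -
      have "of_real x ^ n = (?z x + (- (\<i> * of_real h))) ^ n" by simp
      also have "\<dots> = (\<Sum>k\<le>n. of_nat (n choose k) * ?z x ^ k * (- (\<i> * of_real h)) ^ (n - k))"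
        by (rule binomial_ring)
      finally have e: "of_real x ^ n = (\<Sum>k\<le>n. of_nat (n choose k) * ?z x ^ k * (- (\<i> * of_real h)) ^ (n - k))" .
      show ?thesis unfolding e sum_distrib_right by (intro sum.cong refl) (simp only: mult_ac)
    qed
    ultimately show ?thesis by simp
  qed
  have limF: "((\<lambda>h. F k (of_real x + \<i> * of_real h)) \<longlongrightarrow> L) (at_right 0)"
    if "(F k \<longlongrightarrow> L) (at (of_real x) within ?H)" for k x L
  proof -
    have "filterlim (\<lambda>h. of_real x + \<i> * of_real h) (at (of_real x) within ?H) (at_right 0)"
      unfolding filterlim_at
    proof
      show "\<forall>\<^sub>F h in at_right 0. of_real x + \<i> * of_real h \<in> ?H \<and> of_real x + \<i> * of_real h \<noteq> complex_of_real x"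
        using eventually_at_right_less[of "0::real"] by eventually_elim auto
      have "((\<lambda>h. of_real x + \<i> * of_real h) \<longlongrightarrow> of_real x + \<i> * of_real 0) (at_right 0)"
        by (intro tendsto_intros)
      then show "((\<lambda>h. of_real x + \<i> * of_real h) \<longlongrightarrow> complex_of_real x) (at_right 0)" by simp
    qed
    from filterlim_compose[OF that this] show ?thesis .
  qed
  have limT: "(T n \<longlongrightarrow> l' n B - l n A) (at_right 0)" for n
  proof -
    have "(T n \<longlongrightarrow> (\<Sum>k\<le>n. of_nat (n choose k) * (- (\<i> * of_real 0)) ^ (n - k) * (l' k B - l k A))) (at_right 0)"
      unfolding T_def by (intro tendsto_intros limF l(1) l'(1) AB)
    also have "(\<Sum>k\<le>n. of_nat (n choose k) * (- (\<i> * of_real 0)) ^ (n - k) * (l' k B - l k A)) = 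
        (\<Sum>k\<le>n. if k = n then l' n B - l n A else 0)"
      by (intro sum.cong) auto
    finally show ?thesis by simp
  qed
  let ?S = "\<lambda>h. \<Sum>n\<le>degree p. of_real (coeff p n) * T n h"
  have lim: "((\<lambda>h. Im (?S h)) \<longlongrightarrow> (\<Sum>n\<le>degree p. coeff p n * Im (l' n B - l n A))) (at_right 0)"
    by (simp del: minus_complex.sel) (intro tendsto_intros limT)
  have "eventually (\<lambda>h. Im (?S h) \<le> 0) (at_right 0)"
    using eventually_at_right_less[of "0::real"]
  proof eventually_elim
    case (elim h)
    let ?z = "\<lambda>x. of_real x + \<i> * of_real h"
    have "((\<lambda>x. \<Sum>n\<le>degree p. of_real (coeff p n) * (of_real x ^ n * g (?z x))) has_integral ?S h) {A..B}"
      by (intro has_integral_sum has_integral_mult_right int elim) auto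
    moreover have "(\<Sum>n\<le>degree p. of_real (coeff p n) * (of_real x ^ n * g (?z x))) = of_real (poly p x) * g (?z x)" for x
      by (simp add: poly_altdef sum_distrib_right mult.assoc)
    ultimately have "((\<lambda>x. of_real (poly p x) * g (?z x)) has_integral ?S h) {A..B}" by simp
    then have "((\<lambda>x. Im (of_real (poly p x) * g (?z x))) has_integral Im (?S h)) {A..B}"
      by (rule has_integral_Im)
    then show "Im (?S h) \<le> 0"
      by (rule has_integral_le[OF _ has_integral_0]) (use p neg elim in \<open>auto intro!: mult_nonneg_nonpos\<close>)
  qed
  with lim have "(\<Sum>n\<le>degree p. coeff p n * Im (l' n B - l n A)) \<le> 0"
    by (intro tendsto_upperbound[OF lim]) auto
  also have "(\<Sum>n\<le>degree p. coeff p n * Im (l' n B - l n A)) = - (pi * (\<Sum>n\<le>degree p. coeff p n * Re (a (n + 1))))"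
    unfolding sum_distrib_left sum_negf[symmetric]
  proof (rule sum.cong)
    fix n
    have "Im (l' n B - l n A) = - (pi * Re (a (n + 1)))" using jump[of n] by simp
    then show "coeff p n * Im (l' n B - l n A) = - (pi * (coeff p n * Re (a (n + 1))))" by simp
  qed simp
  finally show ?thesis using pi_gt_zero by (auto simp: zero_le_mult_iff)
qed

text \<open>The preceding result needs \<open>p\<close> to be non-negative on an interval reaching
  beyond \<open>[0, 1]\<close>. Adding a small constant to \<open>p\<close> achieves this by
  continuity at 0 and 1, at the cost of a multiple of \<open>Re (a 1)\<close>.\<close>

lemma laurent_coefficients_nonneg:
  fixes g :: "complex \<Rightarrow> complex" and a :: "nat \<Rightarrow> complex" and p :: "real poly"
  assumes hol: "g holomorphic_on - (of_real ` {0..1})"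
    and neg: "\<And>z. Im z > 0 \<Longrightarrow> Im (g z) \<le> 0"
    and real: "\<And>x. x \<notin> {0..1} \<Longrightarrow> Im (g (of_real x)) = 0"
    and a: "\<And>z. norm z > 1 \<Longrightarrow> (\<lambda>j. a j * inverse z ^ j) sums g z"
    and ar: "\<And>j. Im (a j) = 0"
    and p: "\<And>x. x \<in> {0..1} \<Longrightarrow> poly p x \<ge> 0"
  shows "0 \<le> (\<Sum>n\<le>degree p. coeff p n * Re (a (n + 1)))"
proof (rule field_le_epsilon)
  let ?L = "\<lambda>p. \<Sum>n\<le>degree p. coeff p n * Re (a (n + 1))"
  fix e :: real assume e: "e > 0"
  \<comment> \<open>Chosen such that the error \<open>\<eta> * Re (a 1)\<close> is at most
    \<open>e\<close>; the summand 1 avoids a division by zero.\<close>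
  define \<eta> where "\<eta> = e / (1 + \<bar>Re (a 1)\<bar>)"
  have \<eta>: "\<eta> > 0" using e by (simp add: \<eta>_def)
  let ?q = "p + [:\<eta>:]"
  have near: "\<exists>d>0. \<forall>x. \<bar>x - y\<bar> < d \<longrightarrow> poly ?q x \<ge> 0" if "y \<in> {0..1}" for y
  proof -
    have "isCont (poly p) y" by simp
    then obtain d where d: "d > 0" "\<And>x. \<bar>x - y\<bar> < d \<Longrightarrow> \<bar>poly p x - poly p y\<bar> < \<eta>"
      using \<eta> by (auto simp: continuous_at_eps_delta dist_real_def)
    show ?thesis using d p[OF that] by (intro exI[of _ d]) fastforce
  qed
  obtain d where d: "d > 0" "\<And>x. \<bar>x\<bar> < d \<Longrightarrow> poly ?q x \<ge> 0" using near[of 0] by auto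
  obtain d' where d': "d' > 0" "\<And>x. \<bar>x - 1\<bar> < d' \<Longrightarrow> poly ?q x \<ge> 0" using near[of 1] by auto
  have "poly ?q x \<ge> 0" if "x \<in> {-(d/2)..1+d'/2}" for x
  proof -
    have "\<bar>x\<bar> < d \<or> x \<in> {0..1} \<or> \<bar>x - 1\<bar> < d'"
      using that d(1) d'(1) unfolding atLeastAtMost_iff by linarith
    then consider "\<bar>x\<bar> < d" | "x \<in> {0..1}" | "\<bar>x - 1\<bar> < d'" by blast
    then show ?thesis using d d' p[of x] \<eta> by cases auto
  qed
  then have "0 \<le> ?L ?q"
    using d d' by (intro laurent_coefficients_nonneg_aux[OF hol neg real a ar, of "-(d/2)" "1+d'/2"]) auto
  also have "?L ?q = ?L p + \<eta> * Re (a 1)"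
  proof (cases "degree p = 0")
    case True
    then obtain c where "p = [:c:]" by (metis degree_eq_zeroE)
    then show ?thesis by (simp add: algebra_simps)
  next
    case False
    then have dq: "degree ?q = degree p" by (simp add: degree_add_eq_left)
    show ?thesis
    proof -
      have "(\<Sum>n\<le>degree p. coeff [:\<eta>:] n * Re (a (n + 1))) = \<eta> * Re (a 1)"
        by (subst sum.atMost_shift) (simp add: coeff_pCons)
      then show ?thesis unfolding dq by (simp add: algebra_simps sum.distrib)
    qed
  qed
  also have "\<eta> * Re (a 1) \<le> e"
  proof -
    have "\<eta> * Re (a 1) \<le> \<eta> * (1 + \<bar>Re (a 1)\<bar>)" using \<eta> by (intro mult_left_mono) auto
    also have "\<dots> = e" by (simp add: \<eta>_def)
    finally show ?thesis .
  qed
  finally show "0 \<le> ?L p + e" by simp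
qed


section \<open>The Hausdorff moment problem\<close>

lemma borel_measurable_poly [measurable]: "poly p \<in> borel_measurable borel" for p :: "real poly"
  by (intro borel_measurable_continuous_onI continuous_intros)

text \<open>The polynomial behind the real function \<open>Bernstein n k\<close>, needed because the
  functionals below act on polynomials.\<close>

definition bernstein_poly :: "nat \<Rightarrow> nat \<Rightarrow> real poly"
  where "bernstein_poly n k = smult (of_nat (n choose k)) ([:0, 1:] ^ k * [:1, -1:] ^ (n - k))"

lemma poly_bernstein_poly: "poly (bernstein_poly n k) x = Bernstein n k x"
  by (simp add: bernstein_poly_def Bernstein_def mult.assoc)

locale positive_functional =
  fixes L :: "real poly \<Rightarrow> real"
  assumes add: "L (p + q) = L p + L q"
    and smult: "L (smult c p) = c * L p"
    and nonneg: "(\<And>x. x \<in> {0..1} \<Longrightarrow> 0 \<le> poly p x) \<Longrightarrow> 0 \<le> L p"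
begin

lemma zero: "L 0 = 0"
  using smult[of 0 0] by simp

lemma sum: "finite A \<Longrightarrow> L (\<Sum>i\<in>A. p i) = (\<Sum>i\<in>A. L (p i))"
  by (induction rule: finite_induct) (auto simp: add zero)

lemma diff: "L (p - q) = L p - L q"
  using add[of p "smult (-1) q"] smult[of "-1" q] by simp

lemma mono: "L p \<le> L q" if "\<And>x. x \<in> {0..1} \<Longrightarrow> poly p x \<le> poly q x"
  using nonneg[of "q - p"] that by (simp add: diff)

lemma abs_le: "\<bar>L p\<bar> \<le> e * L 1" if "\<And>x. x \<in> {0..1} \<Longrightarrow> \<bar>poly p x\<bar> \<le> e"
proof -
  have "L p \<le> L (smult e 1)" using that by (intro mono) force
  moreover have "L (smult (-e) 1) \<le> L p" using that by (intro mono) (force simp: abs_le_iff)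
  ultimately show ?thesis using smult[of e 1] smult[of "-e" 1] by (auto simp: abs_le_iff)
qed

lemma bernstein_nonneg: "0 \<le> L (bernstein_poly n k)"
  by (rule nonneg) (simp add: poly_bernstein_poly Bernstein_nonneg)

lemma sum_bernstein: "(\<Sum>k\<le>n. L (bernstein_poly n k)) = L 1"
proof -
  have "(\<Sum>k\<le>n. bernstein_poly n k) = 1"
    by (simp add: poly_eq_poly_eq_iff[symmetric] fun_eq_iff poly_sum poly_bernstein_poly)
  then show ?thesis by (metis sum finite_atMost)
qed

text \<open>The sum is \<open>L\<close> applied to the Bernstein approximation of \<open>p\<close>
  of order \<open>n\<close>, which converges uniformly on \<open>[0, 1]\<close>; positivity makes
  \<open>L\<close> continuous for the supremum norm there (\<open>abs_le\<close>).\<close>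

lemma bernstein_approx: "(\<lambda>n. \<Sum>k\<le>n. poly p (k / n) * L (bernstein_poly n k)) \<longlonglongrightarrow> L p"
proof (rule LIMSEQ_I)
  fix r :: real assume r: "r > 0"
  have L1: "0 \<le> L 1" by (rule nonneg) simp
  define e where "e = r / (1 + L 1)"
  have e: "e > 0" "e * L 1 < r" using r L1 by (auto simp: e_def field_simps)
  have "continuous_on {0..1} (poly p)" by (intro continuous_intros)
  from Bernstein_Weierstrass[OF this e(1)] obtain N where
    N: "\<And>n x. N \<le> n \<Longrightarrow> x \<in> {0..1} \<Longrightarrow> \<bar>poly p x - (\<Sum>k\<le>n. poly p (k / n) * Bernstein n k x)\<bar> < e"
    by blast
  have "norm ((\<Sum>k\<le>n. poly p (k / n) * L (bernstein_poly n k)) - L p) < r" if "n \<ge> N" for n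
  proof -
    let ?q = "\<Sum>k\<le>n. smult (poly p (k / n)) (bernstein_poly n k)"
    have "(\<Sum>k\<le>n. poly p (k / n) * L (bernstein_poly n k)) - L p = L (?q - p)"
      by (simp add: diff sum smult)
    also have "\<bar>L (?q - p)\<bar> \<le> e * L 1"
    proof (rule abs_le)
      fix x :: real assume "x \<in> {0..1}"
      from N[OF that this] show "\<bar>poly (?q - p) x\<bar> \<le> e"
        by (simp add: poly_sum poly_bernstein_poly abs_minus_commute)
    qed
    finally show ?thesis using e(2) by simp
  qed
  then show "\<exists>N. \<forall>n\<ge>N. norm ((\<Sum>k\<le>n. poly p (k / n) * L (bernstein_poly n k)) - L p) < r" by blast
qed

text \<open>Weights for the points \<open>k / n\<close>, summing to 1 because the Bernstein
  polynomials of a fixed order do. The division by \<open>L 1\<close> gives access to weak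
  convergence of probability distributions.\<close>

definition bernstein_pmf :: "nat \<Rightarrow> nat pmf"
  where "bernstein_pmf n = embed_pmf (\<lambda>k. if k \<le> n then L (bernstein_poly n k) / L 1 else 0)"

definition bernstein_measure :: "nat \<Rightarrow> real measure"
  where "bernstein_measure n = distr (measure_pmf (bernstein_pmf n)) borel (\<lambda>k. k / n)"

context
  assumes L1: "L 1 > 0"
begin

lemma pmf_bernstein_pmf: "pmf (bernstein_pmf n) k = (if k \<le> n then L (bernstein_poly n k) / L 1 else 0)"
  unfolding bernstein_pmf_def
proof (rule pmf_embed_pmf)
  have "(\<integral>\<^sup>+ x. ennreal (if x \<le> n then L (bernstein_poly n x) / L 1 else 0) \<partial>count_space UNIV) = 
      (\<integral>\<^sup>+ x. ennreal (if x \<le> n then L (bernstein_poly n x) / L 1 else 0) \<partial>count_space {..n})"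
    by (rule nn_integral_count_space_eq) auto
  also have "\<dots> = (\<Sum>k\<le>n. ennreal (L (bernstein_poly n k) / L 1))"
    by (simp add: nn_integral_count_space_finite)
  also have "\<dots> = ennreal (\<Sum>k\<le>n. L (bernstein_poly n k) / L 1)"
    using L1 bernstein_nonneg by (intro sum_ennreal) auto
  also have "(\<Sum>k\<le>n. L (bernstein_poly n k) / L 1) = 1"
    using L1 sum_bernstein[of n] by (simp flip: sum_divide_distrib)
  finally show "(\<integral>\<^sup>+ x. ennreal (if x \<le> n then L (bernstein_poly n x) / L 1 else 0) \<partial>count_space UNIV) = 1"
    by simp
qed (use L1 bernstein_nonneg in auto)

lemma set_bernstein_pmf: "set_pmf (bernstein_pmf n) \<subseteq> {..n}"
  by (auto simp: set_pmf_iff pmf_bernstein_pmf split: if_splits)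

lemma integral_bernstein_measure:
  assumes [measurable]: "f \<in> borel_measurable borel"
  shows "(\<integral>x. f x \<partial>bernstein_measure n) = (\<Sum>k\<le>n. f (k / n) * L (bernstein_poly n k)) / (L 1 :: real)"
proof -
  have "(\<integral>x. f x \<partial>bernstein_measure n) = (\<integral>k. f (real k / n) \<partial>measure_pmf (bernstein_pmf n))"
    unfolding bernstein_measure_def by (rule integral_distr) auto
  also have "\<dots> = (\<Sum>k\<le>n. f (real k / n) * pmf (bernstein_pmf n) k)"
    using set_bernstein_pmf by (intro integral_measure_pmf_real) auto
  finally show ?thesis by (simp add: pmf_bernstein_pmf sum_divide_distrib)
qed

lemma real_distribution_bernstein_measure: "real_distribution (bernstein_measure n)"
  unfolding bernstein_measure_def real_distribution_def real_distribution_axioms_def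
  by (auto intro: measure_pmf.prob_space_distr)

lemma AE_bernstein_measure: "AE x in bernstein_measure n. x \<in> {0..1}"
  unfolding bernstein_measure_def
  by (subst AE_distr_iff) (use set_bernstein_pmf in \<open>force simp: AE_measure_pmf_iff divide_le_eq_1\<close>)+

lemma tight_bernstein_measure: "tight bernstein_measure"
  unfolding tight_def
proof (intro conjI allI impI)
  fix e :: real assume e: "e > 0"
  have "measure (bernstein_measure n) {-1<..1} = 1" for n
  proof -
    interpret real_distribution "bernstein_measure n" by (rule real_distribution_bernstein_measure)
    show ?thesis by (rule prob_eq_1[THEN iffD2]) (use AE_bernstein_measure[of n] in auto)
  qed
  with e show "\<exists>a b. a < b \<and> (\<forall>n. 1 - e < measure (bernstein_measure n) {a<..b})"
    by (intro exI[of _ "-1"] exI[of _ 1]) auto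
qed (rule real_distribution_bernstein_measure)

text \<open>Weak convergence only controls bounded continuous test functions. Two of them do the
  work: \<open>d\<close>, which vanishes exactly on \<open>[0, 1]\<close> and locates the limit
  measure, and a truncation \<open>f\<close> of the polynomial, which agrees with it there.\<close>

lemma hausdorff_pos:
  obtains M where "real_distribution M" "AE x in M. x \<in> {0..1}"
    "\<And>p. (\<integral>x. poly p x \<partial>M) = L p / L 1"
proof -
  obtain r M where r: "strict_mono (r :: nat \<Rightarrow> nat)" and M: "real_distribution M"
    and conv: "weak_conv_m (bernstein_measure \<circ> id \<circ> r) M"
    using tight_imp_convergent_subsubsequence[OF tight_bernstein_measure strict_mono_id] by blast
  interpret M: real_distribution M by fact
  have lim: "(\<lambda>n. \<integral>x. f x \<partial>bernstein_measure (r n)) \<longlonglongrightarrow> (\<integral>x. f x \<partial>M)"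
    if "\<And>x. isCont f x" "\<And>x. norm (f x) \<le> B" for f :: "real \<Rightarrow> real" and B
    using weak_conv_imp_integral_bdd_continuous_conv[OF _ M conv that] real_distribution_bernstein_measure
    by (simp add: o_def)
  define d where "d x = min 1 (max 0 (max (-x) (x - 1)))" for x :: real
  have dc: "isCont d x" for x unfolding d_def by (intro continuous_intros)
  then have [measurable]: "d \<in> borel_measurable borel"
    by (intro borel_measurable_continuous_onI) (simp add: continuous_on_eq_continuous_at)
  have "(\<integral>x. d x \<partial>bernstein_measure n) = 0" for n
  proof -
    have "(\<integral>x. d x \<partial>bernstein_measure n) = (\<integral>x. 0 \<partial>bernstein_measure n)"
      by (rule integral_cong_AE) (use AE_bernstein_measure[of n] in \<open>auto simp: d_def bernstein_measure_def elim: eventually_mono\<close>)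
    then show ?thesis by simp
  qed
  with lim[of d 1, OF dc] have "(\<integral>x. d x \<partial>M) = 0"
    by (auto simp: d_def LIMSEQ_const_iff)
  moreover have "integrable M d"
    by (rule M.integrable_const_bound[of _ 1]) (auto simp: d_def)
  ultimately have "AE x in M. d x = 0"
    by (subst (asm) integral_nonneg_eq_0_iff_AE) (auto simp: d_def)
  then have AE: "AE x in M. x \<in> {0..1}"
    by eventually_elim (auto simp: d_def min_def max_def split: if_splits)
  show ?thesis
  proof (rule that[OF M AE])
    fix p :: "real poly"
    define f where "f x = poly p (max 0 (min 1 x))" for x
    have fc: "isCont f x" for x unfolding f_def by (intro continuous_intros)
    then have [measurable]: "f \<in> borel_measurable borel"
      by (intro borel_measurable_continuous_onI) (simp add: continuous_on_eq_continuous_at)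
    have "compact (poly p ` {0..1})"
      by (intro compact_continuous_image continuous_intros) auto
    then obtain B where B: "\<And>x. x \<in> {0..1} \<Longrightarrow> norm (poly p x) \<le> B"
      by (meson bounded_iff compact_imp_bounded imageI)
    have fB: "norm (f x) \<le> B" for x unfolding f_def by (rule B) auto
    have "(\<integral>x. f x \<partial>bernstein_measure (r n)) = (\<Sum>k\<le>r n. poly p (k / r n) * L (bernstein_poly (r n) k)) / L 1" for n
    proof -
      have "f (real k / r n) = poly p (k / r n)" if "k \<le> r n" for k
      proof -
        have "real k / r n \<in> {0..1}" using that by (auto simp: divide_le_eq_1)
        then show ?thesis by (simp add: f_def)
      qed
      then show ?thesis by (subst integral_bernstein_measure) auto
    qed
    moreover have "(\<lambda>n. (\<Sum>k\<le>r n. poly p (k / r n) * L (bernstein_poly (r n) k)) / L 1) \<longlonglongrightarrow> L p / L 1"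
      using LIMSEQ_subseq_LIMSEQ[OF bernstein_approx r] L1 by (intro tendsto_intros) (auto simp: o_def)
    ultimately have "(\<lambda>n. \<integral>x. f x \<partial>bernstein_measure (r n)) \<longlonglongrightarrow> L p / L 1" by simp
    with lim[OF fc fB] have "(\<integral>x. f x \<partial>M) = L p / L 1" by (rule LIMSEQ_unique)
    moreover have "(\<integral>x. f x \<partial>M) = (\<integral>x. poly p x \<partial>M)"
    proof (rule integral_cong_AE)
      show "AE x in M. f x = poly p x" using AE by eventually_elim (simp add: f_def)
    qed auto
    ultimately show "(\<integral>x. poly p x \<partial>M) = L p / L 1" by simp
  qed
qed

end

text \<open>If \<open>L 1 = 0\<close>, the functional vanishes by \<open>abs_le\<close> and the null
  measure serves; otherwise a constant density undoes the normalization.\<close>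

theorem hausdorff:
  obtains M where "finite_measure M" "sets M = sets borel" "AE x in M. x \<in> {0..1}"
    "\<And>p. (\<integral>x. poly p x \<partial>M) = L p"
proof (cases "L 1 > 0")
  case True
  then obtain N where N: "real_distribution N" "AE x in N. x \<in> {0..1}"
    "\<And>p. (\<integral>x. poly p x \<partial>N) = L p / L 1" using hausdorff_pos by blast
  interpret N: real_distribution N by fact
  define M where "M = density N (\<lambda>_. ennreal (L 1))"
  show ?thesis
  proof (rule that[of M])
    show "finite_measure M"
      by (rule finite_measureI) (simp add: M_def emeasure_density N.emeasure_space_1 ennreal_mult_eq_top_iff)
    show "sets M = sets borel" by (simp add: M_def)
    show "AE x in M. x \<in> {0..1}" unfolding M_def using N(2) by (simp add: AE_density)
    show "(\<integral>x. poly p x \<partial>M) = L p" for p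
      unfolding M_def using True N(3)[of p] by (subst integral_density) auto
  qed
next
  case False
  moreover have "L 1 \<ge> 0" by (rule nonneg) simp
  ultimately have L1: "L 1 = 0" by simp
  have "L p = 0" for p
  proof -
    have "compact (poly p ` {0..1})"
      by (intro compact_continuous_image continuous_intros) auto
    then obtain B where "\<And>x. x \<in> {0..1} \<Longrightarrow> norm (poly p x) \<le> B"
      by (meson bounded_iff compact_imp_bounded imageI)
    from abs_le[of p B] this L1 show ?thesis by auto
  qed
  then show ?thesis
    by (intro that[of "null_measure borel"] finite_measureI AE_I[of _ _ UNIV]) auto
qed

end


section \<open>Scalar Stieltjes transforms\<close>

text \<open>Uniqueness of Stieltjes measures, phrased for linear relations among several measures so
  that no complex measure has to be built. The map \<open>u t = 1 / (t - (\<alpha> - 1))\<close>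
  sends \<open>[\<alpha>, \<infinity>)\<close> onto \<open>(0, 1]\<close>. Polynomials in
  \<open>u\<close> without constant term approximate all continuous functions of \<open>u\<close>
  that vanish at 0, these approximate the indicators of \<open>{..b}\<close>, and a \<pi>-\<lambda>
  argument reaches all Borel sets.\<close>

lemma signed_measures_eq_zero:
  fixes M :: "'i \<Rightarrow> real measure" and c :: "'i \<Rightarrow> complex"
  assumes I: "finite I"
    and M: "\<And>i. i \<in> I \<Longrightarrow> finite_measure (M i)" "\<And>i. i \<in> I \<Longrightarrow> sets (M i) = sets borel"
      "\<And>i. i \<in> I \<Longrightarrow> AE t in M i. \<alpha> \<le> t"
    and moments: "\<And>k. (\<Sum>i\<in>I. c i * of_real (\<integral>t. (1 / (t - (\<alpha> - 1))) ^ (k + 1) \<partial>M i)) = 0"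
    and B: "B \<in> sets borel"
  shows "(\<Sum>i\<in>I. c i * of_real (measure (M i) B)) = 0"
proof -
  define u where "u t = 1 / (t - (\<alpha> - 1))" for t :: real
  have um [measurable]: "u \<in> borel_measurable borel" unfolding u_def by measurable
  have u01: "u t \<in> {0<..1}" if "t \<ge> \<alpha>" for t using that by (auto simp: u_def field_simps)
  have space: "space (M i) = UNIV" if "i \<in> I" for i using sets_eq_imp_space_eq[OF M(2)[OF that]] by simp
  have Mm: "f \<in> borel_measurable (M i) \<longleftrightarrow> f \<in> borel_measurable borel" if "i \<in> I" for i and f :: "real \<Rightarrow> real"
    using M(2)[OF that] by (simp cong: measurable_cong_sets)
  have intb: "integrable (M i) f" if "i \<in> I" "f \<in> borel_measurable borel" "\<And>t. t \<ge> \<alpha> \<Longrightarrow> \<bar>f t\<bar> \<le> b" for i and f :: "real \<Rightarrow> real" and b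
  proof -
    interpret finite_measure "M i" by (rule M(1)[OF that(1)])
    show ?thesis
      by (rule integrable_const_bound[of _ b]) (use M(3)[OF that(1)] that Mm in \<open>auto elim: eventually_mono\<close>)
  qed
  define J where "J f = (\<Sum>i\<in>I. c i * of_real (\<integral>t. f t \<partial>M i))" for f :: "real \<Rightarrow> real"
  define K where "K = (\<Sum>i\<in>I. norm (c i) * measure (M i) UNIV)"
  have K0: "K \<ge> 0" unfolding K_def by (intro sum_nonneg) simp
  have J_bound: "norm (J f) \<le> e * K"
    if f: "f \<in> borel_measurable borel" "\<And>t. t \<ge> \<alpha> \<Longrightarrow> \<bar>f t\<bar> \<le> e" for f e
  proof -
    have "norm (J f) \<le> (\<Sum>i\<in>I. norm (c i) * (e * measure (M i) UNIV))"
      unfolding J_def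
    proof (rule sum_norm_le)
      fix i assume i: "i \<in> I"
      interpret finite_measure "M i" by (rule M(1)[OF i])
      have "norm (\<integral>t. f t \<partial>M i) \<le> (\<integral>t. norm (f t) \<partial>M i)"
        by (rule integral_norm_bound)
      also have "\<dots> \<le> (\<integral>t. e \<partial>M i)"
      proof (rule integral_mono_AE)
        show "AE t in M i. norm (f t) \<le> e" using M(3)[OF i] by eventually_elim (use f(2) in auto)
      qed (use intb[OF i f] in auto)
      finally have "norm (\<integral>t. f t \<partial>M i) \<le> (\<integral>t. e \<partial>M i)" .
      then have "\<bar>\<integral>t. f t \<partial>M i\<bar> \<le> e * measure (M i) UNIV" using space[OF i] by (simp add: mult.commute)
      then show "norm (c i * of_real (\<integral>t. f t \<partial>M i)) \<le> norm (c i) * (e * measure (M i) UNIV)"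
        by (simp add: norm_mult mult_left_mono)
    qed
    also have "\<dots> = e * K" by (simp add: K_def sum_distrib_left mult_ac)
    finally show ?thesis .
  qed
  have J_poly: "J (\<lambda>t. poly (pCons 0 r) (u t)) = 0" for r
  proof -
    have "(\<integral>t. poly (pCons 0 r) (u t) \<partial>M i) = (\<Sum>k\<le>degree r. coeff r k * (\<integral>t. u t ^ (k+1) \<partial>M i))" if i: "i \<in> I" for i
    proof -
      have "(\<integral>t. poly (pCons 0 r) (u t) \<partial>M i) = (\<integral>t. (\<Sum>k\<le>degree r. coeff r k * u t ^ (k+1)) \<partial>M i)"
        by (simp add: poly_altdef[of r] sum_distrib_left mult_ac)
      also have "\<dots> = (\<Sum>k\<le>degree r. \<integral>t. coeff r k * u t ^ (k+1) \<partial>M i)"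
      proof (rule Bochner_Integration.integral_sum)
        fix k
        have "integrable (M i) (\<lambda>t. u t ^ (k+1))"
        proof (rule intb[OF i, of _ 1])
          fix t assume "t \<ge> \<alpha>"
          from u01[OF this] show "\<bar>u t ^ (k+1)\<bar> \<le> 1" by (auto simp: power_le_one abs_mult simp del: power_Suc)
        qed measurable
        then show "integrable (M i) (\<lambda>t. coeff r k * u t ^ (k+1))" by simp
      qed
      finally show ?thesis by simp
    qed
    then have "J (\<lambda>t. poly (pCons 0 r) (u t)) = (\<Sum>i\<in>I. \<Sum>k\<le>degree r. of_real (coeff r k) * (c i * of_real (\<integral>t. u t ^ (k+1) \<partial>M i)))"
      unfolding J_def by (intro sum.cong refl) (simp add: sum_distrib_left mult_ac)
    also have "\<dots> = (\<Sum>k\<le>degree r. of_real (coeff r k) * (\<Sum>i\<in>I. c i * of_real (\<integral>t. u t ^ (k+1) \<partial>M i)))"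
      by (subst sum.swap) (simp add: sum_distrib_left)
    also have "\<dots> = 0" using moments by (simp add: u_def)
    finally show ?thesis .
  qed
  have J_cont: "J (\<lambda>t. \<phi> (u t)) = 0" if \<phi>: "continuous_on UNIV \<phi>" "\<phi> 0 = 0" for \<phi> :: "real \<Rightarrow> real"
  proof -
    have \<phi>m [measurable]: "\<phi> \<in> borel_measurable borel" using \<phi>(1) by (rule borel_measurable_continuous_onI)
    have "norm (J (\<lambda>t. \<phi> (u t))) \<le> e" if e: "e > 0" for e
    proof -
      define e' where "e' = e / (2 * (1 + K))"
      have e': "e' > 0" using e K0 by (simp add: e'_def)
      have "continuous_on {0..1} \<phi>" using \<phi>(1) continuous_on_subset by blast
      from Bernstein_Weierstrass[OF this e'] obtain n where
        n: "\<And>x. x \<in> {0..1} \<Longrightarrow> \<bar>\<phi> x - (\<Sum>k\<le>n. \<phi> (k / n) * Bernstein n k x)\<bar> < e'" by blast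
      define q where "q = (\<Sum>k\<le>n. smult (\<phi> (k / n)) (bernstein_poly n k))"
      have q: "\<bar>\<phi> x - poly q x\<bar> < e'" if "x \<in> {0..1}" for x
        using n[OF that] by (simp add: q_def poly_sum poly_bernstein_poly)
      \<comment> \<open>Only powers \<open>k + 1\<close> occur in the hypothesis, so the constant
        term of the approximating polynomial must go. Since \<open>\<phi> 0 = 0\<close>, that term
        is below \<open>e'\<close> in modulus, which doubles the error.\<close>
      obtain r where r: "q - [:poly q 0:] = pCons 0 r"
        using pCons_cases[of "q - [:poly q 0:]"]
        by (metis add.commute add.right_neutral cancel_comm_monoid_add_class.diff_cancel mult_zero_left poly_diff poly_pCons poly_0)
      have r': "poly (pCons 0 r) x = poly q x - poly q 0" for x
        unfolding r[symmetric] by simp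
      have err: "\<bar>\<phi> (u t) - poly (pCons 0 r) (u t)\<bar> \<le> 2 * e'" if "t \<ge> \<alpha>" for t
        using q[of "u t"] q[of 0] u01[OF that] \<phi>(2) unfolding r' by simp
      have int: "integrable (M i) (\<lambda>t. \<psi> (u t))" if "i \<in> I" "continuous_on UNIV \<psi>" for i and \<psi> :: "real \<Rightarrow> real"
      proof -
        have "compact (\<psi> ` {0..1})"
          using that(2) by (intro compact_continuous_image) (auto intro: continuous_on_subset)
        then obtain b where b: "\<And>x. x \<in> {0..1} \<Longrightarrow> norm (\<psi> x) \<le> b"
          by (meson bounded_iff compact_imp_bounded imageI)
        have [measurable]: "\<psi> \<in> borel_measurable borel" using that(2) by (rule borel_measurable_continuous_onI)
        show ?thesis by (rule intb[OF that(1), of _ b]) (use b u01 in \<open>auto simp: less_imp_le\<close>)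
      qed
      have "J (\<lambda>t. \<phi> (u t)) = J (\<lambda>t. \<phi> (u t) - poly (pCons 0 r) (u t)) + J (\<lambda>t. poly (pCons 0 r) (u t))"
        unfolding J_def sum.distrib[symmetric]
        by (intro sum.cong refl)
          (simp only: Bochner_Integration.integral_diff[OF int[OF _ \<phi>(1)] int] continuous_on_poly continuous_on_id; simp add: algebra_simps)
      also have "norm \<dots> \<le> 2 * e' * K"
        unfolding J_poly using err by (simp add: J_bound del: poly_pCons)
      also have "\<dots> \<le> e" using e K0 by (simp add: e'_def field_simps)
      finally show ?thesis .
    qed
    then show ?thesis using field_le_epsilon[of "norm (J (\<lambda>t. \<phi> (u t)))" 0] by simp
  qed
  have J_atMost: "(\<Sum>i\<in>I. c i * of_real (measure (M i) {..b})) = 0" for b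
  proof -
    define s where "s = b - (\<alpha> - 1)"
    \<comment> \<open>Ramps in \<open>x = u t\<close> decreasing to the indicator of
      \<open>1 \<le> s * x\<close>, that is of \<open>t \<le> b\<close>. The factor
      \<open>Suc n\<close> instead of \<open>n\<close> ensures \<open>\<phi> n 0 = 0\<close> already
      for \<open>n = 0\<close>.\<close>
    define \<phi> where "\<phi> n x = max 0 (min 1 (1 - real (Suc n) * (1 - s * x)))" for n x
    have \<phi>c: "continuous_on UNIV (\<phi> n)" for n unfolding \<phi>_def by (intro continuous_intros)
    have [measurable]: "\<phi> n \<in> borel_measurable borel" for n using \<phi>c by (rule borel_measurable_continuous_onI)
    have lim: "(\<lambda>n. \<phi> n x) \<longlonglongrightarrow> (if 1 \<le> s * x then 1 else 0)" for x
    proof (cases "1 \<le> s * x")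
      case True
      then have "\<phi> n x = 1" for n by (simp add: \<phi>_def mult_nonneg_nonpos)
      then show ?thesis using True by simp
    next
      case False
      obtain N :: nat where N: "1 / (1 - s * x) < real N" using reals_Archimedean2 by blast
      have "\<phi> n x = 0" if "n \<ge> N" for n
      proof -
        have "1 / (1 - s * x) < real (Suc n)" using N that by linarith
        then have "1 < real (Suc n) * (1 - s * x)" using False by (simp add: pos_divide_less_eq)
        then show ?thesis by (simp add: \<phi>_def)
      qed
      then have "\<forall>\<^sub>F n in sequentially. \<phi> n x = 0" by (auto simp: eventually_sequentially)
      then show ?thesis using False tendsto_eventually by auto
    qed
    have "(\<lambda>n. J (\<lambda>t. \<phi> n (u t))) \<longlonglongrightarrow> (\<Sum>i\<in>I. c i * of_real (measure (M i) {..b}))"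
      unfolding J_def
    proof (intro tendsto_intros)
      fix i assume i: "i \<in> I"
      interpret finite_measure "M i" by (rule M(1)[OF i])
      have "(\<lambda>n. \<integral>t. \<phi> n (u t) \<partial>M i) \<longlonglongrightarrow> (\<integral>t. indicator {..b} t \<partial>M i)"
      proof (rule integral_dominated_convergence[where w = "\<lambda>_. 1"])
        show "AE t in M i. (\<lambda>n. \<phi> n (u t)) \<longlonglongrightarrow> indicator {..b} t"
          using M(3)[OF i]
        proof eventually_elim
          case (elim t)
          then have "1 \<le> s * u t \<longleftrightarrow> t \<le> b" by (auto simp: u_def s_def field_simps)
          then show ?case using lim[of "u t"] by (auto simp: indicator_def)
        qed
        show "AE t in M i. norm (\<phi> n (u t)) \<le> 1" for n by (simp add: \<phi>_def)
      qed (use Mm[OF i] in auto)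
      then show "(\<lambda>n. \<integral>t. \<phi> n (u t) \<partial>M i) \<longlonglongrightarrow> measure (M i) {..b}"
        using M(2)[OF i] space[OF i] by simp
    qed
    moreover have "J (\<lambda>t. \<phi> n (u t)) = 0" for n by (rule J_cont[OF \<phi>c]) (simp add: \<phi>_def)
    ultimately show ?thesis by (simp add: LIMSEQ_const_iff)
  qed
  have Int_stable_atMost: "Int_stable (range (atMost :: real \<Rightarrow> _))"
    by (auto simp: Int_stable_def)
  \<comment> \<open>The whole line is not of the form \<open>{..b}\<close>, yet the complement step
    of the induction below needs it.\<close>
  have J_UNIV: "(\<Sum>i\<in>I. c i * of_real (measure (M i) UNIV)) = 0"
  proof -
    have "(\<lambda>n. \<Sum>i\<in>I. c i * of_real (measure (M i) {..real n})) \<longlonglongrightarrow> (\<Sum>i\<in>I. c i * of_real (measure (M i) UNIV))"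
    proof (intro tendsto_intros)
      fix i assume i: "i \<in> I"
      interpret finite_measure "M i" by (rule M(1)[OF i])
      have "(\<lambda>n. measure (M i) {..real n}) \<longlonglongrightarrow> measure (M i) (\<Union>n. {..real n})"
        by (rule finite_Lim_measure_incseq) (auto simp: M(2)[OF i] incseq_def)
      also have "(\<Union>n. {..real n}) = UNIV" using real_arch_simple by auto
      finally show "(\<lambda>n. measure (M i) {..real n}) \<longlonglongrightarrow> measure (M i) UNIV" .
    qed
    then show ?thesis unfolding J_atMost by (simp add: LIMSEQ_const_iff)
  qed
  have sB: "B \<in> sigma_sets UNIV (range atMost)" using B by (simp add: borel_eq_atMost)
  have "range atMost \<subseteq> Pow (UNIV :: real set)" by auto
  from Int_stable_atMost this sB show ?thesis
  proof (induction rule: sigma_sets_induct_disjoint)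
    case (compl A)
    have A: "A \<in> sets borel" using compl(1) by (simp add: borel_eq_atMost)
    have "(\<Sum>i\<in>I. c i * of_real (measure (M i) (UNIV - A))) = (\<Sum>i\<in>I. c i * of_real (measure (M i) UNIV) - c i * of_real (measure (M i) A))"
    proof (rule sum.cong[OF refl])
      fix i assume i: "i \<in> I"
      interpret finite_measure "M i" by (rule M(1)[OF i])
      show "c i * of_real (measure (M i) (UNIV - A)) = c i * of_real (measure (M i) UNIV) - c i * of_real (measure (M i) A)"
        using finite_measure_compl[of A] A M(2)[OF i] space[OF i] by (simp add: right_diff_distrib)
    qed
    then show ?case using compl(2) J_UNIV by (simp add: sum_subtractf)
  next
    case (union A)
    have "(\<lambda>n. \<Sum>i\<in>I. c i * of_real (measure (M i) (A n))) sums (\<Sum>i\<in>I. c i * of_real (measure (M i) (\<Union>n. A n)))"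
    proof (intro sums_sum sums_mult sums_of_real)
      fix i assume i: "i \<in> I"
      interpret finite_measure "M i" by (rule M(1)[OF i])
      show "(\<lambda>n. measure (M i) (A n)) sums measure (M i) (\<Union>n. A n)"
        by (rule finite_measure_UNION) (use union M(2)[OF i] in \<open>auto simp: borel_eq_atMost\<close>)
    qed
    then show ?case using union(3) by (simp add: sums_iff)
  next
    case (basic A)
    then show ?case using J_atMost by auto
  qed auto
qed

text \<open>Inductively the lower coefficients are real, so the imaginary part of the sum starts
  with \<open>Im (a k) * x ^ k\<close>; dividing by \<open>x ^ k\<close> and letting
  \<open>x\<close> tend to 0 isolates it.\<close>

lemma real_powser_coeffs:
  fixes a :: "nat \<Rightarrow> complex"
  assumes "\<And>x. \<bar>x\<bar> < 1 \<Longrightarrow> (\<lambda>k. a k * of_real x ^ k) sums s x" "\<And>x. \<bar>x\<bar> < 1 \<Longrightarrow> Im (s x) = 0"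
  shows "Im (a k) = 0"
proof (induction k rule: less_induct)
  case (less k)
  have "(\<lambda>j. Im (a (j + k)) * x ^ j) sums 0" if x: "x \<noteq> 0" "norm x < 1" for x :: real
  proof -
    have "(\<lambda>j. Im (a j * of_real x ^ j)) sums Im (s x)" using x assms(1) by (intro sums_Im) auto
    then have "(\<lambda>j. Im (a j) * x ^ j) sums 0" using assms(2)[of x] x by (simp flip: of_real_power)
    then have "(\<lambda>j. Im (a (j + k)) * x ^ (j + k)) sums (0 - (\<Sum>j<k. Im (a j) * x ^ j))"
      by (subst sums_iff_shift) simp
    then have "(\<lambda>j. Im (a (j + k)) * x ^ (j + k) / x ^ k) sums (0 / x ^ k)"
      using less by (intro sums_divide) simp
    then show ?thesis using x by (simp add: power_add)
  qed
  then have "((\<lambda>x. 0) \<longlongrightarrow> Im (a (0 + k))) (at (0 :: real))"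
    by (intro powser_limit_0_strong[of 1 "\<lambda>j. Im (a (j + k))"]) auto
  then show ?case by (simp add: tendsto_const_iff)
qed

text \<open>Differentiation under the integral with a dominating function for \<open>k\<close>
  alone: Cauchy's inequality on discs of half the radius turns it into one for the derivative, hence
  for the difference quotients.\<close>

lemma holomorphic_parametric_integral:
  fixes k :: "complex \<Rightarrow> 'a \<Rightarrow> complex"
  assumes S: "open S"
    and meas: "\<And>z. z \<in> S \<Longrightarrow> k z \<in> borel_measurable M"
    and hol: "\<And>x. x \<in> space M \<Longrightarrow> (\<lambda>z. k z x) holomorphic_on S"
    and bound: "\<And>z. z \<in> S \<Longrightarrow> \<exists>r>0. \<exists>w. ball z r \<subseteq> S \<and> integrable M w \<and> (\<forall>x\<in>space M. \<forall>z'\<in>ball z r. norm (k z' x) \<le> w x)"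
  shows "(\<lambda>z. \<integral>x. k z x \<partial>M) holomorphic_on S"
  unfolding holomorphic_on_open[OF S]
proof (intro ballI)
  fix z assume z: "z \<in> S"
  obtain r w where r: "r > 0" "ball z r \<subseteq> S" and w: "integrable M w"
    "\<And>x z'. x \<in> space M \<Longrightarrow> z' \<in> ball z r \<Longrightarrow> norm (k z' x) \<le> w x" using bound[OF z] by blast
  have int: "integrable M (k z')" if "z' \<in> ball z r" for z'
    by (rule Bochner_Integration.integrable_bound[OF w(1)]) (use that w(2) r(2) meas in \<open>auto intro!: AE_I2 order_trans[OF w(2)]\<close>)
  define D where "D x = deriv (\<lambda>z. k z x) z" for x
  have der: "((\<lambda>z. k z x) has_field_derivative deriv (\<lambda>z. k z x) z') (at z')" if "x \<in> space M" "z' \<in> ball z r" for x z'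
    using hol[OF that(1)] r(2) that(2) S by (intro holomorphic_derivI) auto
  have dbound: "norm (deriv (\<lambda>z. k z x) y) \<le> 2 * w x / r" if x: "x \<in> space M" and y: "y \<in> ball z (r/2)" for x y
  proof -
    have sub: "cball y (r/2) \<subseteq> ball z r"
    proof
      fix v assume "v \<in> cball y (r/2)"
      then show "v \<in> ball z r" using y dist_triangle[of z v y] by simp
    qed
    have h: "(\<lambda>z. k z x) holomorphic_on cball y (r/2)"
      using hol[OF x] by (rule holomorphic_on_subset) (use sub r(2) in blast)
    have "norm ((deriv ^^ 1) (\<lambda>z. k z x) y) \<le> fact 1 * w x / (r/2) ^ 1"
    proof (rule Cauchy_inequality[of "\<lambda>z. k z x" y "r/2" "w x" 1])
      show "(\<lambda>z. k z x) holomorphic_on ball y (r/2)"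
        using h by (rule holomorphic_on_subset) auto
      show "continuous_on (cball y (r/2)) (\<lambda>z. k z x)"
        using h by (rule holomorphic_on_imp_continuous_on)
      fix y' assume "norm (y - y') = r/2"
      then have "y' \<in> cball y (r/2)" by (simp add: dist_norm)
      then show "norm (k y' x) \<le> w x" using sub by (intro w(2)[OF x]) auto
    qed (use r in auto)
    then show ?thesis by (simp add: field_simps)
  qed
  have lip: "norm (k z' x - k z x) \<le> (2 * w x / r) * norm (z' - z)" if x: "x \<in> space M" and z': "z' \<in> ball z (r/2)" for x z'
  proof -
    have "((\<lambda>z. k z x) has_field_derivative deriv (\<lambda>z. k z x) y) (at y within ball z (r/2))"
      if "y \<in> ball z (r/2)" for y
      using that r(1) by (intro has_field_derivative_at_within[OF der[OF x]]) auto
    from field_differentiable_bound[of "ball z (r/2)" "\<lambda>z. k z x" "deriv (\<lambda>z. k z x)" "2 * w x / r" z' z, OF convex_ball this dbound[OF x]]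
    show ?thesis using z' r(1) by auto
  qed
  have lim: "(\<lambda>n. (k (X n) x - k z x) / (X n - z)) \<longlonglongrightarrow> D x"
    if "x \<in> space M" "\<And>n. X n \<noteq> z" "X \<longlonglongrightarrow> z" for x X
    using der[OF that(1), of z] r(1) that(2,3) unfolding D_def has_field_derivative_iff tendsto_at_iff_sequentially
    by (auto simp: o_def)
  have "((\<lambda>z. \<integral>x. k z x \<partial>M) has_field_derivative (\<integral>x. D x \<partial>M)) (at z)"
    unfolding has_field_derivative_iff tendsto_at_iff_sequentially
  proof (intro allI impI)
    fix X assume X: "\<forall>n. X n \<in> UNIV - {z}" "X \<longlonglongrightarrow> z"
    have ev: "eventually (\<lambda>n. X n \<in> ball z (r/2)) sequentially"
      using X(2) r(1) by (intro topological_tendstoD) auto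
    then obtain N where N: "\<And>n. n \<ge> N \<Longrightarrow> X n \<in> ball z (r/2)" by (auto simp: eventually_sequentially)
    \<comment> \<open>Dominated convergence needs all terms in the smaller ball, so the first
      \<open>N\<close> terms are dropped.\<close>
    define Y where "Y n = X (n + N)" for n
    have Yz: "Y \<longlonglongrightarrow> z" unfolding Y_def using LIMSEQ_ignore_initial_segment[OF X(2)] .
    have Y: "Y n \<in> ball z (r/2)" "Y n \<noteq> z" "Y n \<in> ball z r" for n
      using N[of "n+N"] X r(1) by (auto simp: Y_def)
    have "(\<lambda>n. \<integral>x. (k (Y n) x - k z x) / (Y n - z) \<partial>M) \<longlonglongrightarrow> (\<integral>x. D x \<partial>M)"
    proof (rule integral_dominated_convergence[where w = "\<lambda>x. 2 * w x / r"])
      have m: "(\<lambda>x. (k (Y n) x - k z x) / (Y n - z)) \<in> borel_measurable M" for n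
      proof -
        have "Y n \<in> S" using Y(3) r(2) by blast
        then show ?thesis
          using meas z by (intro borel_measurable_divide borel_measurable_diff) auto
      qed
      then show "(\<lambda>x. (k (Y n) x - k z x) / (Y n - z)) \<in> borel_measurable M" for n .
      show "D \<in> borel_measurable M"
        by (rule borel_measurable_LIMSEQ_metric[where f = "\<lambda>n x. (k (Y n) x - k z x) / (Y n - z)", OF m]) (use lim Y Yz in auto)
      show "AE x in M. (\<lambda>n. (k (Y n) x - k z x) / (Y n - z)) \<longlonglongrightarrow> D x"
        using lim Y Yz by (intro AE_I2) auto
      show "AE x in M. norm ((k (Y n) x - k z x) / (Y n - z)) \<le> 2 * w x / r" for n
        using lip Y(1,2)[of n] by (intro AE_I2) (simp add: norm_divide pos_divide_le_eq)
      show "integrable M (\<lambda>x. 2 * w x / r)" using w(1) by simp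
    qed
    moreover have e: "(\<integral>x. (k (Y n) x - k z x) / (Y n - z) \<partial>M) = ((\<integral>x. k (Y n) x \<partial>M) - (\<integral>x. k z x \<partial>M)) / (Y n - z)" for n
      using int[OF Y(3)[of n]] int[of z] r(1) by simp
    ultimately have "(\<lambda>n. ((\<integral>x. k (Y n) x \<partial>M) - (\<integral>x. k z x \<partial>M)) / (Y n - z)) \<longlonglongrightarrow> (\<integral>x. D x \<partial>M)"
      unfolding e by blast
    then have "(\<lambda>n. (((\<lambda>y. ((\<integral>x. k y x \<partial>M) - (\<integral>x. k z x \<partial>M)) / (y - z)) \<circ> X) (n + N))) \<longlonglongrightarrow> (\<integral>x. D x \<partial>M)"
      by (simp add: Y_def o_def)
    then show "((\<lambda>y. ((\<integral>x. k y x \<partial>M) - (\<integral>x. k z x \<partial>M)) / (y - z)) \<circ> X) \<longlonglongrightarrow> (\<integral>x. D x \<partial>M)"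
      by (rule LIMSEQ_offset)
  qed
  then show "\<exists>f'. ((\<lambda>z. \<integral>x. k z x \<partial>M) has_field_derivative f') (at z)" by blast
qed

section \<open>Geometry of the slit plane\<close>

lemma in_slit_plane_iff: "z \<in> slit_plane \<alpha> \<longleftrightarrow> Im z \<noteq> 0 \<or> Re z < \<alpha>"
  by (auto simp: slit_plane_def complex_eq_iff image_iff not_le)

lemma open_slit_plane: "open (slit_plane \<alpha>)"
proof -
  have "slit_plane \<alpha> = {z. Im z > 0} \<union> {z. Im z < 0} \<union> {z. Re z < \<alpha>}"
    by (auto simp: in_slit_plane_iff)
  then show ?thesis
    by (simp add: open_Un open_halfspace_Im_gt open_halfspace_Im_lt open_halfspace_Re_lt)
qed

lemma ball_subset_slit_plane: "ball (of_real (\<alpha> - 1)) 1 \<subseteq> slit_plane \<alpha>"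
proof
  fix w assume "w \<in> ball (complex_of_real (\<alpha> - 1)) 1"
  then have "\<bar>Re (w - of_real (\<alpha> - 1))\<bar> < 1"
    using abs_Re_le_cmod[of "w - of_real (\<alpha> - 1)"] by (simp add: dist_norm norm_minus_commute)
  then have "Re w < \<alpha>" by (auto simp: abs_less_iff)
  then show "w \<in> slit_plane \<alpha>" by (simp add: in_slit_plane_iff)
qed

lemma connected_slit_plane: "connected (slit_plane \<alpha>)"
proof (rule starlike_imp_connected)
  have "closed_segment (of_real (\<alpha> - 1)) z \<subseteq> slit_plane \<alpha>" if z: "z \<in> slit_plane \<alpha>" for z
  proof
    fix w assume "w \<in> closed_segment (of_real (\<alpha> - 1)) z"
    then obtain u where u: "0 \<le> u" "u \<le> 1" "w = (1 - u) *\<^sub>R of_real (\<alpha> - 1) + u *\<^sub>R z"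
      by (auto simp: closed_segment_def)
    have im: "Im w = u * Im z" and re: "Re w = (1 - u) * (\<alpha> - 1) + u * Re z" unfolding u(3) by auto
    show "w \<in> slit_plane \<alpha>"
    proof (cases "u * Im z = 0")
      case True
      then have "u = 0 \<or> Re z < \<alpha>" using z by (auto simp: in_slit_plane_iff)
      then have "(1 - u) * (\<alpha> - 1) + u * Re z < \<alpha>"
      proof
        assume "Re z < \<alpha>"
        then show ?thesis using u convex_bound_lt[of "\<alpha> - 1" \<alpha> "Re z" "1 - u" u] by simp
      qed simp
      then show ?thesis using re by (simp add: in_slit_plane_iff)
    qed (use im in \<open>simp add: in_slit_plane_iff\<close>)
  qed
  moreover have "complex_of_real (\<alpha> - 1) \<in> slit_plane \<alpha>" by (simp add: in_slit_plane_iff)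
  ultimately show "starlike (slit_plane \<alpha>)" unfolding starlike_def by blast
qed


text \<open>A zero would mean \<open>z = x0 + 1 / x\<close> with \<open>0 < x \<le> 1\<close>, a
  point of the cut.\<close>

lemma one_minus_mult_nonzero:
  fixes x0 x :: real
  assumes "z \<in> slit_plane (x0 + 1)" "x \<in> {0..1}"
  shows "1 - of_real x * (z - of_real x0) \<noteq> 0"
proof
  assume "1 - of_real x * (z - of_real x0) = 0"
  then have im: "x * Im z = 0" and re: "x * (Re z - x0) = 1" by (simp_all add: complex_eq_iff)
  have "x \<noteq> 0" using re by auto
  then have "Re z - x0 < 1" "x > 0" using im assms by (auto simp: in_slit_plane_iff)
  then have "x * (Re z - x0) < x * 1" by (intro mult_strict_left_mono)
  then show False using re assms by simp
qed

lemma stieltjes_scalar_kernel_bound: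
  fixes x0 :: real
  assumes z: "z \<in> slit_plane (x0 + 1)"
  obtains r B where "r > 0" "ball z r \<subseteq> slit_plane (x0 + 1)"
    "\<And>x z'. x \<in> {0..1} \<Longrightarrow> z' \<in> ball z r \<Longrightarrow> norm ((z' - of_real x0) / (1 - of_real x * (z' - of_real x0))) \<le> B"
proof -
  obtain r where r: "r > 0" "cball z r \<subseteq> slit_plane (x0 + 1)"
    using open_slit_plane z open_contains_cball by blast
  let ?k = "\<lambda>(x::real, z'). (z' - of_real x0) / (1 - of_real x * (z' - of_real x0))"
  have "continuous_on ({0..1} \<times> cball z r) ?k"
    unfolding case_prod_unfold
    by (intro continuous_intros) (use one_minus_mult_nonzero r(2) in fastforce)
  then have "compact (?k ` ({0..1} \<times> cball z r))"
    by (intro compact_continuous_image compact_Times) auto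
  then obtain B where B: "\<And>v. v \<in> {0..1} \<times> cball z r \<Longrightarrow> norm (?k v) \<le> B"
    by (meson bounded_iff compact_imp_bounded imageI)
  show ?thesis
    by (rule that[of r B]) (use r B[of "(_, _)"] in auto)
qed

text \<open>The variable \<open>x = 1 / (t - x0)\<close> maps \<open>[\<alpha>, \<infinity>)\<close> onto \<open>(0, 1]\<close>, which turns the Taylor
  coefficients of \<open>f\<close> at \<open>x0\<close> into the moments of a Hausdorff moment problem. The function \<open>g\<close> is
  conjugated twice because \<open>w \<mapsto> 1 / w\<close> interchanges the half-planes and the sign of \<open>Im f\<close> is known on
  the upper one only.\<close>

theorem stieltjes_scalar:
  fixes f :: "complex \<Rightarrow> complex" and a :: "nat \<Rightarrow> complex" and \<alpha> C :: real
  defines "x0 \<equiv> \<alpha> - 1"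
  assumes hol: "f holomorphic_on slit_plane \<alpha>"
    and pos: "\<And>z. Im z > 0 \<Longrightarrow> Im (f z) \<ge> 0"
    and real: "\<And>x. x < \<alpha> \<Longrightarrow> Im (f (of_real x)) = 0"
    and growth: "\<And>y. y \<ge> 1 \<Longrightarrow> y * norm (f (\<i> * of_real y)) \<le> C"
    and a: "\<And>\<zeta>. norm \<zeta> < 1 \<Longrightarrow> (\<lambda>k. a k * \<zeta> ^ k) sums f (of_real x0 + \<zeta>)"
  obtains M where "finite_measure M" "sets M = sets borel" "AE t in M. \<alpha> \<le> t"
    "\<And>z. z \<in> slit_plane \<alpha> \<Longrightarrow> f z = (\<integral>t. inverse (of_real t - z) \<partial>M)"
    "\<And>k. of_real (\<integral>t. (1 / (t - x0)) ^ (k + 1) \<partial>M) = a k"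
proof -
  have ar: "Im (a k) = 0" for k
  proof (rule real_powser_coeffs)
    fix x :: real assume x: "\<bar>x\<bar> < 1"
    show "(\<lambda>k. a k * of_real x ^ k) sums f (of_real x0 + of_real x)" using a[of "of_real x"] x by simp
    show "Im (f (of_real x0 + of_real x)) = 0" using real[of "x0 + x"] x by (simp add: x0_def)
  qed
  then have a_Re: "of_real (Re (a k)) = a k" for k by (simp add: complex_eq_iff)
  define g where "g w = cnj (f (of_real x0 + inverse (cnj w)))" for w
  have slit: "of_real x0 + inverse w \<in> slit_plane \<alpha>" if "w \<notin> of_real ` {0..1}" for w
  proof -
    have w: "Im w \<noteq> 0 \<or> Re w < 0 \<or> Re w > 1"
    proof (rule ccontr)
      assume "\<not> ?thesis"
      then have "w = of_real (Re w)" "Re w \<in> {0..1}" by (auto simp: complex_eq_iff)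
      then show False using that by blast
    qed
    show ?thesis
    proof (cases "Im w = 0")
      case False
      then have "Im (inverse w) \<noteq> 0" by (auto simp: complex_eq_iff)
      then show ?thesis by (simp add: in_slit_plane_iff)
    next
      case True
      then have "w = of_real (Re w)" by (simp add: complex_eq_iff)
      then have e: "inverse w = of_real (inverse (Re w))" by (metis of_real_inverse)
      have "inverse (Re w) < 1" using w True by (auto simp: inverse_less_1_iff)
      then show ?thesis unfolding e in_slit_plane_iff by (simp only: plus_complex.sel Re_complex_of_real) (simp add: x0_def)
    qed
  qed
  have holg: "g holomorphic_on - (of_real ` {0..1})"
  proof -
    let ?S = "- (complex_of_real ` {0..1})"
    have S: "cnj ` ?S = ?S" using involuntory_imp_bij[of cnj] by (simp add: bij_image_Compl_eq image_image)
    have oS: "open ?S"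
      by (intro open_Compl compact_imp_closed compact_continuous_image continuous_intros) auto
    have "0 \<notin> ?S" by (auto intro!: image_eqI[of _ _ 0])
    then have "(\<lambda>w. f (of_real x0 + inverse w)) holomorphic_on ?S"
      by (intro holomorphic_on_compose_gen[OF _ hol, unfolded o_def] holomorphic_intros) (use slit in auto)
    then have "(cnj \<circ> (\<lambda>w. f (of_real x0 + inverse w)) \<circ> cnj) holomorphic_on ?S"
      by (intro holomorphic_on_compose_cnj_cnj[OF _ oS]) (simp only: S)
    then show ?thesis by (simp add: g_def[abs_def] o_def)
  qed
  have sums_g: "(\<lambda>j. a j * inverse w ^ j) sums g w" if "norm w > 1" for w
  proof -
    have "(\<lambda>j. a j * inverse (cnj w) ^ j) sums f (of_real x0 + inverse (cnj w))"
      by (rule a) (use that in \<open>auto simp: norm_inverse inverse_less_1_iff\<close>)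
    then have "(\<lambda>j. cnj (a j * inverse (cnj w) ^ j)) sums g w"
      unfolding g_def by (simp only: sums_cnj)
    moreover have "cnj (a j) = a j" for j using ar[of j] by (simp add: complex_eq_iff)
    ultimately show ?thesis by simp
  qed
  \<comment> \<open>The shift by one is that of a residue: \<open>a (n + 1)\<close> is the
    coefficient of \<open>1 / w\<close> in \<open>w ^ n * g w\<close>. Hence the measure below has
    the moments \<open>a (k + 1)\<close>, while \<open>a 0\<close> remains outside as an additive
    constant.\<close>
  define L where "L p = (\<Sum>n\<le>degree p. coeff p n * Re (a (n + 1)))" for p :: "real poly"
  have L_eq: "L p = (\<Sum>n\<le>N. coeff p n * Re (a (n + 1)))" if "degree p \<le> N" for p N
    unfolding L_def by (rule sum.mono_neutral_left) (use that in \<open>auto simp: coeff_eq_0\<close>)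
  interpret L: positive_functional L
  proof
    show "L (p + q) = L p + L q" for p q
      using L_eq[of "p + q" "max (degree p) (degree q)"] L_eq[of p "max (degree p) (degree q)"] L_eq[of q "max (degree p) (degree q)"]
      by (simp add: degree_add_le_max algebra_simps sum.distrib)
    show "L (smult c p) = c * L p" for c p
      using L_eq[of "smult c p" "degree p"] by (simp add: L_def sum_distrib_left mult_ac)
    show "0 \<le> L p" if "\<And>x. x \<in> {0..1} \<Longrightarrow> 0 \<le> poly p x" for p
      unfolding L_def
    proof (rule laurent_coefficients_nonneg[OF holg _ _ sums_g ar that])
      fix w :: complex assume "Im w > 0"
      then have "Im (inverse (cnj w)) > 0" by (simp add: divide_pos_pos sum_power2_gt_zero_iff) 
      then show "Im (g w) \<le> 0" using pos by (simp add: g_def)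
    next
      fix x :: real assume x: "x \<notin> {0..1}"
      then have "inverse x < 1" by (auto simp: inverse_less_1_iff)
      then show "Im (g (of_real x)) = 0" using real[of "x0 + inverse x"] by (simp add: g_def x0_def)
    qed
  qed
  obtain \<mu> where mu: "finite_measure \<mu>" and sets_mu: "sets \<mu> = sets borel" and AE_mu: "AE x in \<mu>. x \<in> {0..1}"
    and int_mu: "\<And>p. (\<integral>x. poly p x \<partial>\<mu>) = L p"
    by (rule L.hausdorff) blast
  interpret mu: finite_measure \<mu> by (rule mu)
  note [measurable_cong] = sets_mu
  have moment_mu: "(\<integral>x. x ^ k \<partial>\<mu>) = Re (a (k + 1))" for k
  proof -
    have "L (monom 1 k) = (\<Sum>n\<le>k. coeff (monom 1 k) n * Re (a (n + 1)))"
      by (rule L_eq) (simp add: degree_monom_le)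
    also have "\<dots> = (\<Sum>n\<le>k. if n = k then Re (a (k + 1)) else 0)" by (intro sum.cong) auto
    finally show ?thesis using int_mu[of "monom 1 k"] by (simp add: poly_monom)
  qed
  \<comment> \<open>With \<open>\<zeta> = z - x0\<close> this is the sum of
    \<open>x ^ k * \<zeta> ^ (k + 1)\<close> near \<open>x0\<close>, so integration against
    \<open>\<mu>\<close> reproduces the Taylor series of \<open>f\<close> except for
    \<open>a 0\<close>. Off \<open>[0, 1]\<close>, where \<open>\<mu>\<close> has no mass, the value
    0 keeps the kernel bounded.\<close>
  define K where "K z x = (if x \<in> {0..1} then (z - of_real x0) / (1 - of_real x * (z - of_real x0)) else 0)" for z :: complex and x :: real
  have Km [measurable]: "K z \<in> borel_measurable borel" for z
    unfolding K_def by measurable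
  have nz: "1 - of_real x * (z - of_real x0) \<noteq> 0" if "z \<in> slit_plane \<alpha>" "x \<in> {0..1}" for z x
    using one_minus_mult_nonzero[of z x0 x] that by (simp add: x0_def)
  have hol_K: "(\<lambda>z. \<integral>x. K z x \<partial>\<mu>) holomorphic_on slit_plane \<alpha>"
  proof (rule holomorphic_parametric_integral[OF open_slit_plane])
    fix x
    show "(\<lambda>z. K z x) holomorphic_on slit_plane \<alpha>"
      unfolding K_def using nz by (cases "x \<in> {0..1}") (auto intro!: holomorphic_intros)
  next
    fix z assume "z \<in> slit_plane \<alpha>"
    then have "z \<in> slit_plane (x0 + 1)" by (simp add: x0_def)
    then obtain r B where B: "r > 0" "ball z r \<subseteq> slit_plane (x0 + 1)"
      "\<And>x z'. x \<in> {0..1} \<Longrightarrow> z' \<in> ball z r \<Longrightarrow> norm ((z' - of_real x0) / (1 - of_real x * (z' - of_real x0))) \<le> B"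
      using stieltjes_scalar_kernel_bound by metis
    have "\<forall>x\<in>space \<mu>. \<forall>z'\<in>ball z r. norm (K z' x) \<le> \<bar>B\<bar>"
      using B(3) by (auto simp: K_def intro: order_trans[OF _ abs_ge_self])
    then show "\<exists>r>0. \<exists>w. ball z r \<subseteq> slit_plane \<alpha> \<and> integrable \<mu> w \<and> (\<forall>x\<in>space \<mu>. \<forall>z'\<in>ball z r. norm (K z' x) \<le> w x)"
      using B(1,2) by (intro exI[of _ r] exI[of _ "\<lambda>_. \<bar>B\<bar>"]) (auto simp: x0_def)
  qed auto
  have near: "f z = a 0 + (\<integral>x. K z x \<partial>\<mu>)" if z: "norm (z - of_real x0) < 1" for z
  proof -
    let ?\<zeta> = "z - of_real x0"
    have "(\<lambda>k. \<integral>x. indicator {0..1} x *\<^sub>R (of_real x ^ k * ?\<zeta> ^ (k + 1)) \<partial>\<mu>) sums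
        (\<integral>x. (\<Sum>k. indicator {0..1} x *\<^sub>R (of_real x ^ k * ?\<zeta> ^ (k + 1))) \<partial>\<mu>)"
    proof (rule sums_integral)
      have b: "norm (indicator {0..1} x *\<^sub>R (of_real x ^ k * ?\<zeta> ^ (k + 1))) \<le> norm ?\<zeta> ^ (k + 1)" for k x
        by (auto simp: indicator_def norm_mult norm_power intro!: mult_left_le_one_le power_le_one)
      show "integrable \<mu> (\<lambda>x. indicator {0..1} x *\<^sub>R (of_real x ^ k * ?\<zeta> ^ (k + 1)))" for k
        by (rule mu.integrable_const_bound[of _ "norm ?\<zeta> ^ (k + 1)"]) (use b in auto)
      have g: "summable (\<lambda>k. norm ?\<zeta> ^ (k + 1))" using z by (simp add: summable_mult)
      show "AE x in \<mu>. summable (\<lambda>k. norm (indicator {0..1} x *\<^sub>R (of_real x ^ k * ?\<zeta> ^ (k + 1))))"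
      proof (intro AE_I2 summable_comparison_test'[OF g, of 0])
        show "norm (norm (indicator {0..1} x *\<^sub>R (of_real x ^ k * ?\<zeta> ^ (k + 1)))) \<le> norm ?\<zeta> ^ (k + 1)" for x k
          using b[of x k] by simp
      qed
      show "summable (\<lambda>k. \<integral>x. norm (indicator {0..1} x *\<^sub>R (of_real x ^ k * ?\<zeta> ^ (k + 1))) \<partial>\<mu>)"
      proof (rule summable_comparison_test'[OF summable_mult[OF g, of "measure \<mu> (space \<mu>)"], of 0])
        fix k
        have "(\<integral>x. norm (indicator {0..1} x *\<^sub>R (of_real x ^ k * ?\<zeta> ^ (k + 1))) \<partial>\<mu>) \<le> (\<integral>x. norm ?\<zeta> ^ (k + 1) \<partial>\<mu>)"
          by (rule integral_mono') (use b in auto)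
        then show "norm (\<integral>x. norm (indicator {0..1} x *\<^sub>R (of_real x ^ k * ?\<zeta> ^ (k + 1))) \<partial>\<mu>) \<le> measure \<mu> (space \<mu>) * norm ?\<zeta> ^ (k + 1)"
          by simp
      qed
    qed
    moreover have "(\<Sum>k. indicator {0..1} x *\<^sub>R (of_real x ^ k * ?\<zeta> ^ (k + 1))) = K z x" for x
    proof (cases "x \<in> {0..1}")
      case True
      have "norm (of_real x * ?\<zeta>) \<le> 1 * norm ?\<zeta>"
        unfolding norm_mult using True by (intro mult_right_mono) auto
      then have "norm (of_real x * ?\<zeta>) < 1" using z by simp
      then have "(\<lambda>k. ?\<zeta> * (of_real x * ?\<zeta>) ^ k) sums (?\<zeta> * (1 / (1 - of_real x * ?\<zeta>)))"
        by (intro sums_mult geometric_sums)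
      then show ?thesis using True by (simp add: sums_iff K_def power_mult_distrib mult_ac)
    next
      case False
      then have "indicator {0..1} x = (0::real)" by simp
      moreover have "K z x = 0" using False by (auto simp: K_def)
      ultimately show ?thesis by simp
    qed
    moreover have "(\<integral>x. indicator {0..1} x *\<^sub>R (of_real x ^ k * ?\<zeta> ^ (k + 1)) \<partial>\<mu>) = a (k + 1) * ?\<zeta> ^ (k + 1)" for k
    proof -
      have "(\<integral>x. indicator {0..1} x *\<^sub>R (of_real x ^ k * ?\<zeta> ^ (k + 1)) \<partial>\<mu>) = (\<integral>x. of_real (x ^ k) * ?\<zeta> ^ (k + 1) \<partial>\<mu>)"
        by (rule integral_cong_AE) (use AE_mu in \<open>auto simp: indicator_def elim: eventually_mono\<close>)
      also have "\<dots> = of_real (\<integral>x. x ^ k \<partial>\<mu>) * ?\<zeta> ^ (k + 1)" by (simp del: of_real_power)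
      finally show ?thesis unfolding moment_mu a_Re .
    qed
    ultimately have "(\<lambda>k. a (Suc k) * ?\<zeta> ^ Suc k) sums (\<integral>x. K z x \<partial>\<mu>)" by simp
    then have "(\<lambda>k. a k * ?\<zeta> ^ k) sums ((\<integral>x. K z x \<partial>\<mu>) + a 0 * ?\<zeta> ^ 0)" by (rule sums_Suc)
    with a[OF z] show ?thesis by (simp add: sums_unique2 add.commute)
  qed
  have f_K: "f z = a 0 + (\<integral>x. K z x \<partial>\<mu>)" if "z \<in> slit_plane \<alpha>" for z
  proof -
    have "(\<lambda>z. f z - (a 0 + (\<integral>x. K z x \<partial>\<mu>))) z = 0"
    proof (rule analytic_continuation[OF _ open_slit_plane connected_slit_plane _ _ _ _ that])
      show "(\<lambda>z. f z - (a 0 + (\<integral>x. K z x \<partial>\<mu>))) holomorphic_on slit_plane \<alpha>"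
        by (intro holomorphic_intros hol hol_K)
      show "ball (of_real x0) 1 \<subseteq> slit_plane \<alpha>" unfolding x0_def by (rule ball_subset_slit_plane)
      show "complex_of_real x0 islimpt ball (of_real x0) 1" by (simp add: islimpt_ball)
    qed (use near in \<open>auto simp: in_slit_plane_iff x0_def dist_norm norm_minus_commute\<close>)
    then show ?thesis by simp
  qed
  have int_K: "integrable \<mu> (K z)" if "z \<in> slit_plane \<alpha>" for z
  proof -
    have "z \<in> slit_plane (x0 + 1)" using that by (simp add: x0_def)
    then obtain r B where B: "r > 0"
      "\<And>x z'. x \<in> {0..1} \<Longrightarrow> z' \<in> ball z r \<Longrightarrow> norm ((z' - of_real x0) / (1 - of_real x * (z' - of_real x0))) \<le> B"
      using stieltjes_scalar_kernel_bound by metis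
    show ?thesis
      by (rule mu.integrable_const_bound[of _ "\<bar>B\<bar>"])
        (use B in \<open>auto simp: K_def intro!: AE_I2 order_trans[OF _ abs_ge_self]\<close>)
  qed
  \<comment> \<open>This is \<open>y * Im (K (\<i> y) x)\<close> with \<open>y = n + 1\<close>. On
    \<open>[0, 1]\<close> it tends to \<open>1 / x\<^sup>2\<close> for \<open>x \<noteq> 0\<close>
    and to infinity for \<open>x = 0\<close>, while its integrals stay below \<open>C\<close>.
    Fatou's lemma therefore excludes mass at 0, the image of \<open>t = \<infinity>\<close>, and
    makes \<open>1 / x\<^sup>2\<close> integrable.\<close>
  define q where "q n x = real (Suc n) * Im (K (\<i> * of_real (real (Suc n))) x)" for n x
  have q: "q n x = real (Suc n) ^ 2 / ((1 + x * x0)\<^sup>2 + x\<^sup>2 * real (Suc n) ^ 2)" if "x \<in> {0..1}" for n x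
    using that by (simp add: q_def K_def Im_divide power2_eq_square algebra_simps)
  have q_nonneg: "q n x \<ge> 0" for n x
    using q[of x n] by (cases "x \<in> {0..1}") (auto simp: q_def K_def)
  have iy: "\<i> * of_real (real (Suc n)) \<in> slit_plane \<alpha>" for n by (simp add: in_slit_plane_iff)
  have int_q: "integrable \<mu> (q n)" for n unfolding q_def using int_K[OF iy[of n]] by simp
  have C0: "C \<ge> 0" using growth[of 1] by (rule order_trans[rotated]) auto
  have "(\<integral>\<^sup>+x. liminf (\<lambda>n. ennreal (q n x)) \<partial>\<mu>) \<le> liminf (\<lambda>n. \<integral>\<^sup>+x. ennreal (q n x) \<partial>\<mu>)"
    by (rule nn_integral_liminf) (simp add: q_def)
  also have "\<dots> \<le> liminf (\<lambda>n. ennreal C)"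
  proof (rule Liminf_mono, rule always_eventually, rule allI)
    fix n
    have "(\<integral>x. q n x \<partial>\<mu>) = real (Suc n) * Im (\<integral>x. K (\<i> * of_real (real (Suc n))) x \<partial>\<mu>)"
      unfolding q_def using int_K[OF iy[of n]] by simp
    also have "\<dots> = real (Suc n) * Im (f (\<i> * of_real (real (Suc n))))"
      using f_K[OF iy[of n]] ar[of 0] by simp
    also have "\<dots> \<le> real (Suc n) * norm (f (\<i> * of_real (real (Suc n))))"
      by (intro mult_left_mono order_trans[OF abs_ge_self abs_Im_le_cmod]) simp
    also have "\<dots> \<le> C" by (rule growth) simp
    finally show "(\<integral>\<^sup>+x. ennreal (q n x) \<partial>\<mu>) \<le> ennreal C"
      using q_nonneg by (subst nn_integral_eq_integral[OF int_q]) (auto intro: ennreal_leI)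
  qed
  also have "\<dots> = ennreal C" by (simp add: Liminf_const)
  finally have fin: "(\<integral>\<^sup>+x. liminf (\<lambda>n. ennreal (q n x)) \<partial>\<mu>) \<noteq> \<infinity>" 
    by (auto simp: top_unique)
  then have "AE x in \<mu>. liminf (\<lambda>n. ennreal (q n x)) \<noteq> \<infinity>"
    by (intro nn_integral_PInf_AE) (auto simp: q_def)
  then have inv2: "AE x in \<mu>. x \<noteq> 0"
  proof eventually_elim
    case (elim x)
    have "(\<lambda>n. ennreal (real (Suc n) ^ 2)) \<longlonglongrightarrow> \<infinity>"
      unfolding infinity_ennreal_def ennreal_tendsto_top_eq_at_top by real_asymp
    then show ?case using elim q[of 0] lim_imp_Liminf[of sequentially "\<lambda>n. ennreal (real (Suc n) ^ 2)" \<infinity>] by auto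
  qed
  have "AE x in \<mu>. liminf (\<lambda>n. ennreal (q n x)) = ennreal (1 / x\<^sup>2)"
    using inv2 AE_mu
  proof eventually_elim
    case (elim x)
    have "(\<lambda>n. real (Suc n) ^ 2 / ((1 + x * x0)\<^sup>2 + x\<^sup>2 * real (Suc n) ^ 2)) \<longlonglongrightarrow> inverse (x\<^sup>2)"
      using elim(1) by real_asymp
    then have "(\<lambda>n. ennreal (q n x)) \<longlonglongrightarrow> ennreal (1 / x\<^sup>2)" using q[OF elim(2)] by (intro tendsto_ennrealI) (simp add: inverse_eq_divide)
    then show ?case by (intro lim_imp_Liminf) auto
  qed
  then have "(\<integral>\<^sup>+x. ennreal (1 / x\<^sup>2) \<partial>\<mu>) = (\<integral>\<^sup>+x. liminf (\<lambda>n. ennreal (q n x)) \<partial>\<mu>)"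
    by (intro nn_integral_cong_AE) auto
  with fin have fin2: "(\<integral>\<^sup>+x. ennreal (1 / x\<^sup>2) \<partial>\<mu>) < \<infinity>" by (simp add: less_top)
  then have int2: "integrable \<mu> (\<lambda>x. 1 / x\<^sup>2)" by (intro integrableI_nonneg) auto
  have AE01: "AE x in \<mu>. x \<in> {0<..1}"
    using AE_mu inv2 by eventually_elim auto
  have int1: "integrable \<mu> (\<lambda>x. 1 / x)"
  proof (rule Bochner_Integration.integrable_bound[OF int2])
    show "AE x in \<mu>. norm (1 / x) \<le> norm (1 / x\<^sup>2)"
      using AE01 by eventually_elim (auto intro!: divide_left_mono simp: power2_eq_square mult_left_le)
  qed measurable
  \<comment> \<open>Undoes the substitution. With \<open>t = x0 + 1 / x\<close> and
    \<open>\<zeta> = z - x0\<close>, the product of \<open>1 / x\<^sup>2\<close> and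
    \<open>1 / (t - z)\<close> is \<open>\<zeta> / (1 - x * \<zeta>) + 1 / x\<close>, so the weight
    turns \<open>K\<close> into the Stieltjes kernel up to the constant \<open>c\<close>.\<close>
  define M where "M = distr (density \<mu> (\<lambda>x. ennreal (1 / x\<^sup>2))) borel (\<lambda>x. x0 + 1 / x)"
  have int_M: "(\<integral>t. h t \<partial>M) = (\<integral>x. (1 / x\<^sup>2) *\<^sub>R h (x0 + 1 / x) \<partial>\<mu>)"
    if [measurable]: "h \<in> borel_measurable borel" for h :: "real \<Rightarrow> 'b::{banach,second_countable_topology}"
    unfolding M_def by (subst integral_distr, simp, simp, subst integral_density) auto
  define c where "c = a 0 - of_real (\<integral>x. 1 / x \<partial>\<mu>)"
  have sets_M: "sets M = sets borel" by (simp add: M_def)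
  have fin_M: "finite_measure M"
  proof (rule finite_measureI)
    have "emeasure M (space M) = (\<integral>\<^sup>+x. ennreal (1 / x\<^sup>2) \<partial>\<mu>)"
      by (simp add: M_def emeasure_distr emeasure_density sets_eq_imp_space_eq[OF sets_mu])
    then show "emeasure M (space M) \<noteq> \<infinity>" using fin2 by auto
  qed
  interpret M: finite_measure M by (rule fin_M)
  have f_M: "f z = c + (\<integral>t. inverse (of_real t - z) \<partial>M)" if z: "z \<in> slit_plane \<alpha>" for z
  proof -
    have "(\<integral>t. inverse (of_real t - z) \<partial>M) = (\<integral>x. (1 / x\<^sup>2) *\<^sub>R inverse (of_real (x0 + 1 / x) - z) \<partial>\<mu>)"
      by (rule int_M) measurable
    also have "\<dots> = (\<integral>x. K z x + of_real (1 / x) \<partial>\<mu>)"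
    proof (rule integral_cong_AE)
      show "AE x in \<mu>. (1 / x\<^sup>2) *\<^sub>R inverse (of_real (x0 + 1 / x) - z) = K z x + of_real (1 / x)"
        using AE01
      proof eventually_elim
        case (elim x)
        let ?d = "1 - of_real x * (z - of_real x0)"
        have x: "x \<noteq> 0" and d: "?d \<noteq> 0" using elim nz[OF z, of x] by auto
        have "of_real (x0 + 1 / x) - z = ?d / of_real x" using x by (simp add: field_simps)
        then have "(1 / x\<^sup>2) *\<^sub>R inverse (of_real (x0 + 1 / x) - z) = 1 / (of_real x * ?d)"
          using x d by (simp add: scaleR_conv_of_real power2_eq_square)
        also have "\<dots> = (z - of_real x0) / ?d + 1 / of_real x"
          using x d by (simp add: add_divide_eq_iff divide_eq_eq) (simp add: field_simps)
        finally show ?case using elim by (simp add: K_def)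
      qed
    qed (auto intro!: borel_measurable_scaleR)
    also have "\<dots> = (\<integral>x. K z x \<partial>\<mu>) + of_real (\<integral>x. 1 / x \<partial>\<mu>)"
      using int_K[OF z] int1 by (simp del: of_real_divide)
    finally show ?thesis using f_K[OF z] by (simp add: c_def)
  qed
  \<comment> \<open>At \<open>\<i> y\<close> both \<open>f\<close> and the integral are of order
    \<open>1 / y\<close>, hence so is their difference, the constant \<open>c\<close>.\<close>
  have c_bound: "norm c \<le> (C + measure M (space M)) / real (Suc n)" for n
  proof -
    let ?y = "real (Suc n)"
    have "norm (\<integral>t. inverse (of_real t - \<i> * of_real ?y) \<partial>M) \<le> (\<integral>t. 1 / ?y \<partial>M)"
    proof (rule order_trans[OF integral_norm_bound integral_mono'])
      fix t :: real
      have "?y \<le> norm (of_real t - \<i> * of_real ?y)"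
        using abs_Im_le_cmod[of "of_real t - \<i> * of_real ?y"] by simp
      then have "inverse (norm (of_real t - \<i> * of_real ?y)) \<le> inverse ?y"
        by (rule le_imp_inverse_le) simp
      then show "norm (inverse (of_real t - \<i> * of_real ?y)) \<le> 1 / ?y"
        unfolding norm_inverse by (simp only: inverse_eq_divide)
    qed auto
    moreover have "norm (f (\<i> * of_real ?y)) \<le> C / ?y"
      using growth[of ?y] by (simp add: field_simps)
    moreover have "c = f (\<i> * of_real ?y) - (\<integral>t. inverse (of_real t - \<i> * of_real ?y) \<partial>M)"
      using f_M[OF iy[of n]] by simp
    then have "norm c \<le> norm (f (\<i> * of_real ?y)) + norm (\<integral>t. inverse (of_real t - \<i> * of_real ?y) \<partial>M)"
      by (simp only: norm_triangle_ineq4)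
    ultimately have "norm c \<le> C / ?y + (\<integral>t. 1 / ?y \<partial>M)" by linarith
    then show ?thesis by (simp add: add_divide_distrib)
  qed
  have c0: "c = 0"
  proof -
    have "(\<lambda>n. (C + measure M (space M)) / real (Suc n)) \<longlonglongrightarrow> 0"
      by real_asymp
    then have "norm c \<le> 0" by (rule LIMSEQ_le_const) (use c_bound in auto)
    then show ?thesis by simp
  qed
  show ?thesis
  proof (rule that[of M])
    show "AE t in M. \<alpha> \<le> t"
      unfolding M_def
    proof (subst AE_distr_iff)
      show "AE x in density \<mu> (\<lambda>x. ennreal (1 / x\<^sup>2)). \<alpha> \<le> x0 + 1 / x"
      proof (subst AE_density)
        show "AE x in \<mu>. 0 < ennreal (1 / x\<^sup>2) \<longrightarrow> \<alpha> \<le> x0 + 1 / x"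
          using AE01 by eventually_elim (simp add: x0_def)
      qed auto
    qed auto
    show "f z = (\<integral>t. inverse (of_real t - z) \<partial>M)" if "z \<in> slit_plane \<alpha>" for z
      using f_M[OF that] c0 by simp
    show "of_real (\<integral>t. (1 / (t - x0)) ^ (k + 1) \<partial>M) = a k" for k
    proof -
      have "(\<integral>t. (1 / (t - x0)) ^ (k + 1) \<partial>M) = (\<integral>x. (1 / x\<^sup>2) *\<^sub>R (1 / (x0 + 1 / x - x0)) ^ (k + 1) \<partial>\<mu>)"
        by (rule int_M) measurable
      also have "\<dots> = Re (a k)"
      \<comment> \<open>The moments of \<open>\<mu>\<close> only encode \<open>a 1\<close>,
        \<open>a 2\<close> and so on; for \<open>k = 0\<close> the claim is
        \<open>c = 0\<close>.\<close>
      proof (cases k)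
        case 0
        have "(\<integral>x. (1 / x\<^sup>2) *\<^sub>R (1 / (x0 + 1 / x - x0)) ^ (k + 1) \<partial>\<mu>) = (\<integral>x. 1 / x \<partial>\<mu>)"
          unfolding 0 by (intro Bochner_Integration.integral_cong) (auto simp: power2_eq_square)
        then show ?thesis using c0 0 by (simp add: c_def)
      next
        case (Suc j)
        have "(\<integral>x. (1 / x\<^sup>2) *\<^sub>R (1 / (x0 + 1 / x - x0)) ^ (k + 1) \<partial>\<mu>) = (\<integral>x. x ^ j \<partial>\<mu>)"
        proof (rule integral_cong_AE)
          show "AE x in \<mu>. (1 / x\<^sup>2) *\<^sub>R (1 / (x0 + 1 / x - x0)) ^ (k + 1) = x ^ j"
            using inv2 by eventually_elim (simp add: Suc power2_eq_square)
        qed measurable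
        then show ?thesis using moment_mu Suc by simp
      qed
      finally show ?thesis by (simp add: a_Re)
    qed
  qed (use fin_M sets_M in auto)
qed


section \<open>Quadratic forms of complex matrices\<close>

definition cinner :: "complex ^ 'q::finite \<Rightarrow> complex ^ 'q \<Rightarrow> complex" where
  "cinner u v = (\<Sum>i\<in>UNIV. cnj (u $ i) * v $ i)"

definition qform :: "complex ^ 'q ^ 'q::finite \<Rightarrow> complex ^ 'q \<Rightarrow> complex" where
  "qform A v = cinner v (A *v v)"

lemma cinner_add_left: "cinner (u + v) w = cinner u w + cinner v w"
  and cinner_add_right: "cinner w (u + v) = cinner w u + cinner w v"
  and cinner_scale_left: "cinner (c *s u) w = cnj c * cinner u w"
  and cinner_scale_right: "cinner w (c *s u) = c * cinner w u"
  and cinner_zero_left [simp]: "cinner 0 w = 0"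
  and cinner_zero_right [simp]: "cinner w 0 = 0"
  by (simp_all add: cinner_def algebra_simps sum.distrib sum_subtractf sum_distrib_left sum_negf)

lemma cnj_cinner: "cnj (cinner u v) = cinner v u"
  by (simp add: cinner_def mult.commute)

lemma cinner_self: "cinner v v = of_real ((norm v)\<^sup>2)"
proof -
  have "cinner v v = of_real (\<Sum>i\<in>UNIV. (norm (v $ i))\<^sup>2)"
    unfolding cinner_def of_real_sum by (intro sum.cong refl) (simp only: complex_norm_square mult.commute)
  then show ?thesis by (simp add: norm_vec_def L2_set_def sum_nonneg)
qed

lemma cinner_self_eq_0 [simp]: "cinner v v = 0 \<longleftrightarrow> v = 0"
  by (simp add: cinner_self)

lemma cinner_ctransp: "cinner u (A *v v) = cinner (ctransp A *v u) v"
proof -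
  have "cinner u (A *v v) = (\<Sum>i\<in>UNIV. \<Sum>j\<in>UNIV. cnj (u $ i) * A $ i $ j * v $ j)"
    by (simp add: cinner_def matrix_vector_mult_def sum_distrib_left mult.assoc)
  also have "\<dots> = (\<Sum>j\<in>UNIV. \<Sum>i\<in>UNIV. cnj (u $ i) * A $ i $ j * v $ j)"
    by (rule sum.swap)
  also have "\<dots> = cinner (ctransp A *v u) v"
    by (simp add: cinner_def matrix_vector_mult_def ctransp_def sum_distrib_left sum_distrib_right mult_ac)
  finally show ?thesis .
qed

lemma ctransp_ctransp [simp]: "ctransp (ctransp A) = A"
  by (simp add: ctransp_def vec_eq_iff)

lemma ctransp_mult: "ctransp (A ** B) = ctransp B ** ctransp A"
  by (simp add: ctransp_def matrix_matrix_mult_def vec_eq_iff mult.commute)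

lemma cinner_axis: "cinner (axis i 1) v = v $ i"
proof -
  have "cinner (axis i 1) v = (\<Sum>k\<in>UNIV. if k = i then v $ i else 0)"
    unfolding cinner_def by (intro sum.cong) (auto simp: axis_def)
  then show ?thesis by simp
qed

lemma matrix_vector_mult_axis: "(A *v axis j 1) $ i = (A $ i $ j :: complex)"
  by (simp add: matrix_vector_mult_def axis_def mult_delta_right)

lemma matrix_entry_cinner: "A $ i $ j = cinner (axis i 1) (A *v axis j 1)"
  by (simp add: cinner_axis matrix_vector_mult_axis)

text \<open>Expanding the form at \<open>w + c u\<close>, weighting with \<open>c\<close> and
  summing over the fourth roots of unity \<open>c\<close> cancels all terms but the one with the
  factor \<open>cnj c\<close>.\<close>

lemma cinner_polarization:
  "cinner u (A *v w) = (\<Sum>r<4. \<i> ^ r / 4 * qform A (w + \<i> ^ r *s u))"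
proof -
  have q: "qform A (w + c *s u) = qform A w + c * cinner w (A *v u) + cnj c * cinner u (A *v w) + cnj c * c * qform A u" for c
    by (simp add: qform_def matrix_vector_right_distrib vector_scalar_commute cinner_add_left cinner_add_right cinner_scale_left cinner_scale_right algebra_simps)
  have "\<i> ^ 3 = - \<i>" by (simp add: power3_eq_cube)
  moreover have "{..<4::nat} = {0, 1, 2, 3}" by auto
  ultimately show ?thesis unfolding q by (simp add: algebra_simps power2_eq_square)
qed

lemma qform_eq_imp_eq:
  assumes "\<And>v. qform A v = qform B v"
  shows "A = B"
  using assms cinner_polarization[of _ A] cinner_polarization[of _ B]
  by (simp add: vec_eq_iff matrix_entry_cinner)

lemma qform_sum: "qform A v = (\<Sum>i\<in>UNIV. \<Sum>j\<in>UNIV. cnj (v $ i) * A $ i $ j * v $ j)"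
  by (simp add: qform_def cinner_def matrix_vector_mult_def sum_distrib_left mult.assoc)

text \<open>A real-valued form has the same values for \<open>A\<close> and
  \<open>ctransp A\<close>, and over the complex numbers a matrix is determined by its form; so
  realness amounts to Hermitian symmetry.\<close>

lemma nonneg_hermitian_iff:
  "nonneg_hermitian A \<longleftrightarrow> (\<forall>v. Im (qform A v) = 0 \<and> 0 \<le> Re (qform A v))"
proof
  assume A: "nonneg_hermitian A"
  then have "ctransp A = A"
    unfolding nonneg_hermitian_def nonneg_hermitian_on_def ctransp_def vec_eq_iff by (metis (lifting) UNIV_I vec_lambda_beta)
  then have "cnj (qform A v) = qform A v" for v
    by (simp add: qform_def cnj_cinner cinner_ctransp)
  then have "Im (qform A v) = 0" for v by (metis complex_cnj_cancel_iff Reals_cnj_iff complex_is_Real_iff)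
  moreover have "0 \<le> Re (qform A v)" for v
    using A unfolding nonneg_hermitian_def nonneg_hermitian_on_def qform_sum by blast
  ultimately show "\<forall>v. Im (qform A v) = 0 \<and> 0 \<le> Re (qform A v)" by blast
next
  assume A: "\<forall>v. Im (qform A v) = 0 \<and> 0 \<le> Re (qform A v)"
  have "qform (ctransp A) v = cnj (qform A v)" for v
    by (simp add: qform_def cnj_cinner cinner_ctransp)
  then have "ctransp A = A" using A by (intro qform_eq_imp_eq) (simp add: complex_eq_iff)
  then have "A $ i $ j = cnj (A $ j $ i)" for i j
    by (metis (no_types) ctransp_def vec_lambda_beta)
  moreover have "0 \<le> Re (\<Sum>i\<in>UNIV. \<Sum>j\<in>UNIV. cnj (x i) * A $ i $ j * x j)" for x
    using A[rule_format, of "\<chi> i. x i"] by (simp add: qform_sum)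
  ultimately show "nonneg_hermitian A" unfolding nonneg_hermitian_def nonneg_hermitian_on_def by blast
qed

lemma nonneg_hermitian_ctransp: "nonneg_hermitian A \<Longrightarrow> ctransp A = A"
  unfolding nonneg_hermitian_def nonneg_hermitian_on_def ctransp_def vec_eq_iff by (metis (lifting) UNIV_I vec_lambda_beta)

lemma qform_add: "qform (A + B) v = qform A v + qform B v"
  and qform_diff: "qform (A - B) v = qform A v - qform B v"
  and qform_minus: "qform (- A) v = - qform A v"
  and qform_cmat_scale: "qform (c *\<^sub>C A) v = c * qform A v"
  and qform_zero [simp]: "qform 0 v = 0"
  by (simp_all add: qform_sum cmat_scale_def algebra_simps sum.distrib sum_subtractf sum_negf sum_distrib_left)

lemma qform_scaleR: "qform (r *\<^sub>R A) v = r *\<^sub>R qform A v"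
  by (simp add: qform_sum scaleR_sum_right)

lemma linear_qform: "linear (\<lambda>A. qform A v)"
  by (rule linearI) (simp_all add: qform_add qform_scaleR)

lemma bounded_linear_qform: "bounded_linear (\<lambda>A. qform A v)"
  by (simp add: linear_conv_bounded_linear[symmetric] linear_qform)

lemma linear_trace: "linear (trace :: complex ^ 'q ^ 'q::finite \<Rightarrow> complex)"
  by (rule linearI) (simp_all add: trace_def sum.distrib scaleR_sum_right)

lemma bounded_linear_trace: "bounded_linear (trace :: complex ^ 'q ^ 'q::finite \<Rightarrow> complex)"
  by (simp add: linear_conv_bounded_linear[symmetric] linear_trace)

lemma trace_qform: "trace A = (\<Sum>i\<in>UNIV. qform A (axis i 1))"
  by (simp add: trace_def qform_def matrix_entry_cinner[of A])

lemma nonneg_hermitian_trace: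
  assumes "nonneg_hermitian A"
  shows "0 \<le> Re (trace A)" "Im (trace A) = 0"
  using assms by (auto simp: trace_qform nonneg_hermitian_iff intro!: sum_nonneg)

text \<open>Evaluate the form at the sum of the i-th and \<open>c\<close> times the j-th unit
  vector, with the phase \<open>c\<close> for which \<open>c * A $ i $ j\<close> is negative: twice
  the modulus is at most \<open>A $ i $ i + A $ j $ j\<close>. In particular a vanishing trace
  forces a vanishing matrix, and densities of trace one are bounded.\<close>

lemma nonneg_hermitian_entry_le:
  assumes A: "nonneg_hermitian A"
  shows "norm (A $ i $ j) \<le> Re (trace A)"
proof (cases "A $ i $ j = 0")
  case True
  then show ?thesis using nonneg_hermitian_trace[OF A] by simp
next
  case False
  have zz: "cnj (A $ i $ j) * A $ i $ j = of_real (norm (A $ i $ j)) * of_real (norm (A $ i $ j))"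
    using complex_norm_square[of "A $ i $ j"] by (simp add: power2_eq_square mult.commute)
  define c where "c = - cnj (A $ i $ j) / of_real (norm (A $ i $ j))"
  have cc: "cnj c * c = 1" using False zz by (simp add: c_def mult.commute)
  have cA: "c * A $ i $ j = - of_real (norm (A $ i $ j))"
    using False zz by (simp add: c_def)
  have h: "A $ j $ i = cnj (A $ i $ j)"
    using nonneg_hermitian_ctransp[OF A] by (metis (no_types) ctransp_def vec_lambda_beta)
  have d: "0 \<le> Re (A $ k $ k)" for k
    using A[unfolded nonneg_hermitian_iff, rule_format, of "axis k 1"] by (simp add: qform_def matrix_entry_cinner)
  have le: "Re (A $ k $ k) \<le> Re (trace A)" for k
    unfolding trace_def Re_sum by (rule member_le_sum) (use d in auto)
  have "qform A (axis i 1 + c *s axis j 1) = A $ i $ i + c * A $ i $ j + cnj c * A $ j $ i + cnj c * c * A $ j $ j"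
    by (simp add: qform_def matrix_entry_cinner matrix_vector_right_distrib vector_scalar_commute cinner_add_left cinner_add_right cinner_scale_left cinner_scale_right algebra_simps)
  also have "cnj c * A $ j $ i = cnj (c * A $ i $ j)" by (simp add: h)
  finally have "Re (qform A (axis i 1 + c *s axis j 1)) = Re (A $ i $ i) - 2 * norm (A $ i $ j) + Re (A $ j $ j)"
    unfolding cA cc by simp
  then have "2 * norm (A $ i $ j) \<le> Re (A $ i $ i) + Re (A $ j $ j)"
    using A[unfolded nonneg_hermitian_iff, rule_format, of "axis i 1 + c *s axis j 1"] by simp
  then show ?thesis using le[of i] le[of j] by simp
qed

lemma closed_nonneg_hermitian: "closed {A :: complex ^ 'q ^ 'q::finite. nonneg_hermitian A}"
proof -
  have c: "continuous_on UNIV (\<lambda>A. qform A v)" for v :: "complex ^ 'q"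
    using bounded_linear_qform by (rule linear_continuous_on)
  have "{A :: complex ^ 'q ^ 'q. nonneg_hermitian A} = (\<Inter>v. {A. Im (qform A v) = 0} \<inter> {A. 0 \<le> Re (qform A v)})"
    by (auto simp: nonneg_hermitian_iff)
  also have "closed \<dots>"
    by (intro closed_INT closed_Int closed_Collect_eq closed_Collect_le continuous_intros ballI c)
  finally show ?thesis .
qed

text \<open>Reconstruction of a matrix from its quadratic form: a real-linear combination, with
  constant coefficient matrices, of the values of the form at finitely many vectors.\<close>

definition polar_vec :: "'q::finite \<Rightarrow> 'q \<Rightarrow> nat \<Rightarrow> complex ^ 'q" where
  "polar_vec i j r = axis j 1 + \<i> ^ r *s axis i 1"

definition polar_coeff :: "'q::finite \<Rightarrow> 'q \<Rightarrow> nat \<Rightarrow> complex ^ 'q ^ 'q" where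
  "polar_coeff i j r = (\<chi> a b. if a = i \<and> b = j then \<i> ^ r / 4 else 0)"

definition polar_sum :: "(complex ^ 'q::finite \<Rightarrow> real) \<Rightarrow> complex ^ 'q ^ 'q" where
  "polar_sum \<phi> = (\<Sum>(i, j, r)\<in>UNIV \<times> UNIV \<times> {..<4}. \<phi> (polar_vec i j r) *\<^sub>R polar_coeff i j r)"

lemma polar_sum_nth:
  "polar_sum \<phi> $ i $ j = (\<Sum>r<4. of_real (\<phi> (polar_vec i j r)) * (\<i> ^ r / 4))"
proof -
  have "polar_sum \<phi> $ i $ j = (\<Sum>a\<in>UNIV. \<Sum>b\<in>UNIV. \<Sum>r<4. if a = i then if b = j then of_real (\<phi> (polar_vec i j r)) * (\<i> ^ r / 4) else 0 else 0)"
    unfolding polar_sum_def sum.cartesian_product[symmetric] sum_component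
    by (intro sum.cong refl) (auto simp: polar_coeff_def scaleR_conv_of_real[of _ "z :: complex" for z])
  also have "\<dots> = (\<Sum>a\<in>UNIV. if a = i then (\<Sum>b\<in>UNIV. if b = j then (\<Sum>r<4. of_real (\<phi> (polar_vec i j r)) * (\<i> ^ r / 4)) else 0) else 0)"
  proof (rule sum.cong[OF refl])
    fix a
    have "(\<Sum>r<4. if b = j then of_real (\<phi> (polar_vec i j r)) * (\<i> ^ r / 4) else 0) =
      (if b = j then (\<Sum>r<4. of_real (\<phi> (polar_vec i j r)) * (\<i> ^ r / 4)) else (0 :: complex))" for b
      by simp
    then show "(\<Sum>b\<in>UNIV. \<Sum>r<4. if a = i then if b = j then of_real (\<phi> (polar_vec i j r)) * (\<i> ^ r / 4) else 0 else 0) =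
      (if a = i then (\<Sum>b\<in>UNIV. if b = j then (\<Sum>r<4. of_real (\<phi> (polar_vec i j r)) * (\<i> ^ r / 4)) else 0) else (0 :: complex))"
      by simp
  qed
  finally show ?thesis by simp
qed

lemma polar_sum_qform:
  assumes "\<And>v. qform A v = of_real (\<phi> v)"
  shows "polar_sum \<phi> = A"
  unfolding vec_eq_iff polar_sum_nth matrix_entry_cinner[of A] cinner_polarization polar_vec_def
  using assms by (simp add: mult.commute)

lemma qform_polar_sum:
  "qform (polar_sum \<phi>) v = (\<Sum>(i, j, r)\<in>UNIV \<times> UNIV \<times> {..<4}. cnj (v $ i) * v $ j * (\<i> ^ r / 4) * of_real (\<phi> (polar_vec i j r)))"
  unfolding qform_sum polar_sum_nth sum.cartesian_product[symmetric]
  by (simp add: sum_distrib_left sum_distrib_right mult_ac)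


lemma norm_cmat_le: "norm A \<le> (\<Sum>i\<in>UNIV. \<Sum>j\<in>UNIV. norm (A $ i $ j))" for A :: "complex ^ 'q ^ 'q"
proof -
  have "norm A \<le> (\<Sum>i\<in>UNIV. norm (A $ i))"
    unfolding norm_vec_def[of A] by (rule L2_set_le_sum) simp
  also have "\<dots> \<le> (\<Sum>i\<in>UNIV. \<Sum>j\<in>UNIV. norm (A $ i $ j))"
  proof (rule sum_mono)
    fix i
    show "norm (A $ i) \<le> (\<Sum>j\<in>UNIV. norm (A $ i $ j))"
      unfolding norm_vec_def[of "A $ i"] by (rule L2_set_le_sum) simp
  qed
  finally show ?thesis .
qed

lemma bounded_bilinear_cmat_scale: "bounded_bilinear ((*\<^sub>C) :: complex \<Rightarrow> complex ^ 'q ^ 'q::finite \<Rightarrow> _)"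
  unfolding bilinear_conv_bounded_bilinear[symmetric] bilinear_def
  by (auto intro!: linearI simp: cmat_scale_def vec_eq_iff algebra_simps)

lemma bounded_bilinear_cmat_mult: "bounded_bilinear ((**) :: complex ^ 'q ^ 'q::finite \<Rightarrow> complex ^ 'q ^ 'q \<Rightarrow> _)"
  unfolding bilinear_conv_bounded_bilinear[symmetric] bilinear_def
  by (auto intro!: linearI simp: matrix_matrix_mult_def vec_eq_iff algebra_simps sum.distrib scaleR_sum_right)

lemma borel_measurable_cmat_scale [measurable (raw)]:
  assumes "f \<in> borel_measurable M" "g \<in> borel_measurable M"
  shows "(\<lambda>t. f t *\<^sub>C (g t :: complex ^ 'q ^ 'q::finite)) \<in> borel_measurable M"
proof -
  have "continuous_on UNIV (\<lambda>x. fst x *\<^sub>C (snd x :: complex ^ 'q ^ 'q))"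
    by (intro bounded_bilinear.continuous_on[OF bounded_bilinear_cmat_scale] continuous_intros)
  from borel_measurable_continuous_Pair[OF assms this] show ?thesis by simp
qed

section \<open>Non-negative Hermitian measures and their trace densities\<close>

lemma space_half_line [simp]: "space (half_line \<alpha>) = {\<alpha>..}"
  by (simp add: half_line_def space_restrict_space)

lemma sets_half_line: "B \<in> sets (half_line \<alpha>) \<longleftrightarrow> B \<in> sets borel \<and> B \<subseteq> {\<alpha>..}"
  by (auto simp: half_line_def sets_restrict_space)

locale nh_measure =
  fixes \<alpha> :: real and \<sigma> :: "real set \<Rightarrow> complex ^ 'q ^ 'q::finite"
  assumes nhm: "nonneg_hermitian_measure \<alpha> \<sigma>"
begin

lemma nonneg: "B \<in> sets (half_line \<alpha>) \<Longrightarrow> nonneg_hermitian (\<sigma> B)"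
  using nhm by (auto simp: nonneg_hermitian_measure_def)

lemma sums: "range B \<subseteq> sets (half_line \<alpha>) \<Longrightarrow> disjoint_family B \<Longrightarrow> (\<lambda>n::nat. \<sigma> (B n)) sums \<sigma> (\<Union>n. B n)"
  using nhm by (auto simp: nonneg_hermitian_measure_def)

lemma empty: "\<sigma> {} = 0"
proof -
  have "(\<lambda>n::nat. \<sigma> {}) sums \<sigma> {}" using sums[of "\<lambda>_. {}"] by (auto simp: disjoint_family_on_def)
  then have "(\<lambda>n::nat. \<sigma> {}) \<longlonglongrightarrow> 0" using summable_LIMSEQ_zero sums_summable by blast
  then show ?thesis by (simp add: LIMSEQ_const_iff)
qed

text \<open>One construction for the two functionals used below: the trace, and the quadratic form
  at a vector.\<close>

definition scalar_measure :: "(complex ^ 'q ^ 'q \<Rightarrow> real) \<Rightarrow> real measure" where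
  "scalar_measure l = measure_of {\<alpha>..} (sets (half_line \<alpha>)) (\<lambda>B. ennreal (l (\<sigma> B)))"

context
  fixes l :: "complex ^ 'q ^ 'q \<Rightarrow> real"
  assumes lin: "bounded_linear l" and pos: "\<And>A. nonneg_hermitian A \<Longrightarrow> 0 \<le> l A"
begin

lemma sets_scalar_measure: "sets (scalar_measure l) = sets (half_line \<alpha>)"
  unfolding scalar_measure_def using sets.sets_measure_of_eq[of "half_line \<alpha>"] by simp

lemma space_scalar_measure: "space (scalar_measure l) = {\<alpha>..}"
  unfolding scalar_measure_def by (simp add: space_measure_of_conv)

lemma emeasure_scalar_measure:
  assumes "B \<in> sets (half_line \<alpha>)"
  shows "emeasure (scalar_measure l) B = ennreal (l (\<sigma> B))"
  unfolding scalar_measure_def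
proof (rule emeasure_measure_of_sigma)
  show "sigma_algebra {\<alpha>..} (sets (half_line \<alpha>))" using sets.sigma_algebra_axioms[of "half_line \<alpha>"] by simp
  show "positive (sets (half_line \<alpha>)) (\<lambda>B. ennreal (l (\<sigma> B)))"
    using bounded_linear.linear[OF lin] by (simp add: positive_def empty linear_0)
  show "countably_additive (sets (half_line \<alpha>)) (\<lambda>B. ennreal (l (\<sigma> B)))"
  proof (rule countably_additiveI)
    fix A :: "nat \<Rightarrow> real set"
    assume A: "range A \<subseteq> sets (half_line \<alpha>)" "disjoint_family A"
    have s: "(\<lambda>n. l (\<sigma> (A n))) sums l (\<sigma> (\<Union>n. A n))"
      using sums[OF A] by (rule bounded_linear.sums[OF lin])
    have "0 \<le> l (\<sigma> (A n))" for n using A by (intro pos nonneg) auto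
    then have "(\<Sum>n. ennreal (l (\<sigma> (A n)))) = ennreal (\<Sum>n. l (\<sigma> (A n)))"
      using s by (intro suminf_ennreal2) (auto simp: sums_iff)
    then show "(\<Sum>n. ennreal (l (\<sigma> (A n)))) = ennreal (l (\<sigma> (\<Union>n. A n)))" using s by (simp add: sums_iff)
  qed
qed (fact assms)

lemma measure_scalar_measure:
  assumes "B \<in> sets (half_line \<alpha>)"
  shows "measure (scalar_measure l) B = l (\<sigma> B)"
  unfolding measure_def emeasure_scalar_measure[OF assms] using pos[OF nonneg[OF assms]] by simp

lemma finite_scalar_measure: "finite_measure (scalar_measure l)"
proof (rule finite_measureI)
  have "{\<alpha>..} \<in> sets (half_line \<alpha>)" by (simp add: sets_half_line)
  then show "emeasure (scalar_measure l) (space (scalar_measure l)) \<noteq> \<infinity>"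
    by (simp add: space_scalar_measure emeasure_scalar_measure)
qed

end

abbreviation \<tau> :: "real measure" where "\<tau> \<equiv> trace_measure \<alpha> \<sigma>"

lemma trace_measure_eq: "\<tau> = scalar_measure (\<lambda>A. Re (trace A))"
  by (simp add: trace_measure_def scalar_measure_def)

lemma bounded_linear_Re_trace: "bounded_linear (\<lambda>A :: complex ^ 'q ^ 'q. Re (trace A))"
  using bounded_linear_compose[OF bounded_linear_Re bounded_linear_trace] .

lemma bounded_linear_Re_qform: "bounded_linear (\<lambda>A :: complex ^ 'q ^ 'q. Re (qform A v))"
  using bounded_linear_compose[OF bounded_linear_Re bounded_linear_qform] .

lemma Re_qform_nonneg: "nonneg_hermitian A \<Longrightarrow> 0 \<le> Re (qform A v)"
  by (simp add: nonneg_hermitian_iff)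

lemmas trace_lin = bounded_linear_Re_trace nonneg_hermitian_trace(1)
lemmas qform_lin = bounded_linear_Re_qform Re_qform_nonneg

lemma sets_trace_measure [measurable_cong]: "sets \<tau> = sets (half_line \<alpha>)"
  unfolding trace_measure_eq by (rule sets_scalar_measure[OF trace_lin])

lemma space_trace_measure [simp]: "space \<tau> = {\<alpha>..}"
  unfolding trace_measure_eq by (rule space_scalar_measure[OF trace_lin])

lemma measure_trace_measure: "B \<in> sets (half_line \<alpha>) \<Longrightarrow> measure \<tau> B = Re (trace (\<sigma> B))"
  unfolding trace_measure_eq by (rule measure_scalar_measure[OF trace_lin])

sublocale trace: finite_measure \<tau>
  unfolding trace_measure_eq by (rule finite_scalar_measure[OF trace_lin])

lemma measurable_trace_measure: "f \<in> borel_measurable borel \<Longrightarrow> f \<in> borel_measurable \<tau>"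
  unfolding measurable_cong_sets[OF sets_trace_measure refl] half_line_def by (rule measurable_restrict_space1)

text \<open>The trace dominates all entries, so \<open>\<sigma>\<close> vanishes on sets of trace
  measure zero and each of its quadratic forms has a Radon-Nikodym derivative.\<close>

lemma scalar_density:
  obtains d where "integrable \<tau> d" "\<And>B. B \<in> sets (half_line \<alpha>) \<Longrightarrow> Re (qform (\<sigma> B) v) = set_lebesgue_integral \<tau> B d"
proof -
  let ?N = "scalar_measure (\<lambda>A. Re (qform A v))"
  interpret N: finite_measure ?N by (rule finite_scalar_measure[OF qform_lin])
  have ac: "absolutely_continuous \<tau> ?N"
    unfolding absolutely_continuous_def
  proof
    fix B assume "B \<in> null_sets \<tau>"
    then have B: "B \<in> sets (half_line \<alpha>)" "measure \<tau> B = 0"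
      by (auto simp: sets_trace_measure null_setsD1 measure_def)
    then have "Re (trace (\<sigma> B)) = 0" by (simp add: measure_trace_measure)
    then have "\<sigma> B = 0" using nonneg_hermitian_entry_le[OF nonneg[OF B(1)]] by (simp add: vec_eq_iff)
    then show "B \<in> null_sets ?N"
      using B(1) by (intro null_setsI) (auto simp: emeasure_scalar_measure[OF qform_lin] sets_scalar_measure[OF qform_lin])
  qed
  have sN: "sets ?N = sets \<tau>" by (simp add: sets_scalar_measure[OF qform_lin] sets_trace_measure)
  obtain d where d: "d \<in> borel_measurable \<tau>" "AE x in \<tau>. RN_deriv \<tau> ?N x = ennreal (d x)" "\<And>x. 0 \<le> d x"
    using trace.real_RN_deriv[OF N.finite_measure_axioms ac sN] by blast
  have dN: "density \<tau> d = ?N"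
  proof -
    have "density \<tau> d = density \<tau> (RN_deriv \<tau> ?N)"
      using d(1,2) by (intro density_cong) auto
    then show ?thesis using trace.density_RN_deriv[OF ac sN] by simp
  qed
  have nn: "(\<integral>\<^sup>+x. ennreal (d x) * indicator B x \<partial>\<tau>) = ennreal (Re (qform (\<sigma> B) v))" if "B \<in> sets (half_line \<alpha>)" for B
  proof -
    have "(\<integral>\<^sup>+x. ennreal (d x) * indicator B x \<partial>\<tau>) = emeasure (density \<tau> d) B"
      using that d(1) by (intro emeasure_density[symmetric]) (auto simp: sets_trace_measure)
    then show ?thesis unfolding dN using that by (simp add: emeasure_scalar_measure[OF qform_lin])
  qed
  have "(\<integral>\<^sup>+x. ennreal (d x) \<partial>\<tau>) = (\<integral>\<^sup>+x. ennreal (d x) * indicator {\<alpha>..} x \<partial>\<tau>)"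
    by (intro nn_integral_cong) auto
  also have "\<dots> < \<infinity>" by (subst nn) (auto simp: sets_half_line)
  finally have int: "integrable \<tau> d" using d by (intro integrableI_nonneg) auto
  show ?thesis
  proof (rule that[OF int])
    fix B assume B: "B \<in> sets (half_line \<alpha>)"
    have "set_lebesgue_integral \<tau> B d = enn2real (\<integral>\<^sup>+x. ennreal (indicator B x *\<^sub>R d x) \<partial>\<tau>)"
      unfolding set_lebesgue_integral_def using d B by (intro integral_eq_nn_integral) (auto simp: sets_trace_measure)
    also have "(\<integral>\<^sup>+x. ennreal (indicator B x *\<^sub>R d x) \<partial>\<tau>) = (\<integral>\<^sup>+x. ennreal (d x) * indicator B x \<partial>\<tau>)"
      by (intro nn_integral_cong) (auto simp: indicator_def)
    finally show "Re (qform (\<sigma> B) v) = set_lebesgue_integral \<tau> B d"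
      using nn[OF B] Re_qform_nonneg[OF nonneg[OF B]] by simp
  qed
qed

lemma polar_sum_measure: "B \<in> sets (half_line \<alpha>) \<Longrightarrow> polar_sum (\<lambda>v. Re (qform (\<sigma> B) v)) = \<sigma> B"
  using nonneg[of B] by (intro polar_sum_qform) (simp add: nonneg_hermitian_iff complex_eq_iff)

text \<open>The scalar densities are chosen for each vector separately and need not be quadratic in
  it. Only those at the finitely many polarization vectors are used, and integration commutes with
  that finite combination.\<close>

lemma is_trace_density_ex: "\<exists>D. is_trace_density \<alpha> \<sigma> D"
proof -
  have "\<exists>d. \<forall>v. integrable \<tau> (d v) \<and> (\<forall>B\<in>sets (half_line \<alpha>). Re (qform (\<sigma> B) v) = set_lebesgue_integral \<tau> B (d v))"
    by (rule choice) (use scalar_density in metis)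
  then obtain d where d: "\<And>v. integrable \<tau> (d v)"
    "\<And>v B. B \<in> sets (half_line \<alpha>) \<Longrightarrow> Re (qform (\<sigma> B) v) = set_lebesgue_integral \<tau> B (d v)" by blast
  let ?I = "UNIV \<times> UNIV \<times> {..<4} :: ('q \<times> 'q \<times> nat) set"
  have "is_trace_density \<alpha> \<sigma> (\<lambda>t. polar_sum (\<lambda>v. d v t))"
    unfolding is_trace_density_def
  proof (intro conjI ballI)
    show "integrable \<tau> (\<lambda>t. polar_sum (\<lambda>v. d v t))"
      unfolding polar_sum_def case_prod_unfold by (intro Bochner_Integration.integrable_sum integrable_scaleR_left d)
    fix B assume B: "B \<in> sets (half_line \<alpha>)"
    have i: "integrable \<tau> (\<lambda>t. indicator B t *\<^sub>R d v t)" for v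
      using d(1) B by (intro integrable_mult_indicator) (auto simp: sets_trace_measure)
    have "set_lebesgue_integral \<tau> B (\<lambda>t. polar_sum (\<lambda>v. d v t)) =
        (\<integral>t. (\<Sum>x\<in>?I. (indicator B t *\<^sub>R d (polar_vec (fst x) (fst (snd x)) (snd (snd x))) t) *\<^sub>R polar_coeff (fst x) (fst (snd x)) (snd (snd x))) \<partial>\<tau>)"
      unfolding set_lebesgue_integral_def polar_sum_def case_prod_unfold by (simp add: scaleR_sum_right)
    also have "\<dots> = (\<Sum>x\<in>?I. (\<integral>t. indicator B t *\<^sub>R d (polar_vec (fst x) (fst (snd x)) (snd (snd x))) t \<partial>\<tau>) *\<^sub>R polar_coeff (fst x) (fst (snd x)) (snd (snd x)))"
      by (subst Bochner_Integration.integral_sum) (use i in \<open>auto intro!: integrable_scaleR_left sum.cong integral_scaleR_left\<close>)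
    also have "\<dots> = polar_sum (\<lambda>v. Re (qform (\<sigma> B) v))"
      unfolding d(2)[OF B] polar_sum_def case_prod_unfold set_lebesgue_integral_def ..
    finally show "\<sigma> B = set_lebesgue_integral \<tau> B (\<lambda>t. polar_sum (\<lambda>v. d v t))"
      using polar_sum_measure[OF B] by simp
  qed
  then show ?thesis by blast
qed

abbreviation D :: "real \<Rightarrow> complex ^ 'q ^ 'q" where "D \<equiv> trace_density \<alpha> \<sigma>"

lemma integrable_density: "integrable \<tau> D"
  and integral_density: "B \<in> sets (half_line \<alpha>) \<Longrightarrow> set_lebesgue_integral \<tau> B D = \<sigma> B"
proof -
  have "is_trace_density \<alpha> \<sigma> D"
    unfolding trace_density_def by (rule someI_ex[OF is_trace_density_ex])
  then show "integrable \<tau> D" "B \<in> sets (half_line \<alpha>) \<Longrightarrow> set_lebesgue_integral \<tau> B D = \<sigma> B"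
    by (auto simp: is_trace_density_def)
qed

lemma borel_measurable_density [measurable]: "D \<in> borel_measurable \<tau>"
  using integrable_density by (rule borel_measurable_integrable)

text \<open>The average of the density over \<open>B\<close> is \<open>\<sigma> B\<close> divided by
  its trace. A function whose averages over all sets of positive measure lie in a closed set takes
  its values there almost everywhere.\<close>

lemma AE_trace_density: "AE t in \<tau>. nonneg_hermitian (D t) \<and> trace (D t) = 1"
proof -
  let ?S = "{A :: complex ^ 'q ^ 'q. nonneg_hermitian A} \<inter> {A. trace A = 1}"
  have "AE t in \<tau>. D t \<in> ?S"
  proof (rule trace.averaging_theorem[OF integrable_density])
    show "closed ?S"
      by (intro closed_Int closed_nonneg_hermitian closed_Collect_eq continuous_intros
          linear_continuous_on[OF bounded_linear_trace])
    fix B assume B: "B \<in> sets \<tau>" "0 < measure \<tau> B"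
    then have B': "B \<in> sets (half_line \<alpha>)" by (simp add: sets_trace_measure)
    let ?m = "measure \<tau> B"
    have "nonneg_hermitian ((1 / ?m) *\<^sub>R \<sigma> B)"
      using nonneg[OF B'] B(2) by (simp add: nonneg_hermitian_iff qform_scaleR)
    moreover have "trace (\<sigma> B) = of_real ?m"
      using nonneg_hermitian_trace[OF nonneg[OF B']] measure_trace_measure[OF B'] by (simp add: complex_eq_iff)
    then have "trace ((1 / ?m) *\<^sub>R \<sigma> B) = 1"
      using B(2) by (simp add: linear_cmul[OF linear_trace] scaleR_conv_of_real[of _ "z :: complex" for z])
    ultimately show "(1 / ?m) *\<^sub>R set_lebesgue_integral \<tau> B D \<in> ?S"
      unfolding integral_density[OF B'] by simp
  qed
  then show ?thesis by simp
qed

lemma norm_scale_density_le: "AE t in \<tau>. norm (f t *\<^sub>C D t) \<le> real (CARD('q) * CARD('q)) * norm (f t)"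
  using AE_trace_density
proof eventually_elim
  case (elim t)
  have "norm (D t $ i $ j) \<le> 1" for i j
    using nonneg_hermitian_entry_le[of "D t" i j] elim by simp
  then have "norm ((f t *\<^sub>C D t) $ i $ j) \<le> norm (f t)" for i j
    by (simp add: cmat_scale_def norm_mult mult_left_le)
  then have "norm (f t *\<^sub>C D t) \<le> (\<Sum>i\<in>(UNIV::'q set). \<Sum>j\<in>(UNIV::'q set). norm (f t))"
    by (intro order_trans[OF norm_cmat_le] sum_mono)
  then show ?case by simp
qed

text \<open>The density is bounded, so its product with \<open>f\<close> is dominated by
  \<open>f\<close>; it has trace one, so the trace of the product gives \<open>f\<close>
  back.\<close>

lemma matrix_integrable_iff:
  assumes [measurable]: "f \<in> borel_measurable \<tau>"
  shows "matrix_integrable \<alpha> \<sigma> f \<longleftrightarrow> integrable \<tau> f"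
proof
  assume "matrix_integrable \<alpha> \<sigma> f"
  then have "integrable \<tau> (\<lambda>t. trace (f t *\<^sub>C D t))"
    unfolding matrix_integrable_def by (rule integrable_bounded_linear[OF bounded_linear_trace])
  moreover have "AE t in \<tau>. trace (f t *\<^sub>C D t) = f t"
    using AE_trace_density by eventually_elim (simp add: trace_def cmat_scale_def flip: sum_distrib_left)
  ultimately show "integrable \<tau> f"
    using assms integrable_cong_AE[of "\<lambda>t. trace (f t *\<^sub>C D t)" \<tau> f] by (auto dest: borel_measurable_integrable)
next
  assume f: "integrable \<tau> f"
  have m: "(\<lambda>t. f t *\<^sub>C D t) \<in> borel_measurable \<tau>" by measurable
  have "integrable \<tau> (\<lambda>t. real (CARD('q) * CARD('q)) * norm (f t))" using f by simp
  then show "matrix_integrable \<alpha> \<sigma> f"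
    unfolding matrix_integrable_def
    by (rule Bochner_Integration.integrable_bound[OF _ m]) (use norm_scale_density_le[of f] in simp)
qed

lemma integrable_qform_density:
  assumes "f \<in> borel_measurable \<tau>" "integrable \<tau> f"
  shows "integrable \<tau> (\<lambda>t. f t * qform (D t) v)"
    and "qform (matrix_integral \<alpha> \<sigma> f) v = (\<integral>t. f t * qform (D t) v \<partial>\<tau>)"
proof -
  have i: "integrable \<tau> (\<lambda>t. f t *\<^sub>C D t)"
    using matrix_integrable_iff[OF assms(1)] assms(2) by (simp add: matrix_integrable_def)
  show "integrable \<tau> (\<lambda>t. f t * qform (D t) v)"
    using integrable_bounded_linear[OF bounded_linear_qform i] by (simp add: qform_cmat_scale)
  show "qform (matrix_integral \<alpha> \<sigma> f) v = (\<integral>t. f t * qform (D t) v \<partial>\<tau>)"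
    using integral_bounded_linear[OF bounded_linear_qform i] by (simp add: qform_cmat_scale matrix_integral_def)
qed

end


section \<open>The integral representation\<close>

lemma slit_plane_dist:
  assumes "z \<in> slit_plane \<alpha>"
  obtains d where "d > 0" "\<And>t. t \<ge> \<alpha> \<Longrightarrow> d \<le> norm (complex_of_real t - z)"
proof (cases "Im z = 0")
  case True
  show ?thesis
  proof (rule that[of "\<alpha> - Re z"])
    show "\<alpha> - Re z > 0" using assms True by (simp add: in_slit_plane_iff)
    show "\<alpha> - Re z \<le> norm (complex_of_real t - z)" if "t \<ge> \<alpha>" for t
      using abs_Re_le_cmod[of "of_real t - z"] that by simp
  qed
next
  case False
  show ?thesis
  proof (rule that[of "\<bar>Im z\<bar>"])
    show "\<bar>Im z\<bar> \<le> norm (complex_of_real t - z)" for t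
      using abs_Im_le_cmod[of "of_real t - z"] by simp
  qed (use False in simp)
qed

context nh_measure begin

lemma borel_measurable_resolvent: "(\<lambda>t. inverse (complex_of_real t - z)) \<in> borel_measurable \<tau>"
  by (rule measurable_trace_measure) measurable

lemma integrable_bounded_mult:
  fixes f g :: "real \<Rightarrow> complex"
  assumes "integrable \<tau> f" "g \<in> borel_measurable \<tau>" "\<And>t. t \<ge> \<alpha> \<Longrightarrow> norm (g t) \<le> C"
  shows "integrable \<tau> (\<lambda>t. g t * f t)"
proof (rule Bochner_Integration.integrable_bound)
  show "integrable \<tau> (\<lambda>t. C * norm (f t))" using assms(1) by simp
  show "(\<lambda>t. g t * f t) \<in> borel_measurable \<tau>"
    using assms(1,2) borel_measurable_integrable by (intro borel_measurable_times) auto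
  show "AE t in \<tau>. norm (g t * f t) \<le> norm (C * norm (f t))"
  proof (rule AE_I2)
    fix t assume "t \<in> space \<tau>"
    then have t: "norm (g t) \<le> C" using assms(3) by simp
    have "norm (g t * f t) \<le> C * norm (f t)" unfolding norm_mult by (rule mult_right_mono[OF t]) simp
    then show "norm (g t * f t) \<le> norm (C * norm (f t))" by simp
  qed
qed

lemma norm_resolvent_le:
  assumes "z \<in> slit_plane \<alpha>"
  obtains C where "\<And>t. t \<ge> \<alpha> \<Longrightarrow> norm (inverse (complex_of_real t - z)) \<le> C"
proof -
  obtain d where d: "d > 0" "\<And>t. t \<ge> \<alpha> \<Longrightarrow> d \<le> norm (complex_of_real t - z)"
    using slit_plane_dist[OF assms] by blast
  show ?thesis
  proof (rule that[of "inverse d"])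
    show "norm (inverse (complex_of_real t - z)) \<le> inverse d" if "t \<ge> \<alpha>" for t
      unfolding norm_inverse using d that by (intro le_imp_inverse_le) auto
  qed
qed

lemma integrable_resolvent_mult:
  assumes "z \<in> slit_plane \<alpha>" "integrable \<tau> f"
  shows "integrable \<tau> (\<lambda>t. inverse (complex_of_real t - z) * f t)"
proof -
  obtain C where "\<And>t. t \<ge> \<alpha> \<Longrightarrow> norm (inverse (complex_of_real t - z)) \<le> C"
    using norm_resolvent_le[OF assms(1)] by blast
  then show ?thesis by (rule integrable_bounded_mult[OF assms(2) borel_measurable_resolvent])
qed

lemma integrable_resolvent: "z \<in> slit_plane \<alpha> \<Longrightarrow> integrable \<tau> (\<lambda>t. inverse (complex_of_real t - z))"
  using integrable_resolvent_mult[of z "\<lambda>_. 1"] by simp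

lemma borel_measurable_qform_density [measurable]: "(\<lambda>t. qform (D t) v) \<in> borel_measurable \<tau>"
  by (rule borel_measurable_continuous_on[OF linear_continuous_on[OF bounded_linear_qform] borel_measurable_density])

lemma AE_qform_density: "AE t in \<tau>. Im (qform (D t) v) = 0 \<and> 0 \<le> Re (qform (D t) v)"
  using AE_trace_density by eventually_elim (simp add: nonneg_hermitian_iff)

lemma integrable_Re_qform_density: "integrable \<tau> (\<lambda>t. Re (qform (D t) v))"
  using integrable_bounded_linear[OF bounded_linear_Re_qform integrable_density] .

lemma emeasure_qform_density:
  assumes "B \<in> sets (half_line \<alpha>)"
  shows "emeasure (density \<tau> (\<lambda>t. ennreal (Re (qform (D t) v)))) B = ennreal (Re (qform (\<sigma> B) v))"
proof -
  have B: "B \<in> sets \<tau>" using assms by (simp add: sets_trace_measure)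
  have i: "integrable \<tau> (\<lambda>t. indicator B t *\<^sub>R D t)"
    using integrable_density B by (rule integrable_mult_indicator[rotated])
  have "Re (qform (\<sigma> B) v) = (\<integral>t. Re (qform (indicator B t *\<^sub>R D t) v) \<partial>\<tau>)"
    using integral_bounded_linear[OF bounded_linear_Re_qform i, of v]
    by (simp add: integral_density[OF assms, symmetric] set_lebesgue_integral_def)
  also have "\<dots> = (\<integral>t. Re (qform (D t) v) * indicator B t \<partial>\<tau>)"
    by (simp add: qform_scaleR mult.commute)
  finally have e: "Re (qform (\<sigma> B) v) = (\<integral>t. Re (qform (D t) v) * indicator B t \<partial>\<tau>)" .
  have "emeasure (density \<tau> (\<lambda>t. ennreal (Re (qform (D t) v)))) B = (\<integral>\<^sup>+t. ennreal (Re (qform (D t) v)) * indicator B t \<partial>\<tau>)"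
    using B by (intro emeasure_density) auto
  also have "\<dots> = (\<integral>\<^sup>+t. ennreal (Re (qform (D t) v) * indicator B t) \<partial>\<tau>)"
    by (intro nn_integral_cong) (auto simp: indicator_def)
  also have "\<dots> = ennreal (Re (qform (\<sigma> B) v))"
    unfolding e
  proof (rule nn_integral_eq_integral)
    show "integrable \<tau> (\<lambda>t. Re (qform (D t) v) * indicator B t)"
      using integrable_real_mult_indicator[OF B integrable_Re_qform_density] .
    show "AE t in \<tau>. 0 \<le> Re (qform (D t) v) * indicator B t"
      using AE_qform_density[of v] by eventually_elim (auto simp: indicator_def)
  qed
  finally show ?thesis .
qed

end

lemma norm_qform_le: "norm (qform A v) \<le> operator_norm A * (norm v)\<^sup>2"
proof -
  have b: "bounded_linear ((*v) A)" by (rule matrix_vector_mul_bounded_linear)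
  have "norm (cinner v w) \<le> norm v * norm w" for w :: "complex ^ 'a"
  proof -
    have "norm (cinner v w) \<le> (\<Sum>i\<in>UNIV. norm (v $ i) * norm (w $ i))"
      unfolding cinner_def by (rule order_trans[OF norm_sum]) (simp add: norm_mult)
    also have "\<dots> \<le> L2_set (\<lambda>i. norm (v $ i)) UNIV * L2_set (\<lambda>i. norm (w $ i)) UNIV"
      using L2_set_mult_ineq[of "\<lambda>i. norm (v $ i)" "\<lambda>i. norm (w $ i)" UNIV] by simp
    finally show ?thesis by (simp add: norm_vec_def)
  qed
  then have "norm (qform A v) \<le> norm v * norm (A *v v)" by (simp add: qform_def)
  also have "\<dots> \<le> norm v * (operator_norm A * norm v)"
    unfolding operator_norm_def using onorm[OF b] by (intro mult_left_mono) auto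
  finally show ?thesis by (simp add: power2_eq_square mult_ac)
qed

lemma qform_matrix_Im: "qform (matrix_Im A) v = of_real (Im (qform A v))"
proof -
  have "qform (ctransp A) v = cnj (qform A v)" by (simp add: qform_def cnj_cinner cinner_ctransp)
  then show ?thesis by (simp add: matrix_Im_def qform_cmat_scale qform_diff complex_eq_iff)
qed

lemma S_class_iff:
  "F \<in> S_class \<alpha> \<longleftrightarrow> (\<forall>i j. (\<lambda>z. F z $ i $ j) holomorphic_on slit_plane \<alpha>) \<and>
    (\<forall>w v. Im w > 0 \<longrightarrow> 0 \<le> Im (qform (F w) v)) \<and>
    (\<forall>x v. x < \<alpha> \<longrightarrow> Im (qform (F (of_real x)) v) = 0 \<and> 0 \<le> Re (qform (F (of_real x)) v))"
  unfolding S_class_def by (simp add: nonneg_hermitian_iff qform_matrix_Im)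

theorem S0_class_represents:
  fixes F :: "complex \<Rightarrow> complex ^ 'q ^ 'q::finite"
  assumes F: "F \<in> S0_class \<alpha>"
  shows "\<exists>\<sigma>. represents \<alpha> \<sigma> F"
proof -
  have S: "F \<in> S_class \<alpha>" and bdd: "bdd_above ((\<lambda>y::real. y * operator_norm (F (\<i> * of_real y))) ` {1..})"
    using F by (auto simp: S0_class_def)
  have hol: "(\<lambda>z. F z $ i $ j) holomorphic_on slit_plane \<alpha>" for i j using S by (simp add: S_class_iff)
  obtain C where C: "\<And>y. y \<ge> 1 \<Longrightarrow> y * operator_norm (F (\<i> * of_real y)) \<le> C"
    using bdd by (auto simp: bdd_above_def)
  define x0 where "x0 = \<alpha> - 1"
  define A where "A k = (\<chi> i j. (deriv ^^ k) (\<lambda>z. F z $ i $ j) (of_real x0) / fact k)" for k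
  have holq: "(\<lambda>z. qform (F z) v) holomorphic_on slit_plane \<alpha>" for v
    unfolding qform_sum by (intro holomorphic_intros hol)
  have sums: "(\<lambda>k. qform (A k) v * \<zeta> ^ k) sums qform (F (of_real x0 + \<zeta>)) v" if "norm \<zeta> < 1" for \<zeta> v
  proof -
    have b: "ball (of_real x0) 1 \<subseteq> slit_plane \<alpha>" unfolding x0_def by (rule ball_subset_slit_plane)
    have "(\<lambda>k. A k $ i $ j * \<zeta> ^ k) sums (F (of_real x0 + \<zeta>) $ i $ j)" for i j
      using holomorphic_power_series[OF holomorphic_on_subset[OF hol b], of "of_real x0 + \<zeta>" i j] that
      by (simp add: A_def dist_norm)
    then have "(\<lambda>k. \<Sum>i\<in>UNIV. \<Sum>j\<in>UNIV. cnj (v $ i) * v $ j * (A k $ i $ j * \<zeta> ^ k)) sums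
        (\<Sum>i\<in>UNIV. \<Sum>j\<in>UNIV. cnj (v $ i) * v $ j * (F (of_real x0 + \<zeta>) $ i $ j))"
      by (intro sums_sum sums_mult)
    then show ?thesis by (simp add: qform_sum sum_distrib_left mult_ac)
  qed
  have "\<exists>M. \<forall>v. finite_measure (M v) \<and> sets (M v) = sets borel \<and> (AE t in M v. \<alpha> \<le> t) \<and>
      (\<forall>z\<in>slit_plane \<alpha>. qform (F z) v = (\<integral>t. inverse (of_real t - z) \<partial>M v)) \<and>
      (\<forall>k. of_real (\<integral>t. (1 / (t - x0)) ^ (k + 1) \<partial>M v) = qform (A k) v)"
  proof (rule choice, rule allI)
    fix v :: "complex ^ 'q"
    have g: "y * norm (qform (F (\<i> * of_real y)) v) \<le> C * (norm v)\<^sup>2" if "y \<ge> 1" for y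
    proof -
      have "y * norm (qform (F (\<i> * of_real y)) v) \<le> y * (operator_norm (F (\<i> * of_real y)) * (norm v)\<^sup>2)"
        using that by (intro mult_left_mono norm_qform_le) auto
      also have "\<dots> \<le> C * (norm v)\<^sup>2"
        unfolding mult.assoc[symmetric] by (intro mult_right_mono C that) auto
      finally show ?thesis .
    qed
    have p: "0 \<le> Im (qform (F z) v)" if "Im z > 0" for z using S that by (simp add: S_class_iff)
    have r: "Im (qform (F (of_real x)) v) = 0" if "x < \<alpha>" for x using S that by (simp add: S_class_iff)
    show "\<exists>M. finite_measure M \<and> sets M = sets borel \<and> (AE t in M. \<alpha> \<le> t) \<and>
      (\<forall>z\<in>slit_plane \<alpha>. qform (F z) v = (\<integral>t. inverse (of_real t - z) \<partial>M)) \<and>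
      (\<forall>k. of_real (\<integral>t. (1 / (t - x0)) ^ (k + 1) \<partial>M) = qform (A k) v)"
      by (rule stieltjes_scalar[OF holq p r g sums[unfolded x0_def]]) (auto simp: x0_def)
  qed
  then obtain M where M: "\<And>v. finite_measure (M v)" "\<And>v. sets (M v) = sets borel" "\<And>v. AE t in M v. \<alpha> \<le> t"
    "\<And>z v. z \<in> slit_plane \<alpha> \<Longrightarrow> qform (F z) v = (\<integral>t. inverse (of_real t - z) \<partial>M v)"
    "\<And>k v. of_real (\<integral>t. (1 / (t - x0)) ^ (k + 1) \<partial>M v) = qform (A k) v" by blast
  define \<sigma> where "\<sigma> B = polar_sum (\<lambda>v. measure (M v) B)" for B
  \<comment> \<open>The measures \<open>M v\<close> come from separate existence statements, so it
    has to be shown that \<open>v \<mapsto> M v B\<close> is a quadratic form. The linear relation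
    expressing this holds for the moments, which are forms of \<open>A k\<close>, and carries over
    to the measures by uniqueness.\<close>
  have q: "qform (\<sigma> B) v = of_real (measure (M v) B)" if B: "B \<in> sets borel" for B v
  proof -
    let ?I = "UNIV \<times> UNIV \<times> {..<4} :: ('q \<times> 'q \<times> nat) set"
    \<comment> \<open>\<open>None\<close> stands for \<open>v\<close> itself with coefficient -1,
      \<open>Some\<close> for the polarization vectors; a vanishing total is the wanted
      identity.\<close>
    let ?J = "insert None (Some ` ?I)"
    define c where "c x = (case x of None \<Rightarrow> -1 | Some (i, j, r) \<Rightarrow> cnj (v $ i) * v $ j * (\<i> ^ r / 4))" for x
    define N where "N x = M (case x of None \<Rightarrow> v | Some (i, j, r) \<Rightarrow> polar_vec i j r)" for x
    have split: "(\<Sum>x\<in>?J. c x * of_real (h (N x))) = qform (polar_sum (\<lambda>v. h (M v))) v - of_real (h (M v))" for h :: "real measure \<Rightarrow> real"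
    proof -
      have "(\<Sum>x\<in>?J. c x * of_real (h (N x))) = (\<Sum>x\<in>Some ` ?I. c x * of_real (h (N x))) - of_real (h (M v))"
        by (subst sum.insert) (auto simp: c_def N_def)
      also have "(\<Sum>x\<in>Some ` ?I. c x * of_real (h (N x))) = (\<Sum>x\<in>?I. c (Some x) * of_real (h (N (Some x))))"
        by (subst sum.reindex) (auto simp: inj_on_def)
      also have "\<dots> = qform (polar_sum (\<lambda>v. h (M v))) v"
        unfolding qform_polar_sum by (intro sum.cong refl) (auto simp: c_def N_def)
      finally show ?thesis .
    qed
    have N: "finite_measure (N x)" "sets (N x) = sets borel" "AE t in N x. \<alpha> \<le> t" for x
      unfolding N_def by (rule M)+
    have "(\<Sum>x\<in>?J. c x * of_real (measure (N x) B)) = 0"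
    proof (rule signed_measures_eq_zero[OF _ N _ B])
      show "finite ?J" by simp
      fix k
      have "polar_sum (\<lambda>v. \<integral>t. (1 / (t - x0)) ^ (k + 1) \<partial>M v) = A k"
        by (rule polar_sum_qform) (simp only: M(5))
      then show "(\<Sum>x\<in>?J. c x * of_real (\<integral>t. (1 / (t - (\<alpha> - 1))) ^ (k + 1) \<partial>N x)) = 0"
        unfolding split[of "\<lambda>N. \<integral>t. (1 / (t - (\<alpha> - 1))) ^ (k + 1) \<partial>N"] using M(5)[of v k] by (simp only: x0_def) simp
    qed
    then show ?thesis unfolding split[of "\<lambda>N. measure N B"] \<sigma>_def by simp
  qed
  have nhm: "nonneg_hermitian_measure \<alpha> \<sigma>"
    unfolding nonneg_hermitian_measure_def
  proof (intro conjI ballI allI impI)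
    fix B assume "B \<in> sets (half_line \<alpha>)"
    then show "nonneg_hermitian (\<sigma> B)" using q[of B] by (simp add: nonneg_hermitian_iff sets_half_line)
  next
    fix B :: "nat \<Rightarrow> real set"
    assume B: "range B \<subseteq> sets (half_line \<alpha>)" "disjoint_family B"
    have "(\<lambda>n. measure (M v) (B n)) sums measure (M v) (\<Union>n. B n)" for v
    proof -
      interpret finite_measure "M v" by (rule M(1))
      show ?thesis by (rule finite_measure_UNION) (use B M(2) in \<open>auto simp: sets_half_line\<close>)
    qed
    then show "(\<lambda>n. \<sigma> (B n)) sums \<sigma> (\<Union>n. B n)"
      unfolding \<sigma>_def polar_sum_def case_prod_unfold by (intro sums_sum sums_scaleR_left)
  qed
  then interpret nh_measure \<alpha> \<sigma> by unfold_locales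
  have "F z = matrix_integral \<alpha> \<sigma> (\<lambda>t. inverse (of_real t - z))" if z: "z \<in> slit_plane \<alpha>" for z
  proof (rule qform_eq_imp_eq)
    fix v
    interpret Mv: finite_measure "M v" by (rule M(1))
    let ?h = "\<lambda>t. inverse (complex_of_real t - z)"
    have h [measurable]: "?h \<in> borel_measurable \<tau>" by (rule borel_measurable_resolvent)
    have dens: "density \<tau> (\<lambda>t. ennreal (Re (qform (D t) v))) = restrict_space (M v) {\<alpha>..}"
    proof (rule measure_eqI)
      have s: "sets (restrict_space (M v) {\<alpha>..}) = sets (half_line \<alpha>)"
        unfolding half_line_def by (rule sets_restrict_space_cong) (rule M(2))
      then show "sets (density \<tau> (\<lambda>t. ennreal (Re (qform (D t) v)))) = sets (restrict_space (M v) {\<alpha>..})"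
        by (simp add: sets_trace_measure)
      fix B assume "B \<in> sets (density \<tau> (\<lambda>t. ennreal (Re (qform (D t) v))))"
      then have B: "B \<in> sets (half_line \<alpha>)" by (simp add: sets_trace_measure)
      then have B': "B \<in> sets borel" "B \<subseteq> {\<alpha>..}" by (auto simp: sets_half_line)
      have "emeasure (restrict_space (M v) {\<alpha>..}) B = emeasure (M v) B"
        using B' M(2)[of v] by (intro emeasure_restrict_space) (auto simp: sets_eq_imp_space_eq[OF M(2)[of v]])
      then show "emeasure (density \<tau> (\<lambda>t. ennreal (Re (qform (D t) v)))) B = emeasure (restrict_space (M v) {\<alpha>..}) B"
        unfolding emeasure_qform_density[OF B] q[OF B'(1)] by (simp add: Mv.emeasure_eq_measure)
    qed
    have "qform (matrix_integral \<alpha> \<sigma> ?h) v = (\<integral>t. ?h t * qform (D t) v \<partial>\<tau>)"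
      by (rule integrable_qform_density[OF h integrable_resolvent[OF z]])
    also have "\<dots> = (\<integral>t. Re (qform (D t) v) *\<^sub>R ?h t \<partial>\<tau>)"
    proof (rule integral_cong_AE)
      show "AE t in \<tau>. ?h t * qform (D t) v = Re (qform (D t) v) *\<^sub>R ?h t"
        using AE_qform_density[of v] by eventually_elim (simp add: complex_eq_iff)
    qed measurable
    also have "\<dots> = (\<integral>t. ?h t \<partial>density \<tau> (\<lambda>t. ennreal (Re (qform (D t) v))))"
      using AE_qform_density[of v] by (intro Bochner_Integration.integral_density[symmetric]) auto
    also have "\<dots> = (\<integral>t. indicator {\<alpha>..} t *\<^sub>R ?h t \<partial>M v)"
      unfolding dens by (rule integral_restrict_space) (simp add: M(2) sets_eq_imp_space_eq[OF M(2)[of v]])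
    also have "\<dots> = (\<integral>t. ?h t \<partial>M v)"
    proof (rule integral_cong_AE)
      show "AE t in M v. indicator {\<alpha>..} t *\<^sub>R ?h t = ?h t"
        using M(3)[of v] by eventually_elim simp
    qed (simp_all add: measurable_cong_sets[OF M(2)[of v] refl])
    finally show "qform (F z) v = qform (matrix_integral \<alpha> \<sigma> ?h) v" using M(4)[OF z] by simp
  qed
  with nhm show ?thesis unfolding represents_def by blast
qed


section \<open>Moore--Penrose inverses\<close>

interpretation cmat_mult: bounded_bilinear "(**) :: complex ^ 'q ^ 'q::finite \<Rightarrow> complex ^ 'q ^ 'q \<Rightarrow> _"
  by (rule bounded_bilinear_cmat_mult)

interpretation cmat_scale: bounded_bilinear "(*\<^sub>C) :: complex \<Rightarrow> complex ^ 'q ^ 'q::finite \<Rightarrow> _"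
  by (rule bounded_bilinear_cmat_scale)

lemma cmat_scale_mult_left: "(c *\<^sub>C A) ** B = c *\<^sub>C (A ** B)"
  and cmat_scale_mult_right: "A ** (c *\<^sub>C B) = c *\<^sub>C (A ** B)"
  and cmat_scale_scale: "c *\<^sub>C d *\<^sub>C A = (c * d) *\<^sub>C A"
  and cmat_scale_one [simp]: "1 *\<^sub>C A = A"
  by (simp_all add: cmat_scale_def matrix_matrix_mult_def vec_eq_iff sum_distrib_left mult_ac)

lemma cmat_scale_vec: "(c *\<^sub>C A) *v v = c *s (A *v v)"
  by (simp add: cmat_scale_def matrix_vector_mult_def vec_eq_iff sum_distrib_left mult_ac)

lemmas cmat_distribs = cmat_mult.add_left cmat_mult.add_right cmat_mult.diff_left cmat_mult.diff_right
  cmat_mult.minus_left cmat_mult.minus_right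

lemma matrix_mul_eq_assoc: "B ** C = E \<Longrightarrow> A ** B ** C = A ** (E :: complex ^ 'q ^ 'q::finite)"
  by (simp add: matrix_mul_assoc[symmetric])

text \<open>\<open>A ** X\<close> and \<open>A ** Y\<close> are Hermitian projections onto the range
  of \<open>A\<close>, so they coincide; likewise \<open>X ** A\<close> and \<open>Y ** A\<close>.
  Hence \<open>X ** A ** X = X ** A ** Y = Y ** A ** Y\<close>.\<close>

lemma moore_penrose_unique:
  assumes X: "is_moore_penrose A X" and Y: "is_moore_penrose A Y"
  shows "X = Y"
proof -
  have x: "A ** X ** A = A" "X ** A ** X = X" "ctransp (A ** X) = A ** X" "ctransp (X ** A) = X ** A"
    and y: "A ** Y ** A = A" "Y ** A ** Y = Y" "ctransp (A ** Y) = A ** Y" "ctransp (Y ** A) = Y ** A"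
    using X Y by (auto simp: is_moore_penrose_def)
  have "A ** X = ctransp (A ** Y ** (A ** X))"
    using x(3) y(1) by (metis matrix_mul_assoc)
  also have "\<dots> = (A ** X) ** (A ** Y)" by (metis ctransp_mult x(3) y(3))
  also have "\<dots> = A ** Y" by (simp add: matrix_mul_assoc x(1))
  finally have ax: "A ** X = A ** Y" .
  have "X ** A = ctransp ((X ** A) ** (Y ** A))"
    using x(4) y(1) by (metis matrix_mul_assoc)
  also have "\<dots> = (Y ** A) ** (X ** A)" by (metis ctransp_mult x(4) y(4))
  also have "\<dots> = Y ** A" by (metis matrix_mul_assoc x(1))
  finally have xa: "X ** A = Y ** A" .
  have "X = X ** A ** X" by (simp add: x(2))
  also have "\<dots> = X ** (A ** Y)" by (simp add: ax flip: matrix_mul_assoc)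
  also have "\<dots> = Y ** A ** Y" by (simp add: xa matrix_mul_assoc)
  finally show ?thesis by (simp add: y(2))
qed

lemma mp_inverse_eqI: "is_moore_penrose A X \<Longrightarrow> mp_inverse A = X"
  unfolding mp_inverse_def using moore_penrose_unique by blast

text \<open>A Hermitian \<open>A\<close> is injective on its range, so \<open>A = A\<^sup>2 B\<close> for some \<open>B\<close>; then \<open>A B\<close> is the
  orthogonal projection onto the range and \<open>A B\<^sup>2\<close> is the Moore--Penrose inverse.\<close>

lemma hermitian_square_solvable:
  fixes A :: "complex ^ 'q ^ 'q::finite"
  assumes A: "ctransp A = A"
  obtains B where "A = A ** A ** B"
proof -
  have ker: "A *v v = 0" if "A *v (A *v v) = 0" for v
  proof -
    have "cinner (A *v v) (A *v v) = cinner v (A *v (A *v v))" by (simp add: cinner_ctransp[of v A] A)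
    then show ?thesis using that by simp
  qed
  have lin: "linear ((*v) A)" using matrix_vector_mul_bounded_linear[of A] by (rule bounded_linear.linear)
  have sub: "subspace (range ((*v) A))" using lin by (rule linear_subspace_image) simp
  have inj: "inj_on ((*v) A) (range ((*v) A))"
  proof (rule inj_onI)
    fix x y assume "x \<in> range ((*v) A)" "y \<in> range ((*v) A)" and e: "A *v x = A *v y"
    then obtain v w where "x = A *v v" "y = A *v w" by auto
    then have "A *v (A *v (v - w)) = 0" using e by (simp add: matrix_vector_mult_diff_distrib)
    then have "A *v (v - w) = 0" by (rule ker)
    then show "x = y" by (simp add: \<open>x = _\<close> \<open>y = _\<close> matrix_vector_mult_diff_distrib)
  qed
  have "(*v) A ` range ((*v) A) = range ((*v) A)"
  proof (rule subspace_dim_equal)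
    show "subspace ((*v) A ` range ((*v) A))" using lin sub by (rule linear_subspace_image)
    show "dim ((*v) A ` range ((*v) A)) \<ge> dim (range ((*v) A))"
      using dim_image_eq[OF lin, of "range ((*v) A)"] inj sub by (simp add: span_eq_iff[THEN iffD2])
  qed (use sub in auto)
  then have "\<forall>v. \<exists>w. A *v v = A *v (A *v w)" by (metis (no_types, lifting) image_iff rangeI)
  then obtain w where w: "\<And>v. A *v v = A *v (A *v (w v))" by metis
  define B where "B = (\<chi> i j. w (axis j 1) $ i)"
  have "B *v axis j 1 = w (axis j 1)" for j by (simp add: B_def vec_eq_iff matrix_vector_mult_axis)
  then have "(A ** A ** B) $ i $ j = A $ i $ j" for i j
    using w[of "axis j 1"] by (simp add: matrix_vector_mult_axis[symmetric] matrix_vector_mul_assoc[symmetric])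
  then show ?thesis by (intro that[of B]) (simp add: vec_eq_iff)
qed

lemma hermitian_mp_inverse:
  fixes A :: "complex ^ 'q ^ 'q::finite"
  assumes A: "ctransp A = A"
  obtains P where "ctransp P = P" "A ** mp_inverse A = P" "mp_inverse A ** A = P" "P ** P = P"
    "P ** A = A" "A ** P = A" "P ** mp_inverse A = mp_inverse A" "mp_inverse A ** P = mp_inverse A"
    "ctransp (mp_inverse A) = mp_inverse A"
proof -
  obtain B where B: "A = A ** A ** B" using hermitian_square_solvable[OF A] .
  have B': "ctransp B ** A ** A = A"
    using arg_cong[OF B, of ctransp] by (simp add: ctransp_mult A matrix_mul_assoc)
  define P where "P = A ** B"
  \<comment> \<open>Both expressions for \<open>P\<close> come from \<open>A = A ** A ** B\<close>
    and its adjoint; their equality makes \<open>P\<close> Hermitian.\<close>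
  have P1: "P = ctransp B ** A"
  proof -
    have "P = ctransp B ** A ** A ** B" by (simp add: P_def B')
    also have "\<dots> = ctransp B ** A" using B by (simp flip: matrix_mul_assoc)
    finally show ?thesis .
  qed
  have P2: "ctransp P = P" by (simp add: P1 ctransp_mult A) (simp add: P_def flip: P1)
  have PA: "P ** A = A" by (simp add: P1 B')
  have AP: "A ** P = A" using B by (simp add: P_def matrix_mul_assoc)
  have PP: "P ** P = P" by (metis P_def PA matrix_mul_assoc)
  define X where "X = P ** B"
  have X1: "X = ctransp B ** A ** B" by (simp add: X_def P1)
  have X2: "ctransp X = X" by (simp add: X1 ctransp_mult A matrix_mul_assoc)
  have PX: "P ** X = X" by (simp add: X_def matrix_mul_assoc PP)
  have AX: "A ** X = P" by (simp add: X_def matrix_mul_assoc AP) (simp add: P_def)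
  have XA: "X ** A = P" using arg_cong[OF AX, of ctransp] by (simp add: ctransp_mult A X2 P2)
  have XP: "X ** P = X" using arg_cong[OF PX, of ctransp] by (simp add: ctransp_mult X2 P2)
  have "mp_inverse A = X"
    by (rule mp_inverse_eqI) (simp add: is_moore_penrose_def AX XA PA PX P2)
  then show ?thesis using that[of P] P2 AX XA PP PA AP PX XP X2 by simp
qed

text \<open>Were \<open>A *v v\<close> not zero, moving \<open>v\<close> by a suitable negative real
  multiple of it would make the form negative: the linear term \<open>2 * r * a\<close> outweighs
  the quadratic term \<open>r * r * b\<close>.\<close>

lemma nonneg_hermitian_qform_0:
  assumes A: "nonneg_hermitian A" and v: "qform A v = 0"
  shows "A *v v = 0"
proof (rule ccontr)
  let ?u = "A *v v"
  assume "?u \<noteq> 0"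
  define a where "a = (norm ?u)\<^sup>2"
  have a: "a > 0" using \<open>?u \<noteq> 0\<close> by (simp add: a_def)
  define b where "b = Re (qform A ?u)"
  have b: "b \<ge> 0" using A by (simp add: b_def nonneg_hermitian_iff)
  have 1: "cinner ?u (A *v v) = of_real a" by (simp add: cinner_self a_def)
  have 2: "cinner v (A *v ?u) = of_real a"
    using 1 nonneg_hermitian_ctransp[OF A] by (simp add: cinner_ctransp[of v A])
  have q: "Re (qform A (v + of_real r *s ?u)) = 2 * r * a + r * r * b" for r
    using v 1 2 by (simp add: b_def qform_def matrix_vector_right_distrib vector_scalar_commute
        cinner_add_left cinner_add_right cinner_scale_left cinner_scale_right algebra_simps)
  \<comment> \<open>The exact minimizer would be \<open>- a / b\<close>; the summand 1 covers
    \<open>b = 0\<close> and still leaves a negative value.\<close>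
  define r where "r = - a / (1 + b)"
  have "0 \<le> Re (qform A (v + of_real r *s ?u))" using A by (simp only: nonneg_hermitian_iff)
  then have "0 \<le> 2 * r * a + r * r * b" unfolding q .
  also have "2 * r * a + r * r * b = - (a * a) * (2 + b) / ((1 + b) * (1 + b))"
    using b by (simp add: r_def divide_simps) (simp add: algebra_simps)
  finally have "a * a * (2 + b) / ((1 + b) * (1 + b)) \<le> 0" by simp
  moreover have "0 < a * a * (2 + b) / ((1 + b) * (1 + b))"
    using a b by (intro divide_pos_pos mult_pos_pos) auto
  ultimately show False by simp
qed

section \<open>The transformed function\<close>

lemma matrix_vector_bounded_linear: "bounded_linear (\<lambda>A :: complex ^ 'q ^ 'q::finite. A *v v)"
  unfolding linear_conv_bounded_linear[symmetric]
  by (intro linearI) (simp_all add: matrix_vector_mult_def vec_eq_iff algebra_simps sum.distrib scaleR_sum_right)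

context nh_measure begin

abbreviation I :: "(real \<Rightarrow> complex) \<Rightarrow> complex ^ 'q ^ 'q" where "I \<equiv> matrix_integral \<alpha> \<sigma>"

lemma integrable_cmat_scale_density: "integrable \<tau> f \<Longrightarrow> integrable \<tau> (\<lambda>t. f t *\<^sub>C D t)"
  using matrix_integrable_iff[of f] by (simp add: matrix_integrable_def)

lemma I_bounded_linear:
  assumes "integrable \<tau> f" "bounded_linear l"
  shows "l (I f) = (\<integral>t. l (f t *\<^sub>C D t) \<partial>\<tau>)"
  unfolding matrix_integral_def
  by (rule integral_bounded_linear[OF assms(2) integrable_cmat_scale_density[OF assms(1)], symmetric])

lemma I_add: "integrable \<tau> f \<Longrightarrow> integrable \<tau> g \<Longrightarrow> I (\<lambda>t. f t + g t) = I f + I g"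
  unfolding matrix_integral_def cmat_scale.add_left by (simp add: integrable_cmat_scale_density)

lemma I_scale: "integrable \<tau> f \<Longrightarrow> I (\<lambda>t. c * f t) = c *\<^sub>C I f"
  unfolding matrix_integral_def cmat_scale_scale[symmetric]
  by (rule integral_bounded_linear[OF cmat_scale.bounded_linear_right integrable_cmat_scale_density])

lemma I_sum: "(\<And>i. i \<in> A \<Longrightarrow> integrable \<tau> (f i)) \<Longrightarrow> I (\<lambda>t. \<Sum>i\<in>A. f i t) = (\<Sum>i\<in>A. I (f i))"
  unfolding matrix_integral_def cmat_scale.sum_left by (simp add: integrable_cmat_scale_density)

lemma I_cong: "(\<And>t. t \<ge> \<alpha> \<Longrightarrow> f t = g t) \<Longrightarrow> I f = I g"
  unfolding matrix_integral_def by (rule Bochner_Integration.integral_cong) auto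

lemma norm_I_le:
  assumes "integrable \<tau> f"
  shows "norm (I f) \<le> real (CARD('q) * CARD('q)) * (\<integral>t. norm (f t) \<partial>\<tau>)"
proof -
  have "norm (I f) \<le> (\<integral>t. norm (f t *\<^sub>C D t) \<partial>\<tau>)"
    unfolding matrix_integral_def by (rule integral_norm_bound)
  also have "\<dots> \<le> (\<integral>t. real (CARD('q) * CARD('q)) * norm (f t) \<partial>\<tau>)"
    using assms integrable_cmat_scale_density[OF assms] norm_scale_density_le
    by (intro integral_mono_AE) auto
  finally show ?thesis by simp
qed

lemma I_dominated_convergence:
  assumes m: "\<And>n. f n \<in> borel_measurable \<tau>" "g \<in> borel_measurable \<tau>" and w: "integrable \<tau> w"
    and b: "\<And>n t. t \<ge> \<alpha> \<Longrightarrow> norm (f n t) \<le> w t"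
    and l: "\<And>t. t \<ge> \<alpha> \<Longrightarrow> (\<lambda>n. f n t) \<longlonglongrightarrow> g t"
  shows "(\<lambda>n. I (f n)) \<longlonglongrightarrow> I g"
  unfolding matrix_integral_def
proof (rule integral_dominated_convergence)
  show "integrable \<tau> (\<lambda>t. real (CARD('q) * CARD('q)) * w t)" using w by simp
  show "AE t in \<tau>. (\<lambda>n. f n t *\<^sub>C D t) \<longlonglongrightarrow> g t *\<^sub>C D t"
    using l by (intro AE_I2 cmat_scale.tendsto tendsto_const) simp
  show "AE t in \<tau>. norm (f n t *\<^sub>C D t) \<le> real (CARD('q) * CARD('q)) * w t" for n
    using norm_scale_density_le[of "f n"] AE_space
  proof eventually_elim
    case (elim t)
    have "norm (f n t) \<le> w t" using b elim(2) by simp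
    then show ?case by (intro order_trans[OF elim(1)] mult_left_mono) auto
  qed
qed (use m in measurable)

lemma trace_I:
  assumes "integrable \<tau> f"
  shows "trace (I f) = (\<integral>t. f t \<partial>\<tau>)"
proof -
  have i: "integrable \<tau> (\<lambda>t. trace (f t *\<^sub>C D t))"
    by (rule integrable_bounded_linear[OF bounded_linear_trace integrable_cmat_scale_density[OF assms]])
  have "AE t in \<tau>. trace (f t *\<^sub>C D t) = f t"
    using AE_trace_density by eventually_elim (simp add: trace_def cmat_scale_def flip: sum_distrib_left)
  then show ?thesis
    unfolding I_bounded_linear[OF assms bounded_linear_trace]
    using assms i by (intro integral_cong_AE) auto
qed

lemma qform_I: "integrable \<tau> f \<Longrightarrow> qform (I f) v = (\<integral>t. f t * qform (D t) v \<partial>\<tau>)"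
  and integrable_qform: "integrable \<tau> f \<Longrightarrow> integrable \<tau> (\<lambda>t. f t * qform (D t) v)"
  using integrable_qform_density[of f v] by (auto dest: borel_measurable_integrable)

lemma ctransp_I:
  assumes "integrable \<tau> f"
  shows "ctransp (I f) = I (\<lambda>t. cnj (f t))"
proof (rule qform_eq_imp_eq)
  fix v
  have "qform (ctransp (I f)) v = cnj (qform (I f) v)" by (simp add: qform_def cnj_cinner cinner_ctransp)
  also have "\<dots> = (\<integral>t. cnj (f t * qform (D t) v) \<partial>\<tau>)" unfolding qform_I[OF assms] by (rule Bochner_Integration.integral_cnj[symmetric])
  also have "\<dots> = (\<integral>t. cnj (f t) * qform (D t) v \<partial>\<tau>)"
  proof (rule integral_cong_AE)
    show "AE t in \<tau>. cnj (f t * qform (D t) v) = cnj (f t) * qform (D t) v"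
      using AE_qform_density[of v] by eventually_elim (simp add: complex_eq_iff)
    show "(\<lambda>t. cnj (f t * qform (D t) v)) \<in> borel_measurable \<tau>" "(\<lambda>t. cnj (f t) * qform (D t) v) \<in> borel_measurable \<tau>"
      using integrable_qform[OF assms, of v] integrable_qform[of "\<lambda>t. cnj (f t)" v] assms
      by (auto intro!: borel_measurable_integrable simp del: complex_cnj_mult)
  qed
  also have "\<dots> = qform (I (\<lambda>t. cnj (f t))) v" using assms by (subst qform_I) auto
  finally show "qform (ctransp (I f)) v = qform (I (\<lambda>t. cnj (f t))) v" .
qed

text \<open>The integral of the non-negative function \<open>Re (qform (D t) v)\<close> vanishes, so
  the function does almost everywhere. That the density itself annihilates \<open>v\<close> is what
  makes every integral against \<open>\<sigma>\<close> annihilate \<open>v\<close>.\<close>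

lemma AE_density_null:
  assumes "I (\<lambda>_. 1) *v v = 0"
  shows "AE t in \<tau>. D t *v v = 0"
proof -
  have "(\<integral>t. qform (D t) v \<partial>\<tau>) = 0"
    using qform_I[of "\<lambda>_. 1" v] assms by (simp add: qform_def)
  then have "(\<integral>t. Re (qform (D t) v) \<partial>\<tau>) = 0"
    using integrable_qform[of "\<lambda>_. 1" v] by simp
  then have "AE t in \<tau>. Re (qform (D t) v) = 0"
    using AE_qform_density[of v] integrable_Re_qform_density[of v]
    by (subst (asm) integral_nonneg_eq_0_iff_AE) auto
  then show ?thesis using AE_trace_density
    by eventually_elim (simp add: nonneg_hermitian_qform_0 nonneg_hermitian_iff complex_eq_iff)
qed

lemma I_null:
  assumes "I (\<lambda>_. 1) *v v = 0" "integrable \<tau> f"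
  shows "I f *v v = 0"
proof -
  have "I f *v v = (\<integral>t. (f t *\<^sub>C D t) *v v \<partial>\<tau>)"
    by (rule I_bounded_linear[OF assms(2) matrix_vector_bounded_linear])
  also have "\<dots> = (\<integral>t. 0 \<partial>\<tau>)"
  proof (rule integral_cong_AE)
    show "AE t in \<tau>. (f t *\<^sub>C D t) *v v = 0"
      using AE_density_null[OF assms(1)] by eventually_elim (simp add: cmat_scale_vec)
    show "(\<lambda>t. (f t *\<^sub>C D t) *v v) \<in> borel_measurable \<tau>"
      by (rule borel_measurable_integrable) (rule integrable_bounded_linear[OF matrix_vector_bounded_linear integrable_cmat_scale_density[OF assms(2)]])
  qed simp
  finally show ?thesis by simp
qed

text \<open>For fixed \<open>z\<close> the values of \<open>1 / (t - z)\<close> lie in an open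
  half-plane bounded by a line through 0, so a constant factor \<open>c\<close> makes the real part
  positive for all \<open>t \<ge> \<alpha>\<close>. A vanishing integral then forces the form of the
  density to vanish almost everywhere.\<close>

lemma resolvent_qform_eq_0:
  assumes z: "z \<in> slit_plane \<alpha>" and q: "qform (I (\<lambda>t. inverse (of_real t - z))) v = 0"
  shows "I (\<lambda>_. 1) *v v = 0"
proof -
  let ?h = "\<lambda>t. inverse (of_real t - z)"
  obtain c where c: "\<And>t. t \<ge> \<alpha> \<Longrightarrow> 0 < Re (c * ?h t)"
  proof (cases "Im z = 0")
    case True
    show ?thesis
    proof (rule that[of 1])
      fix t assume "t \<ge> \<alpha>"
      then have "of_real t - z = of_real (t - Re z)" "t - Re z > 0"
        using True z by (auto simp: complex_eq_iff in_slit_plane_iff)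
      then show "0 < Re (1 * ?h t)" by (simp only: of_real_inverse[symmetric] mult_1 Re_complex_of_real) simp
    qed
  next
    case False
    show ?thesis
    proof (rule that[of "- \<i> * of_real (Im z)"])
      fix t
      have "Re (- \<i> * of_real (Im z) * ?h t) = (Im z)\<^sup>2 / ((t - Re z)\<^sup>2 + (Im z)\<^sup>2)"
        by (simp add: power2_eq_square)
      also have "\<dots> > 0" using False by (intro divide_pos_pos add_nonneg_pos) auto
      finally show "0 < Re (- \<i> * of_real (Im z) * ?h t)" .
    qed
  qed
  define k where "k t = Re (c * ?h t)" for t
  have k: "0 < k t" if "t \<ge> \<alpha>" for t using c[OF that] by (simp only: k_def)
  have kq: "Re (c * ?h t * w) = k t * Re w" if "Im w = 0" for t w using that by (simp add: k_def)
  have i: "integrable \<tau> (\<lambda>t. Re (c * ?h t * qform (D t) v))"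
    using integrable_qform[OF integrable_resolvent[OF z], of v] by (simp only: mult.assoc) (intro integrable_Re integrable_mult_right)
  have "(\<integral>t. c * ?h t * qform (D t) v \<partial>\<tau>) = 0"
    using q unfolding qform_I[OF integrable_resolvent[OF z]] by (simp add: mult.assoc)
  moreover have "(\<integral>t. Re (c * ?h t * qform (D t) v) \<partial>\<tau>) = Re (\<integral>t. c * ?h t * qform (D t) v \<partial>\<tau>)"
    using integrable_qform[OF integrable_resolvent[OF z], of v] by (intro integral_Re) (simp only: mult.assoc, rule integrable_mult_right)
  ultimately have "(\<integral>t. Re (c * ?h t * qform (D t) v) \<partial>\<tau>) = 0" by simp
  moreover have "AE t in \<tau>. 0 \<le> Re (c * ?h t * qform (D t) v)"
    using AE_qform_density[of v] AE_space
  proof eventually_elim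
    case (elim t)
    then have "0 \<le> k t * Re (qform (D t) v)" using k[of t] by (intro mult_nonneg_nonneg) auto
    then show ?case using kq elim(1) by (simp only:)
  qed
  ultimately have "AE t in \<tau>. Re (c * ?h t * qform (D t) v) = 0"
    using i by (subst (asm) integral_nonneg_eq_0_iff_AE) auto
  then have 0: "AE t in \<tau>. qform (D t) v = 0"
    using AE_qform_density[of v] AE_space
  proof eventually_elim
    case (elim t)
    have "k t * Re (qform (D t) v) = 0" using kq elim(1,2) by (simp only:)
    then show ?case using elim(2,3) k[of t] by (simp add: complex_eq_iff)
  qed
  have "I (\<lambda>_. 1) *v v = (\<integral>t. (1 *\<^sub>C D t) *v v \<partial>\<tau>)"
    by (rule I_bounded_linear[OF _ matrix_vector_bounded_linear]) simp
  also have "\<dots> = (\<integral>t. 0 \<partial>\<tau>)"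
  proof (rule integral_cong_AE)
    show "AE t in \<tau>. (1 *\<^sub>C D t) *v v = 0"
      using 0 AE_trace_density by eventually_elim (simp add: nonneg_hermitian_qform_0)
    show "(\<lambda>t. (1 *\<^sub>C D t) *v v) \<in> borel_measurable \<tau>"
      by (rule borel_measurable_integrable) (rule integrable_bounded_linear[OF matrix_vector_bounded_linear integrable_cmat_scale_density], simp)
  qed simp
  finally show ?thesis by simp
qed

end


section \<open>The transform for a measure with finite first moment\<close>

locale stieltjes_transform = nh_measure \<alpha> \<sigma>
  for \<alpha> :: real and \<sigma> :: "real set \<Rightarrow> complex ^ 'q ^ 'q::finite" +
  fixes F :: "complex \<Rightarrow> complex ^ 'q ^ 'q"
  assumes F_eq: "z \<in> slit_plane \<alpha> \<Longrightarrow> F z = I (\<lambda>t. inverse (of_real t - z))"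
    and integrable_id: "integrable \<tau> (\<lambda>t. complex_of_real t)"
begin

abbreviation s0 :: "complex ^ 'q ^ 'q" where "s0 \<equiv> I (\<lambda>_. 1)"

definition R :: "complex ^ 'q ^ 'q" where "R = mp_inverse s0"
definition P :: "complex ^ 'q ^ 'q" where "P = s0 ** R"
definition Q :: "complex ^ 'q ^ 'q" where "Q = mat 1 - P"
definition M :: "complex \<Rightarrow> complex ^ 'q ^ 'q" where "M z = (z - of_real \<alpha>) *\<^sub>C F z"
definition N :: "complex \<Rightarrow> complex ^ 'q ^ 'q" where "N z = I (\<lambda>t. of_real (t - \<alpha>) * inverse (of_real t - z))"
definition X :: "complex \<Rightarrow> complex ^ 'q ^ 'q" where "X z = inverse (z - of_real \<alpha>) *\<^sub>C mp_inverse (F z)"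

text \<open>With \<open>\<dagger>\<close> for the Moore--Penrose inverse, \<open>R = s0\<^sup>\<dagger>\<close>, \<open>P\<close> is the orthogonal projection onto the
  range of \<open>s0\<close>, which is the range of \<open>F z\<close> as well, \<open>M z = N z - s0\<close> and \<open>X z = (M z)\<^sup>\<dagger>\<close>. Adding \<open>Q\<close>
  makes \<open>F z\<close> invertible without changing it on that range.\<close>

abbreviation G :: "complex \<Rightarrow> complex ^ 'q ^ 'q" where "G \<equiv> plus_transform \<alpha> s0 F"

lemma nonneg_s0: "nonneg_hermitian s0"
  unfolding nonneg_hermitian_iff
proof
  fix v
  have q: "qform s0 v = (\<integral>t. qform (D t) v \<partial>\<tau>)" using qform_I[of "\<lambda>_. 1" v] by simp
  have i: "integrable \<tau> (\<lambda>t. qform (D t) v)" using integrable_qform[of "\<lambda>_. 1" v] by simp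
  have "(\<integral>t. Im (qform (D t) v) \<partial>\<tau>) = 0"
    by (rule integral_eq_zero_AE) (use AE_qform_density[of v] in \<open>auto elim: eventually_mono\<close>)
  moreover have "0 \<le> (\<integral>t. Re (qform (D t) v) \<partial>\<tau>)"
    by (rule integral_nonneg_AE) (use AE_qform_density[of v] in \<open>auto elim: eventually_mono\<close>)
  ultimately show "Im (qform s0 v) = 0 \<and> 0 \<le> Re (qform s0 v)"
    unfolding q using i by simp
qed

lemma ctransp_s0: "ctransp s0 = s0"
  by (rule nonneg_hermitian_ctransp[OF nonneg_s0])

lemma P_facts: "ctransp P = P" "R ** s0 = P" "P ** P = P" "P ** s0 = s0" "s0 ** P = s0"
    "P ** R = R" "R ** P = R" "ctransp R = R"
proof -
  obtain P' where P': "ctransp P' = P'" "s0 ** mp_inverse s0 = P'" "mp_inverse s0 ** s0 = P'" "P' ** P' = P'"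
    "P' ** s0 = s0" "s0 ** P' = s0" "P' ** mp_inverse s0 = mp_inverse s0" "mp_inverse s0 ** P' = mp_inverse s0"
    "ctransp (mp_inverse s0) = mp_inverse s0"
    by (rule hermitian_mp_inverse[OF ctransp_s0])
  have "P = P'" by (simp add: P_def R_def P')
  then show "ctransp P = P" "R ** s0 = P" "P ** P = P" "P ** s0 = s0" "s0 ** P = s0"
    "P ** R = R" "R ** P = R" "ctransp R = R"
    using P' by (simp_all add: R_def)
qed

lemma s0_Q: "s0 ** Q = 0"
  by (simp add: Q_def cmat_distribs P_facts)

text \<open>The range of \<open>Q\<close> is the kernel of \<open>s0\<close>, on which every
  integral against \<open>\<sigma>\<close> vanishes.\<close>

lemma I_P: "integrable \<tau> f \<Longrightarrow> I f ** P = I f"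
proof -
  assume f: "integrable \<tau> f"
  have "(I f ** Q) *v v = 0" for v
  proof -
    have "s0 *v (Q *v v) = 0" by (simp add: matrix_vector_mul_assoc s0_Q)
    then have "I f *v (Q *v v) = 0" using f by (rule I_null)
    then show ?thesis by (simp add: matrix_vector_mul_assoc)
  qed
  then have "I f ** Q = 0" by (simp add: matrix_eq)
  then show ?thesis by (simp add: Q_def cmat_distribs)
qed

lemma P_I: "integrable \<tau> f \<Longrightarrow> P ** I f = I f"
proof -
  assume f: "integrable \<tau> f"
  have "ctransp (P ** I f) = ctransp (I f)"
    unfolding ctransp_mult P_facts(1) ctransp_I[OF f] using f by (intro I_P) simp
  then show ?thesis by (metis ctransp_ctransp)
qed

context
  fixes z assumes z: "z \<in> slit_plane \<alpha>"
begin

lemma z_neq: "z \<noteq> of_real \<alpha>"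
  using z by (auto simp: in_slit_plane_iff)

lemma F_P: "F z ** P = F z" "P ** F z = F z"
  unfolding F_eq[OF z] using integrable_resolvent[OF z] by (simp_all add: I_P P_I)

text \<open>Multiplying by \<open>P\<close> separates the summands, so \<open>F z *v v\<close> and
  \<open>Q *v v\<close> both vanish; the former puts \<open>v\<close> into the kernel of
  \<open>s0\<close>, that is \<open>P *v v = 0\<close>, and \<open>v\<close> is the sum of its two
  projections.\<close>

lemma FQ_injective: "(F z + Q) *v v = 0 \<Longrightarrow> v = 0"
proof -
  assume v: "(F z + Q) *v v = 0"
  have "P ** (F z + Q) = F z" by (simp add: Q_def cmat_distribs P_facts F_P)
  then have Fv: "F z *v v = 0" using v by (metis matrix_vector_mul_assoc matrix_vector_mult_0_right)
  then have Qv: "Q *v v = 0" using v by (simp add: matrix_vector_mult_add_rdistrib)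
  have "s0 *v v = 0"
    using Fv by (intro resolvent_qform_eq_0[OF z]) (simp add: qform_def flip: F_eq[OF z])
  then have "P *v v = 0" by (simp add: P_facts(2)[symmetric] matrix_vector_mul_assoc[symmetric])
  with Qv show "v = 0" by (simp add: Q_def matrix_vector_mult_diff_rdistrib)
qed

text \<open>\<open>F z + Q\<close> acts as \<open>F z\<close> on the range of \<open>P\<close> and
  as the identity on that of \<open>Q\<close>. Subtracting \<open>Q\<close> from its inverse leaves
  the inverse of \<open>F z\<close> on the range of \<open>P\<close>, extended by 0.\<close>

lemma FQ_inverse:
  obtains B where "(F z + Q) ** B = mat 1" "det (F z + Q) \<noteq> 0" "mp_inverse (F z) = B - Q"
    "F z ** (B - Q) = P" "(B - Q) ** F z = P" "P ** (B - Q) = B - Q" "(B - Q) ** P = B - Q"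
proof -
  obtain B where B: "B ** (F z + Q) = mat 1"
    using FQ_injective matrix_left_invertible_ker[of "F z + Q"] by blast
  then have B': "(F z + Q) ** B = mat 1" using matrix_left_right_inverse by blast
  have QQ: "Q ** Q = Q" and PQ: "P ** Q = 0" and QP: "Q ** P = 0"
    by (simp_all add: Q_def cmat_distribs P_facts)
  have FQ: "F z ** Q = 0" "Q ** F z = 0" by (simp_all add: Q_def cmat_distribs F_P)
  have "B ** ((F z + Q) ** Q) = Q" by (simp add: matrix_mul_assoc B)
  then have BQ: "B ** Q = Q" by (simp add: cmat_distribs FQ QQ)
  have "(Q ** (F z + Q)) ** B = Q" by (simp add: B' flip: matrix_mul_assoc)
  then have QB: "Q ** B = Q" by (simp add: cmat_distribs FQ QQ)
  have FB: "F z ** B = P" and BF: "B ** F z = P"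
    using B B' QB BQ by (simp_all add: cmat_distribs) (simp_all add: Q_def algebra_simps)
  have PB: "P ** B = B - Q" using QB by (simp add: Q_def cmat_distribs algebra_simps)
  have BP: "B ** P = B - Q" using BQ by (simp add: Q_def cmat_distribs algebra_simps)
  have facts: "F z ** (B - Q) = P" "(B - Q) ** F z = P" "P ** (B - Q) = B - Q" "(B - Q) ** P = B - Q"
    by (simp_all add: cmat_distribs FB BF FQ PB BP PQ QP)
  have "mp_inverse (F z) = B - Q"
    by (rule mp_inverse_eqI) (simp add: is_moore_penrose_def facts F_P P_facts)
  moreover have "det (F z + Q) \<noteq> 0"
    using B B' by (simp add: invertible_det_nz[symmetric] invertible_def) blast
  ultimately show ?thesis using that B' facts by blast
qed

lemma mp_F_facts: "F z ** mp_inverse (F z) = P" "mp_inverse (F z) ** F z = P"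
    "P ** mp_inverse (F z) = mp_inverse (F z)" "mp_inverse (F z) ** P = mp_inverse (F z)"
  by (rule FQ_inverse; simp)+

lemma M_X: "M z ** X z = P" "X z ** M z = P" "P ** X z = X z" "X z ** P = X z"
  using z_neq by (simp_all add: M_def X_def cmat_scale_mult_left cmat_scale_mult_right cmat_scale_scale mp_F_facts)

lemma integrable_N: "integrable \<tau> (\<lambda>t. of_real (t - \<alpha>) * inverse (of_real t - z))"
  using integrable_resolvent_mult[OF z, of "\<lambda>t. of_real (t - \<alpha>)"] integrable_id by (simp add: mult.commute)

lemma M_N: "M z = N z - s0"
proof -
  have "N z = I (\<lambda>t. 1 + (z - of_real \<alpha>) * inverse (of_real t - z))"
    unfolding N_def
  proof (rule I_cong)
    fix t assume "t \<ge> \<alpha>"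
    then have "of_real t - z \<noteq> 0" using z by (auto simp: in_slit_plane_iff)
    then show "of_real (t - \<alpha>) * inverse (of_real t - z) = 1 + (z - of_real \<alpha>) * inverse (of_real t - z)"
      by (simp add: field_simps)
  qed
  also have "\<dots> = s0 + I (\<lambda>t. (z - of_real \<alpha>) * inverse (of_real t - z))"
    using integrable_resolvent[OF z] by (intro I_add) auto
  also have "I (\<lambda>t. (z - of_real \<alpha>) * inverse (of_real t - z)) = M z"
    unfolding M_def F_eq[OF z] by (rule I_scale[OF integrable_resolvent[OF z]])
  finally show ?thesis by simp
qed

lemma G_eq: "G z = - s0 - s0 ** X z ** s0"
  by (simp add: plus_transform_def X_def cmat_distribs cmat_scale_mult_left cmat_scale_mult_right matrix_mul_assoc)

lemma G_eq_XN: "G z = - (s0 ** X z ** N z)"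
proof -
  have "s0 ** X z ** N z = s0 ** X z ** (M z + s0)" by (simp add: M_N)
  also have "\<dots> = s0 + s0 ** X z ** s0"
    by (simp add: cmat_distribs matrix_mul_eq_assoc[OF M_X(2)] P_facts)
  finally show ?thesis by (simp add: G_eq)
qed

lemma P_N: "P ** N z = N z" "N z ** P = N z"
  unfolding N_def using integrable_N by (simp_all add: P_I I_P)

lemma G_eq_N: "G z = N z - N z ** X z ** N z"
proof -
  have s: "s0 = N z - M z" by (simp add: M_N)
  have "s0 ** X z ** N z = N z ** X z ** N z - M z ** X z ** N z"
    unfolding s by (simp add: cmat_distribs)
  also have "\<dots> = N z ** X z ** N z - N z" by (simp add: M_X P_N)
  finally show ?thesis by (simp add: G_eq_XN)
qed

text \<open>A fixed-point equation for \<open>X z\<close> that reduces to \<open>- R\<close> when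
  \<open>N z = 0\<close>; as soon as \<open>N z\<close> is small it bounds \<open>X z\<close>,
  although \<open>mp_inverse (F z)\<close> admits no direct estimate.\<close>

lemma X_eq: "X z = X z ** N z ** R - R"
proof -
  have "X z ** N z = P + X z ** s0" by (simp add: M_X(2)[symmetric] M_N cmat_distribs)
  then have "X z ** N z ** R = P ** R + X z ** s0 ** R" by (simp add: cmat_distribs)
  also have "X z ** s0 ** R = X z" by (simp add: matrix_mul_eq_assoc[OF P_def[symmetric]] M_X)
  finally show ?thesis by (simp add: P_facts)
qed

lemma X_bound:
  assumes K: "K > 0" "\<And>(A :: complex ^ 'q ^ 'q) (B :: complex ^ 'q ^ 'q). norm (A ** B) \<le> norm A * norm B * K"
    and small: "2 * (norm (N z) * norm R * K * K) \<le> 1"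
  shows "norm (X z) \<le> 2 * norm R"
proof -
  have "norm (X z ** N z ** R) \<le> norm (X z) * norm (N z) * K * norm R * K"
    using K(1) by (intro order_trans[OF K(2)] mult_right_mono K(2)) auto
  then have "norm (X z) \<le> norm (X z) * norm (N z) * K * norm R * K + norm R"
    using norm_triangle_ineq4[of "X z ** N z ** R" R] by (simp flip: X_eq)
  moreover have "norm (X z) * (2 * (norm (N z) * norm R * K * K)) \<le> norm (X z) * 1"
    by (rule mult_left_mono[OF small]) simp
  ultimately show ?thesis by (simp add: mult_ac)
qed

text \<open>\<open>M z\<close> inverts \<open>X z\<close> on the range of \<open>P\<close>, so the
  form of \<open>X z\<close> is the conjugate of the form of \<open>M z\<close> at another vector.
  The conjugation reverses the sign of the imaginary part, and the minus sign in \<open>G\<close>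
  reverses it back.\<close>

lemma cinner_X:
  assumes "P *v u = u"
  shows "cinner u (X z *v u) = cnj (qform (M z) (X z *v u))"
proof -
  have "M z *v (X z *v u) = u" using assms by (simp add: matrix_vector_mul_assoc M_X)
  then show ?thesis by (simp add: qform_def cnj_cinner)
qed

end

text \<open>\<open>mp_inverse\<close> has no evident analytic dependence on its argument, but by
  Cramer's rule the entries of the inverse of \<open>F z + Q\<close> are quotients of determinants,
  and \<open>Q\<close> disappears between the two factors \<open>s0\<close>.\<close>

lemma G_holomorphic: "(\<lambda>z. G z $ i $ j) holomorphic_on slit_plane \<alpha>"
  if F: "\<And>i j. (\<lambda>z. F z $ i $ j) holomorphic_on slit_plane \<alpha>"
proof -
  define B where "B z = (\<chi> k l. det (\<chi> i j. if j = k then axis l 1 $ i else (F z + Q) $ i $ j) / det (F z + Q))" for z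
  have det: "(\<lambda>z. det (A z)) holomorphic_on slit_plane \<alpha>"
    if "\<And>i j. (\<lambda>z. A z $ i $ j) holomorphic_on slit_plane \<alpha>" for A :: "complex \<Rightarrow> complex ^ 'q ^ 'q"
    unfolding det_def by (intro holomorphic_intros that)
  have FQ: "(\<lambda>z. (F z + Q) $ i $ j) holomorphic_on slit_plane \<alpha>" for i j
    by (simp, intro holomorphic_intros F)
  have dn: "det (F z + Q) \<noteq> 0" if "z \<in> slit_plane \<alpha>" for z using FQ_inverse[OF that] by blast
  have holB: "(\<lambda>z. B z $ k $ l) holomorphic_on slit_plane \<alpha>" for k l
    unfolding B_def vec_lambda_beta
  proof (intro holomorphic_on_divide det FQ dn)
    show "(\<lambda>z. (\<chi> i j. if j = k then axis l 1 $ i else (F z + Q) $ i $ j) $ i $ j) holomorphic_on slit_plane \<alpha>" for i j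
      using FQ[of i j] by (cases "j = k") auto
  qed
  have "G z = - s0 - inverse (z - of_real \<alpha>) *\<^sub>C (s0 ** B z ** s0)" if z: "z \<in> slit_plane \<alpha>" for z
  proof -
    obtain C where C: "(F z + Q) ** C = mat 1" "det (F z + Q) \<noteq> 0" "mp_inverse (F z) = C - Q"
      by (rule FQ_inverse[OF z])
    have "(F z + Q) *v (C *v axis l 1) = axis l 1" for l
      by (simp add: matrix_vector_mul_assoc C)
    then have "C *v axis l 1 = (\<chi> k. det (\<chi> i j. if j = k then axis l 1 $ i else (F z + Q) $ i $ j) / det (F z + Q))" for l
      using cramer[OF C(2)] by blast
    then have "C = B z"
      by (simp add: vec_eq_iff matrix_vector_mult_axis[symmetric] B_def)
    then have "s0 ** mp_inverse (F z) ** s0 = s0 ** B z ** s0"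
      unfolding C(3) by (simp add: cmat_distribs s0_Q)
    then show ?thesis
      by (simp add: G_eq[OF z] X_def cmat_scale_mult_left cmat_scale_mult_right)
  qed
  then have "G z $ i $ j = - (s0 $ i $ j) - inverse (z - of_real \<alpha>) * (\<Sum>k\<in>UNIV. (\<Sum>l\<in>UNIV. s0 $ i $ l * B z $ l $ k) * s0 $ k $ j)"
    if "z \<in> slit_plane \<alpha>" for z using that by (simp add: cmat_scale_def matrix_matrix_mult_def)
  moreover have "(\<lambda>z. - (s0 $ i $ j) - inverse (z - of_real \<alpha>) * (\<Sum>k\<in>UNIV. (\<Sum>l\<in>UNIV. s0 $ i $ l * B z $ l $ k) * s0 $ k $ j)) holomorphic_on slit_plane \<alpha>"
    by (intro holomorphic_intros holB) (auto simp: z_neq)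
  ultimately show ?thesis using holomorphic_cong[OF refl] by (metis (no_types, lifting))
qed

lemma qform_congruence: "qform (ctransp B ** A ** B) v = qform A (B *v v)"
  by (simp add: qform_def matrix_vector_mul_assoc[symmetric] cinner_ctransp[of v "ctransp B"])

lemma Im_qform_M:
  assumes "Im z > 0"
  shows "0 \<le> Im (qform (M z) v)"
proof -
  have z: "z \<in> slit_plane \<alpha>" using assms by (simp add: in_slit_plane_iff)
  have "0 \<le> (\<integral>t. Im (of_real (t - \<alpha>) * inverse (of_real t - z) * qform (D t) v) \<partial>\<tau>)"
  proof (rule integral_nonneg_AE)
    show "AE t in \<tau>. 0 \<le> Im (of_real (t - \<alpha>) * inverse (of_real t - z) * qform (D t) v)"
      using AE_qform_density[of v] AE_space
    proof eventually_elim
      case (elim t)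
      have "Im (of_real (t - \<alpha>) * inverse (of_real t - z)) = (t - \<alpha>) * (Im z / ((t - Re z)\<^sup>2 + (Im z)\<^sup>2))" by simp
      also have "\<dots> \<ge> 0" using elim assms by (intro mult_nonneg_nonneg divide_nonneg_nonneg) auto
      finally have "0 \<le> Im (of_real (t - \<alpha>) * inverse (of_real t - z))" .
      moreover have "Im (k * w) = Im k * Re w" if "Im w = 0" for k w using that by simp
      ultimately show ?case using elim(1) by (simp only: mult_nonneg_nonneg)
    qed
  qed
  also have "\<dots> = Im (qform (N z) v)"
    unfolding N_def qform_I[OF integrable_N[OF z]] using integrable_qform[OF integrable_N[OF z], of v] by (rule integral_Im)
  finally show ?thesis using nonneg_s0 by (simp add: M_N[OF z] qform_diff nonneg_hermitian_iff)
qed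

lemma Im_qform_G:
  assumes "Im z > 0"
  shows "0 \<le> Im (qform (G z) v)"
proof -
  have z: "z \<in> slit_plane \<alpha>" using assms by (simp add: in_slit_plane_iff)
  have "qform (s0 ** X z ** s0) v = cinner (s0 *v v) (X z *v (s0 *v v))"
    by (simp add: qform_def matrix_vector_mul_assoc[symmetric] cinner_ctransp[of v s0] ctransp_s0)
  also have "\<dots> = cnj (qform (M z) (X z *v (s0 *v v)))"
    by (rule cinner_X[OF z]) (simp add: matrix_vector_mul_assoc P_facts)
  finally show ?thesis
    using nonneg_s0 Im_qform_M[OF assms, of "X z *v (s0 *v v)"]
    by (simp add: G_eq[OF z] qform_diff qform_minus nonneg_hermitian_iff)
qed

lemma qform_I_real:
  assumes f: "integrable \<tau> (\<lambda>t. complex_of_real (f t))" and "\<And>t. t \<ge> \<alpha> \<Longrightarrow> 0 \<le> f t"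
  shows "nonneg_hermitian (I (\<lambda>t. complex_of_real (f t)))"
  unfolding nonneg_hermitian_iff
proof
  fix v
  have i: "integrable \<tau> (\<lambda>t. complex_of_real (f t) * qform (D t) v)" by (rule integrable_qform[OF f])
  have "(\<integral>t. Im (complex_of_real (f t) * qform (D t) v) \<partial>\<tau>) = 0"
    by (rule integral_eq_zero_AE) (use AE_qform_density[of v] in \<open>auto elim: eventually_mono\<close>)
  moreover have "0 \<le> (\<integral>t. Re (complex_of_real (f t) * qform (D t) v) \<partial>\<tau>)"
  proof (rule integral_nonneg_AE)
    show "AE t in \<tau>. 0 \<le> Re (complex_of_real (f t) * qform (D t) v)"
      using AE_qform_density[of v] AE_space by eventually_elim (use assms(2) in simp)
  qed
  ultimately show "Im (qform (I (\<lambda>t. complex_of_real (f t))) v) = 0 \<and> 0 \<le> Re (qform (I (\<lambda>t. complex_of_real (f t))) v)"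
    unfolding qform_I[OF f] using integral_Im[OF i] integral_Re[OF i] by simp
qed

text \<open>Below \<open>\<alpha>\<close> the matrix \<open>N\<close> is non-negative while
  \<open>M\<close>, a negative multiple of \<open>F\<close>, is non-positive. So the subtracted term
  in \<open>G = N - N X N\<close> is non-positive; the form \<open>- s0 - s0 X s0\<close> would not
  reveal the sign.\<close>

lemma qform_G_real:
  assumes x: "x < \<alpha>"
  shows "nonneg_hermitian (G (of_real x))"
proof -
  let ?z = "complex_of_real x"
  have z: "?z \<in> slit_plane \<alpha>" using x by (simp add: in_slit_plane_iff)
  have e: "(\<lambda>t. of_real (t - \<alpha>) * inverse (of_real t - ?z)) = (\<lambda>t. complex_of_real ((t - \<alpha>) * inverse (t - x)))" by auto
  have N: "nonneg_hermitian (N ?z)"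
    unfolding N_def e
  proof (rule qform_I_real)
    show "integrable \<tau> (\<lambda>t. complex_of_real ((t - \<alpha>) * inverse (t - x)))"
      using integrable_N[OF z] unfolding e .
    show "0 \<le> (t - \<alpha>) * inverse (t - x)" if "\<alpha> \<le> t" for t using that x by auto
  qed
  have e': "(\<lambda>t. inverse (of_real t - ?z)) = (\<lambda>t. complex_of_real (inverse (t - x)))" by auto
  have Fn: "nonneg_hermitian (F ?z)"
    unfolding F_eq[OF z] e'
  proof (rule qform_I_real)
    show "integrable \<tau> (\<lambda>t. complex_of_real (inverse (t - x)))"
      using integrable_resolvent[OF z] unfolding e' .
    show "0 \<le> inverse (t - x)" if "\<alpha> \<le> t" for t using that x by auto
  qed
  have Mq: "qform (M ?z) v = of_real (x - \<alpha>) * qform (F ?z) v" for v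
    by (simp add: M_def qform_cmat_scale)
  have "qform (G ?z) v = qform (N ?z) v - cnj (qform (M ?z) (X ?z *v (N ?z *v v)))" for v
  proof -
    have "qform (N ?z ** X ?z ** N ?z) v = cinner (N ?z *v v) (X ?z *v (N ?z *v v))"
      by (simp add: qform_def matrix_vector_mul_assoc[symmetric] cinner_ctransp[of v "N ?z"] nonneg_hermitian_ctransp[OF N])
    also have "\<dots> = cnj (qform (M ?z) (X ?z *v (N ?z *v v)))"
      by (rule cinner_X[OF z]) (simp add: matrix_vector_mul_assoc P_N[OF z])
    finally show ?thesis by (simp add: G_eq_N[OF z] qform_diff)
  qed
  moreover have "(x - \<alpha>) * Re (qform (F ?z) v) \<le> 0" for v
    using Fn x by (intro mult_nonpos_nonneg) (auto simp: nonneg_hermitian_iff)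
  moreover have "0 \<le> Re (qform (N ?z) v)" for v using N by (simp add: nonneg_hermitian_iff)
  ultimately show ?thesis
    using N Fn x unfolding nonneg_hermitian_iff Mq by (auto intro: order_trans)
qed

lemma G_S_class: "F \<in> S_class \<alpha> \<Longrightarrow> G \<in> S_class \<alpha>"
  using G_holomorphic Im_qform_G qform_G_real by (auto simp: S_class_iff nonneg_hermitian_iff)

end


section \<open>Growth of the transform along the imaginary axis\<close>

lemma operator_norm_le:
  obtains K where "K > 0" "\<And>A :: complex ^ 'q ^ 'q::finite. operator_norm A \<le> K * norm A"
proof -
  have "bounded_bilinear ((*v) :: complex ^ 'q ^ 'q \<Rightarrow> complex ^ 'q \<Rightarrow> _)"
    unfolding bilinear_conv_bounded_bilinear[symmetric] bilinear_def
    by (auto intro!: linearI simp: matrix_vector_mult_def vec_eq_iff algebra_simps sum.distrib scaleR_sum_right)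
  then obtain K where K: "K > 0" "\<And>(A :: complex ^ 'q ^ 'q) v. norm (A *v v) \<le> norm A * norm v * K"
    using bounded_bilinear.pos_bounded by blast
  show ?thesis
  proof (rule that[OF K(1)])
    fix A :: "complex ^ 'q ^ 'q"
    show "operator_norm A \<le> K * norm A"
      unfolding operator_norm_def by (rule onorm_bound) (use K in \<open>auto simp: mult_ac\<close>)
  qed
qed

context stieltjes_transform begin

text \<open>In \<open>G = - s0 X N\<close> the factor \<open>N\<close> is of order
  \<open>1 / y\<close> by the finite first moment, and \<open>X\<close> is bounded once
  \<open>N\<close> is small. The remaining bounded range of \<open>y\<close> is handled by
  compactness.\<close>

lemma G_S0_class:
  assumes F: "F \<in> S_class \<alpha>"
  shows "G \<in> S0_class \<alpha>"
proof -
  have G: "G \<in> S_class \<alpha>" by (rule G_S_class[OF F])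
  obtain K where K: "K > 0" "\<And>(A :: complex ^ 'q ^ 'q) (B :: complex ^ 'q ^ 'q). norm (A ** B) \<le> norm A * norm B * K"
    using cmat_mult.pos_bounded by blast
  obtain K' where K': "K' > 0" "\<And>A :: complex ^ 'q ^ 'q. operator_norm A \<le> K' * norm A"
    using operator_norm_le by blast
  define c where "c = real (CARD('q) * CARD('q)) * (\<integral>t. norm (complex_of_real (t - \<alpha>)) \<partial>\<tau>)"
  have slit: "\<i> * of_real y \<in> slit_plane \<alpha>" if "y \<ge> 1" for y using that by (simp add: in_slit_plane_iff)
  have int_a: "integrable \<tau> (\<lambda>t. complex_of_real (t - \<alpha>))"
    unfolding of_real_diff using integrable_id by (rule Bochner_Integration.integrable_diff) simp
  have N: "y * norm (N (\<i> * of_real y)) \<le> c" if y: "y \<ge> 1" for y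
  proof -
    have i: "integrable \<tau> (\<lambda>t. norm (complex_of_real (t - \<alpha>) * inverse (of_real t - \<i> * of_real y)))"
      using integrable_N[OF slit[OF y]] by (rule integrable_norm)
    have "(\<integral>t. norm (complex_of_real (t - \<alpha>) * inverse (of_real t - \<i> * of_real y)) \<partial>\<tau>) \<le> (\<integral>t. norm (complex_of_real (t - \<alpha>)) * inverse y \<partial>\<tau>)"
    proof (rule integral_mono[OF i])
      show "integrable \<tau> (\<lambda>t. norm (complex_of_real (t - \<alpha>)) * inverse y)"
        using integrable_norm[OF int_a] by simp
      fix t
      have "y \<le> norm (of_real t - \<i> * of_real y)"
        using abs_Im_le_cmod[of "of_real t - \<i> * of_real y"] y by simp
      then have "inverse (norm (of_real t - \<i> * of_real y)) \<le> inverse y"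
        using y by (intro le_imp_inverse_le) auto
      then show "norm (complex_of_real (t - \<alpha>) * inverse (of_real t - \<i> * of_real y)) \<le> norm (complex_of_real (t - \<alpha>)) * inverse y"
        unfolding norm_mult norm_inverse by (rule mult_left_mono) simp
    qed
    then have "norm (N (\<i> * of_real y)) \<le> real (CARD('q) * CARD('q)) * ((\<integral>t. norm (complex_of_real (t - \<alpha>)) \<partial>\<tau>) * inverse y)"
      unfolding N_def by (intro order_trans[OF norm_I_le[OF integrable_N[OF slit[OF y]]]] mult_left_mono) auto
    then have "y * norm (N (\<i> * of_real y)) \<le> y * (real (CARD('q) * CARD('q)) * ((\<integral>t. norm (complex_of_real (t - \<alpha>)) \<partial>\<tau>) * inverse y))"
      using y by (intro mult_left_mono) auto
    also have "\<dots> = c" using y by (simp add: c_def)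
    finally show ?thesis .
  qed
  have c0: "c \<ge> 0" unfolding c_def by (intro mult_nonneg_nonneg integral_nonneg) auto
  \<comment> \<open>From this height on, the bound \<open>c / y\<close> for \<open>N\<close> meets
    the smallness condition of \<open>X_bound\<close>; the maximum with 1 keeps \<open>y\<close>
    where that bound is available.\<close>
  define Y where "Y = max 1 (2 * (c * norm R * K * K))"
  have large: "y * norm (G (\<i> * of_real y)) \<le> norm s0 * (2 * norm R) * K * c * K" if y: "y \<ge> Y" for y
  proof -
    let ?z = "\<i> * complex_of_real y"
    have y1: "y \<ge> 1" using y by (simp add: Y_def)
    have "y * (2 * (norm (N ?z) * norm R * K * K)) = 2 * ((y * norm (N ?z)) * norm R * K * K)" by simp
    also have "\<dots> \<le> 2 * (c * norm R * K * K)"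
      using K(1) N[OF y1] by (intro mult_left_mono mult_right_mono) auto
    also have "\<dots> \<le> y * 1" using y by (simp add: Y_def)
    finally have "2 * (norm (N ?z) * norm R * K * K) \<le> 1"
      by (rule mult_left_le_imp_le) (use y1 in simp)
    then have X: "norm (X ?z) \<le> 2 * norm R" by (intro X_bound[OF slit[OF y1] K]) auto
    have "norm (G ?z) \<le> norm (s0 ** X ?z) * norm (N ?z) * K"
      unfolding G_eq_XN[OF slit[OF y1]] norm_minus_cancel by (rule K)
    then have "y * norm (G ?z) \<le> y * (norm (s0 ** X ?z) * norm (N ?z) * K)"
      using y1 by (intro mult_left_mono) auto
    also have "\<dots> = norm (s0 ** X ?z) * (y * norm (N ?z)) * K" by simp
    also have "\<dots> \<le> (norm s0 * (2 * norm R) * K) * c * K"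
    proof (intro mult_right_mono mult_mono)
      show "norm (s0 ** X ?z) \<le> norm s0 * (2 * norm R) * K"
        using K(1) X by (intro order_trans[OF K(2)] mult_right_mono mult_left_mono) auto
    qed (use K N[OF y1] y1 in auto)
    finally show ?thesis .
  qed
  have "continuous_on {1..Y} (\<lambda>y. G (\<i> * of_real y) $ i $ j)" for i j
    using G slit
    by (intro continuous_on_compose2[OF holomorphic_on_imp_continuous_on[of "\<lambda>z. G z $ i $ j" "slit_plane \<alpha>"]] continuous_intros)
      (auto simp: S_class_iff)
  then have "continuous_on {1..Y} (\<lambda>y. \<Sum>i\<in>UNIV. \<Sum>j\<in>UNIV. norm (G (\<i> * of_real y) $ i $ j))"
    by (intro continuous_on_sum continuous_on_norm) auto
  then have "compact ((\<lambda>y. \<Sum>i\<in>UNIV. \<Sum>j\<in>UNIV. norm (G (\<i> * of_real y) $ i $ j)) ` {1..Y})"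
    by (rule compact_continuous_image) simp
  then obtain b where b: "\<And>y. y \<in> {1..Y} \<Longrightarrow> (\<Sum>i\<in>UNIV. \<Sum>j\<in>UNIV. norm (G (\<i> * of_real y) $ i $ j)) \<le> b"
  proof -
    assume "compact ((\<lambda>y. \<Sum>i\<in>UNIV. \<Sum>j\<in>UNIV. norm (G (\<i> * of_real y) $ i $ j)) ` {1..Y})"
      and *: "\<And>b. (\<And>y. y \<in> {1..Y} \<Longrightarrow> (\<Sum>i\<in>UNIV. \<Sum>j\<in>UNIV. norm (G (\<i> * of_real y) $ i $ j)) \<le> b) \<Longrightarrow> thesis"
    then obtain b where "\<forall>x\<in>(\<lambda>y. \<Sum>i\<in>UNIV. \<Sum>j\<in>UNIV. norm (G (\<i> * of_real y) $ i $ j)) ` {1..Y}. norm x \<le> b"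
      using compact_imp_bounded bounded_iff by metis
    then show thesis by (intro *[of b]) (metis (no_types, lifting) abs_le_D1 imageI real_norm_def)
  qed
  have "y * operator_norm (G (\<i> * of_real y)) \<le> K' * max (norm s0 * (2 * norm R) * K * c * K) (Y * b)" if y: "y \<ge> 1" for y
  proof -
    have "y * norm (G (\<i> * of_real y)) \<le> max (norm s0 * (2 * norm R) * K * c * K) (Y * b)"
    proof (cases "y \<ge> Y")
      case False
      then have "norm (G (\<i> * of_real y)) \<le> b" using y b[of y] by (intro order_trans[OF norm_cmat_le]) auto
      then have "y * norm (G (\<i> * of_real y)) \<le> Y * b"
        using y False by (intro mult_mono) auto
      then show ?thesis by simp
    qed (use large in \<open>auto simp: le_max_iff_disj\<close>)
    then have "K' * (y * norm (G (\<i> * of_real y))) \<le> K' * max (norm s0 * (2 * norm R) * K * c * K) (Y * b)"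
      using K'(1) by (intro mult_left_mono) auto
    moreover have "y * operator_norm (G (\<i> * of_real y)) \<le> y * (K' * norm (G (\<i> * of_real y)))"
      using y by (intro mult_left_mono K') auto
    ultimately show ?thesis by (simp add: mult_ac)
  qed
  then show ?thesis using G by (auto simp: S0_class_def bdd_above_def)
qed

end

section \<open>Asymptotic expansions along the negative real axis\<close>

text \<open>Along \<open>z = -y\<close> the kernel \<open>y / (t + y)\<close> is positive for \<open>t \<ge> \<alpha>\<close> and bounded by 2 as soon as
  \<open>y \<ge> 2 \<bar>\<alpha>\<bar>\<close>, so that dominated convergence and Fatou's lemma apply without contour arguments.\<close>

locale negative_sequence =
  fixes \<alpha> :: real and y :: "nat \<Rightarrow> real"
  assumes y_ge: "y n \<ge> 1" "y n \<ge> 2 * \<bar>\<alpha>\<bar>" and y_lim: "filterlim y at_top sequentially"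
begin

definition z :: "nat \<Rightarrow> complex" where "z n = - of_real (y n)"

lemma z_slit: "z n \<in> slit_plane \<alpha>"
  using y_ge[of n] by (auto simp: z_def in_slit_plane_iff)

lemma z_neq_0: "z n \<noteq> 0" and z_neq_\<alpha>: "z n \<noteq> of_real \<alpha>"
  using y_ge[of n] z_slit[of n] by (auto simp: z_def in_slit_plane_iff complex_eq_iff)

lemma denom_pos: "t \<ge> \<alpha> \<Longrightarrow> t + y n > 0"
  using y_ge[of n] by linarith

lemma resolvent_z: "inverse (of_real t - z n) = of_real (inverse (t + y n))"
  by (simp add: z_def)

lemma kernel_bounds:
  assumes "t \<ge> \<alpha>"
  shows "\<bar>t * inverse (t + y n)\<bar> \<le> 1" "0 \<le> y n * inverse (t + y n)" "y n * inverse (t + y n) \<le> 2"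
proof -
  have 0: "t + y n > 0" using denom_pos[OF assms] .
  have "\<bar>t\<bar> \<le> t + y n" using assms y_ge[of n] by linarith
  then show "\<bar>t * inverse (t + y n)\<bar> \<le> 1" using 0 by (simp add: abs_mult divide_simps)
  have "y n \<le> 2 * (t + y n)" using assms y_ge(2)[of n] abs_ge_minus_self[of \<alpha>] by argo
  then show "y n * inverse (t + y n) \<le> 2" using 0 by (simp add: divide_simps)
  show "0 \<le> y n * inverse (t + y n)" using 0 y_ge(1)[of n] by simp
qed

lemma inverse_y_lim: "(\<lambda>n. inverse (y n)) \<longlonglongrightarrow> 0"
  using y_lim by (rule tendsto_inverse_0_at_top)

lemma inverse_z_lim: "(\<lambda>n. inverse (z n)) \<longlonglongrightarrow> 0"
proof -
  have "(\<lambda>n. - complex_of_real (inverse (y n))) \<longlonglongrightarrow> - of_real 0" by (intro tendsto_intros inverse_y_lim)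
  then show ?thesis by (simp add: z_def)
qed

lemma kernel_lim:
  shows "(\<lambda>n. inverse (t + y n)) \<longlonglongrightarrow> 0" "(\<lambda>n. y n * inverse (t + y n)) \<longlonglongrightarrow> 1"
proof -
  have "filterlim (\<lambda>n. t + y n) at_top sequentially"
    by (rule filterlim_tendsto_add_at_top[OF tendsto_const y_lim])
  then show l: "(\<lambda>n. inverse (t + y n)) \<longlonglongrightarrow> 0" by (rule tendsto_inverse_0_at_top)
  have "(\<lambda>n. 1 - t * inverse (t + y n)) \<longlonglongrightarrow> 1 - t * 0" by (intro tendsto_intros l)
  moreover have "eventually (\<lambda>n. 1 - t * inverse (t + y n) = y n * inverse (t + y n)) sequentially"
  proof -
    have "eventually (\<lambda>n. y n > \<bar>t\<bar>) sequentially" using y_lim by (simp add: filterlim_at_top_dense)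
    then show ?thesis by eventually_elim (auto simp: field_simps)
  qed
  ultimately show "(\<lambda>n. y n * inverse (t + y n)) \<longlonglongrightarrow> 1" using Lim_transform_eventually by fastforce
qed

end

lemma negative_sequence_ex: obtains y where "negative_sequence \<alpha> y"
proof (rule that)
  show "negative_sequence \<alpha> (\<lambda>n. real (Suc n) + 2 * \<bar>\<alpha>\<bar>)"
  proof
    show "filterlim (\<lambda>n. real (Suc n) + 2 * \<bar>\<alpha>\<bar>) at_top sequentially" by real_asymp
  qed auto
qed

text \<open>The finite geometric expansion at infinity with its exact remainder; each step uses
  \<open>z / (t - z) + 1 = t / (t - z)\<close>.\<close>

lemma resolvent_expansion:
  fixes z :: complex and t :: real
  assumes "z \<noteq> 0" "of_real t \<noteq> z"
  shows "z ^ n * (inverse (of_real t - z) + (\<Sum>j<n. inverse z ^ (j + 1) * of_real t ^ j)) = of_real t ^ n * inverse (of_real t - z)"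
proof (induction n)
  case (Suc n)
  let ?h = "inverse (of_real t - z)" and ?S = "\<lambda>n. \<Sum>j<n. inverse z ^ (j + 1) * of_real t ^ j"
  have "z ^ Suc n * (?h + ?S (Suc n)) = z * (z ^ n * (?h + ?S n)) + (z * inverse z) ^ (Suc n) * of_real t ^ n"
    by (simp add: algebra_simps power_mult_distrib)
  also have "\<dots> = (z * ?h + 1) * of_real t ^ n" using Suc assms(1) by (simp add: algebra_simps)
  also have "z * ?h + 1 = of_real t * ?h" using assms(2) by (simp add: field_simps)
  finally show ?case by simp
qed simp


context nh_measure begin

lemma integrable_power_mono:
  assumes "integrable \<tau> (\<lambda>t. complex_of_real t ^ n)" "k \<le> n"
  shows "integrable \<tau> (\<lambda>t. complex_of_real t ^ k)"
proof (rule Bochner_Integration.integrable_bound)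
  show "integrable \<tau> (\<lambda>t. 1 + norm (complex_of_real t ^ n))" using assms(1) by simp
  show "(\<lambda>t. complex_of_real t ^ k) \<in> borel_measurable \<tau>" by (rule measurable_trace_measure) measurable
  show "AE t in \<tau>. norm (complex_of_real t ^ k) \<le> norm (1 + norm (complex_of_real t ^ n))"
  proof (rule AE_I2)
    fix t :: real
    have "\<bar>t\<bar> ^ k \<le> 1 + \<bar>t\<bar> ^ n"
    proof (cases "\<bar>t\<bar> \<le> 1")
      case True
      then have "\<bar>t\<bar> ^ k \<le> 1" by (simp add: power_le_one)
      then show ?thesis by (simp add: add_increasing2)
    next
      case False
      then have "\<bar>t\<bar> ^ k \<le> \<bar>t\<bar> ^ n" using assms(2) by (intro power_increasing) auto
      then show ?thesis by simp
    qed
    then show "norm (complex_of_real t ^ k) \<le> norm (1 + norm (complex_of_real t ^ n))" by (simp add: norm_power)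
  qed
qed

end

locale asymptotics = nh_measure \<alpha> \<sigma> + negative_sequence \<alpha> y
  for \<alpha> :: real and \<sigma> :: "real set \<Rightarrow> complex ^ 'q ^ 'q::finite" and y
begin

definition H :: "nat \<Rightarrow> complex ^ 'q ^ 'q" where "H n = I (\<lambda>t. inverse (of_real t - z n))"

definition mom :: "nat \<Rightarrow> complex ^ 'q ^ 'q" where "mom j = I (\<lambda>t. complex_of_real t ^ j)"

text \<open>Only moments below \<open>k\<close> enter, so the identity is available in the inductive
  recovery of moments, where the one of index \<open>k\<close> is still unknown.\<close>

lemma remainder_eq:
  assumes int: "\<And>j. j < k \<Longrightarrow> integrable \<tau> (\<lambda>t. complex_of_real t ^ j)"
  shows "z n ^ k *\<^sub>C (H n + (\<Sum>j<k. inverse (z n) ^ (j + 1) *\<^sub>C mom j)) = I (\<lambda>t. of_real t ^ k * inverse (of_real t - z n))"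
proof -
  let ?h = "\<lambda>t. inverse (complex_of_real t - z n)"
  have ih: "integrable \<tau> ?h" by (rule integrable_resolvent[OF z_slit])
  have "H n + (\<Sum>j<k. inverse (z n) ^ (j + 1) *\<^sub>C mom j) = I (\<lambda>t. ?h t + (\<Sum>j<k. inverse (z n) ^ (j + 1) * of_real t ^ j))"
  proof -
    have "(\<Sum>j<k. inverse (z n) ^ (j + 1) *\<^sub>C mom j) = (\<Sum>j<k. I (\<lambda>t. inverse (z n) ^ (j + 1) * of_real t ^ j))"
      unfolding mom_def by (intro sum.cong refl I_scale[symmetric] int) simp
    also have "\<dots> = I (\<lambda>t. \<Sum>j<k. inverse (z n) ^ (j + 1) * of_real t ^ j)"
      by (rule I_sum[symmetric]) (intro integrable_mult_right int, simp)
    finally show ?thesis unfolding H_def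
      by (simp only:) (intro I_add[symmetric] ih Bochner_Integration.integrable_sum integrable_mult_right int, simp)
  qed
  then have "z n ^ k *\<^sub>C (H n + (\<Sum>j<k. inverse (z n) ^ (j + 1) *\<^sub>C mom j)) = I (\<lambda>t. z n ^ k * (?h t + (\<Sum>j<k. inverse (z n) ^ (j + 1) * of_real t ^ j)))"
    by (simp only:) (intro I_scale[symmetric] Bochner_Integration.integrable_add ih Bochner_Integration.integrable_sum integrable_mult_right int, simp)
  also have "\<dots> = I (\<lambda>t. of_real t ^ k * ?h t)"
  proof (rule I_cong)
    fix t assume "t \<ge> \<alpha>"
    then have "of_real t \<noteq> z n" using denom_pos[of t n] by (auto simp: z_def complex_eq_iff)
    then show "z n ^ k * (?h t + (\<Sum>j<k. inverse (z n) ^ (j + 1) * of_real t ^ j)) = of_real t ^ k * ?h t"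
      by (rule resolvent_expansion[OF z_neq_0])
  qed
  finally show ?thesis .
qed

lemma measurable_power_resolvent: "(\<lambda>t. complex_of_real t ^ k * inverse (of_real t - z n)) \<in> borel_measurable \<tau>"
  by (rule measurable_trace_measure) measurable

text \<open>The remainder carries one factor \<open>t\<close> more than the moment of order
  \<open>m\<close> can dominate; the kernel absorbs it, since \<open>t / (t + y)\<close> is bounded
  by 1 and tends to 0.\<close>

lemma expansion_lim:
  assumes int: "integrable \<tau> (\<lambda>t. complex_of_real t ^ m)"
  shows "(\<lambda>n. z n ^ (m + 1) *\<^sub>C (H n + (\<Sum>j\<le>m. inverse (z n) ^ (j + 1) *\<^sub>C mom j))) \<longlonglongrightarrow> 0"
proof -
  have "(\<lambda>n. I (\<lambda>t. of_real t ^ (m + 1) * inverse (of_real t - z n))) \<longlonglongrightarrow> I (\<lambda>_. 0)"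
  proof (rule I_dominated_convergence)
    show "(\<lambda>t. complex_of_real t ^ (m + 1) * inverse (of_real t - z n)) \<in> borel_measurable \<tau>" for n
      by (rule measurable_power_resolvent)
    show "integrable \<tau> (\<lambda>t. norm (complex_of_real t ^ m))" using int by simp
    fix t :: real assume t: "t \<ge> \<alpha>"
    have "norm (complex_of_real t ^ (m + 1) * inverse (of_real t - z n)) = \<bar>t\<bar> ^ m * \<bar>t * inverse (t + y n)\<bar>" for n
      unfolding resolvent_z norm_mult norm_power norm_of_real by (simp add: abs_mult mult_ac)
    also have "\<dots> n \<le> \<bar>t\<bar> ^ m * 1" for n by (intro mult_left_mono kernel_bounds t) simp
    finally show "norm (complex_of_real t ^ (m + 1) * inverse (of_real t - z n)) \<le> norm (complex_of_real t ^ m)" for n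
      by (simp add: norm_power)
    have "(\<lambda>n. complex_of_real t ^ (m + 1) * of_real (inverse (t + y n))) \<longlonglongrightarrow> complex_of_real t ^ (m + 1) * of_real 0"
      by (intro tendsto_intros kernel_lim)
    then show "(\<lambda>n. complex_of_real t ^ (m + 1) * inverse (of_real t - z n)) \<longlonglongrightarrow> 0"
      unfolding resolvent_z by simp
  qed auto
  moreover have "z n ^ (m + 1) *\<^sub>C (H n + (\<Sum>j\<le>m. inverse (z n) ^ (j + 1) *\<^sub>C mom j)) = I (\<lambda>t. of_real t ^ (m + 1) * inverse (of_real t - z n))" for n
    unfolding lessThan_Suc_atMost[symmetric] using remainder_eq[of "Suc m" n] integrable_power_mono[OF int] by simp
  moreover have "I (\<lambda>_. 0) = 0" unfolding matrix_integral_def cmat_scale.zero_left by simp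
  ultimately show ?thesis by simp
qed

text \<open>Conversely, an expansion of \<open>H\<close> forces the moments to exist: the trace turns the next
  coefficient into a bound for scalar integrals, to which Fatou's lemma applies.\<close>

lemma moments_from_expansion:
  assumes lim: "(\<lambda>n. z n ^ m *\<^sub>C (H n + (\<Sum>j<m. inverse (z n) ^ (j + 1) *\<^sub>C c j))) \<longlonglongrightarrow> 0"
    and j: "j < m"
  shows "integrable \<tau> (\<lambda>t. complex_of_real t ^ j) \<and> mom j = c j"
  using j
proof (induction j rule: less_induct)
  case (less k)
  have int: "integrable \<tau> (\<lambda>t. complex_of_real t ^ i)" and mom: "mom i = c i" if "i < k" for i
    using less that by auto
  \<comment> \<open>Cuts the expansion of order \<open>m\<close> down: after division by
    \<open>z ^ (m - (k + 1))\<close> the remainder and the terms beyond \<open>k\<close> tend to 0,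
    which leaves \<open>- c k\<close>.\<close>
  have lim_k: "(\<lambda>n. z n ^ (k + 1) *\<^sub>C (H n + (\<Sum>i<k. inverse (z n) ^ (i + 1) *\<^sub>C c i))) \<longlonglongrightarrow> - c k"
  proof -
    let ?E = "\<lambda>n. z n ^ m *\<^sub>C (H n + (\<Sum>j<m. inverse (z n) ^ (j + 1) *\<^sub>C c j))"
    have e: "z n ^ (k + 1) *\<^sub>C (H n + (\<Sum>i<k. inverse (z n) ^ (i + 1) *\<^sub>C c i)) =
      inverse (z n) ^ (m - (k + 1)) *\<^sub>C ?E n - c k - (\<Sum>i\<in>{k<..<m}. inverse (z n) ^ (i - k) *\<^sub>C c i)" for n
    proof -
      have zz: "inverse (z n) ^ (m - (k + 1)) * z n ^ m = z n ^ (k + 1)"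
        using less.prems z_neq_0[of n] power_add[of "z n" "m - (k + 1)" "k + 1"]
        by (simp add: power_inverse field_simps)
      have split: "sum f ({..<k} \<union> ({k} \<union> {k<..<m})) = sum f {..<k} + (f k + sum f {k<..<m})" for f :: "nat \<Rightarrow> complex ^ 'q ^ 'q"
      proof -
        have "sum f ({..<k} \<union> ({k} \<union> {k<..<m})) = sum f {..<k} + sum f ({k} \<union> {k<..<m})"
          by (rule sum.union_disjoint) auto
        also have "sum f ({k} \<union> {k<..<m}) = sum f {k} + sum f {k<..<m}"
          by (rule sum.union_disjoint) auto
        finally show ?thesis by simp
      qed
      have "{..<m} = {..<k} \<union> ({k} \<union> {k<..<m})" using less.prems by auto
      then have "(\<Sum>j<m. inverse (z n) ^ (j + 1) *\<^sub>C c j) = (\<Sum>i<k. inverse (z n) ^ (i + 1) *\<^sub>C c i) +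
          (inverse (z n) ^ (k + 1) *\<^sub>C c k + (\<Sum>i\<in>{k<..<m}. inverse (z n) ^ (i + 1) *\<^sub>C c i))"
        by (simp only: split)
      then have h1: "inverse (z n) ^ (m - (k + 1)) *\<^sub>C ?E n = z n ^ (k + 1) *\<^sub>C (H n + (\<Sum>i<k. inverse (z n) ^ (i + 1) *\<^sub>C c i)) +
          ((z n ^ (k + 1) * inverse (z n) ^ (k + 1)) *\<^sub>C c k + (\<Sum>i\<in>{k<..<m}. (z n ^ (k + 1) * inverse (z n) ^ (i + 1)) *\<^sub>C c i))"
        by (simp only: cmat_scale_scale zz) (simp only: cmat_scale.add_right cmat_scale.sum_right cmat_scale_scale add.assoc)
      have h2: "z n ^ (k + 1) * inverse (z n) ^ (k + 1) = 1"
        unfolding power_mult_distrib[symmetric] using z_neq_0[of n] by simp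
      have "z n ^ (k + 1) * inverse (z n) ^ (i + 1) = inverse (z n) ^ (i - k)" if "i \<in> {k<..<m}" for i
        using z_neq_0[of n] that power_add[of "z n" "i - k" "k + 1"] by (simp add: power_inverse field_simps)
      then have h3: "(\<Sum>i\<in>{k<..<m}. (z n ^ (k + 1) * inverse (z n) ^ (i + 1)) *\<^sub>C c i) = (\<Sum>i\<in>{k<..<m}. inverse (z n) ^ (i - k) *\<^sub>C c i)"
        by (intro sum.cong refl) (simp only:)
      show ?thesis unfolding h1 h2 h3 cmat_scale_one by simp
    qed
    have "(\<lambda>n. inverse (z n) ^ (m - (k + 1))) \<longlonglongrightarrow> 0 ^ (m - (k + 1))"
      by (intro tendsto_power inverse_z_lim)
    from cmat_scale.tendsto[OF this lim] have 1: "(\<lambda>n. inverse (z n) ^ (m - (k + 1)) *\<^sub>C ?E n) \<longlonglongrightarrow> 0" by (simp add: cmat_scale.zero_right)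
    have "(\<lambda>n. \<Sum>i\<in>{k<..<m}. inverse (z n) ^ (i - k) *\<^sub>C c i) \<longlonglongrightarrow> (\<Sum>i\<in>{k<..<m}. 0 ^ (i - k) *\<^sub>C c i)"
      by (intro tendsto_sum cmat_scale.tendsto tendsto_power inverse_z_lim tendsto_const)
    also have "(\<Sum>i\<in>{k<..<m}. 0 ^ (i - k) *\<^sub>C c i) = 0" by (intro sum.neutral ballI) (simp add: zero_power cmat_scale.zero_left)
    finally have "(\<lambda>n. inverse (z n) ^ (m - (k + 1)) *\<^sub>C ?E n - c k - (\<Sum>i\<in>{k<..<m}. inverse (z n) ^ (i - k) *\<^sub>C c i)) \<longlonglongrightarrow> 0 - c k - 0"
      by (intro tendsto_diff 1 tendsto_const)
    then show ?thesis unfolding e by simp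
  qed
  \<comment> \<open>This is \<open>- z\<close> times the remainder integrand of order
    \<open>k\<close>: the power \<open>t ^ k\<close> times a bounded kernel that tends to 1.\<close>
  define \<phi> where "\<phi> n t = t ^ k * (y n * inverse (t + y n))" for n t
  have phi: "of_real (\<phi> n t) = - z n * (of_real t ^ k * inverse (of_real t - z n))" for n t
    unfolding resolvent_z by (simp add: \<phi>_def z_def)
  have int_phi: "integrable \<tau> (\<lambda>t. complex_of_real (\<phi> n t))" for n
  proof -
    have "integrable \<tau> (\<lambda>t. complex_of_real t ^ k * inverse (of_real t - z n))"
    proof (cases k)
      case 0
      then show ?thesis using integrable_resolvent[OF z_slit] by simp
    next
      case (Suc i)
      have "integrable \<tau> (\<lambda>t. complex_of_real (t * inverse (t + y n)) * of_real t ^ i)"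
      proof (rule integrable_bounded_mult[OF int])
        show "i < k" using Suc by simp
        show "(\<lambda>t. complex_of_real (t * inverse (t + y n))) \<in> borel_measurable \<tau>"
          by (rule measurable_trace_measure) measurable
        show "norm (complex_of_real (t * inverse (t + y n))) \<le> 1" if "t \<ge> \<alpha>" for t
          unfolding norm_of_real by (rule kernel_bounds[OF that])
      qed
      then show ?thesis unfolding resolvent_z Suc by (simp add: mult_ac)
    qed
    then show ?thesis unfolding phi by (rule integrable_mult_right)
  qed
  have I_phi: "(\<lambda>n. I (\<lambda>t. complex_of_real (\<phi> n t))) \<longlonglongrightarrow> c k"
  proof -
    have "z n ^ (k + 1) *\<^sub>C (H n + (\<Sum>i<k. inverse (z n) ^ (i + 1) *\<^sub>C c i)) = - I (\<lambda>t. complex_of_real (\<phi> n t))" for n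
    proof -
      have "(\<Sum>i<k. inverse (z n) ^ (i + 1) *\<^sub>C c i) = (\<Sum>i<k. inverse (z n) ^ (i + 1) *\<^sub>C mom i)"
        by (intro sum.cong refl) (simp add: mom)
      then have "z n ^ (k + 1) *\<^sub>C (H n + (\<Sum>i<k. inverse (z n) ^ (i + 1) *\<^sub>C c i)) =
          z n *\<^sub>C (z n ^ k *\<^sub>C (H n + (\<Sum>i<k. inverse (z n) ^ (i + 1) *\<^sub>C mom i)))"
        by (simp add: cmat_scale_scale)
      also have "\<dots> = z n *\<^sub>C I (\<lambda>t. of_real t ^ k * inverse (of_real t - z n))"
        by (subst remainder_eq) (auto simp: int)
      also have "\<dots> = I (\<lambda>t. - 1 * complex_of_real (\<phi> n t))"
      proof (subst I_scale[symmetric])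
        have "(\<lambda>t. of_real t ^ k * inverse (of_real t - z n)) = (\<lambda>t. (- inverse (z n)) * complex_of_real (\<phi> n t))"
          unfolding phi using z_neq_0[of n] by (simp add: fun_eq_iff)
        then show "integrable \<tau> (\<lambda>t. of_real t ^ k * inverse (of_real t - z n))"
          using integrable_mult_right[OF int_phi, of "- inverse (z n)" n] by simp
      qed (simp add: phi)
      also have "\<dots> = - I (\<lambda>t. complex_of_real (\<phi> n t))"
        by (subst I_scale[OF int_phi]) (simp add: cmat_scale.minus_left)
      finally show ?thesis .
    qed
    with lim_k have "(\<lambda>n. - I (\<lambda>t. complex_of_real (\<phi> n t))) \<longlonglongrightarrow> - c k" by simp
    then show ?thesis by (simp only: tendsto_minus_cancel_left[symmetric] minus_minus)
  qed
  have "(\<lambda>n. Re (trace (I (\<lambda>t. complex_of_real (\<phi> n t))))) \<longlonglongrightarrow> Re (trace (c k))"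
    by (intro tendsto_Re bounded_linear.tendsto[OF bounded_linear_trace] I_phi)
  then obtain B where B: "\<And>n. \<bar>Re (trace (I (\<lambda>t. complex_of_real (\<phi> n t))))\<bar> \<le> B"
    using convergent_imp_Bseq[THEN BseqD] unfolding convergent_def by (metis real_norm_def)
  have int_phi': "integrable \<tau> (\<phi> n)" for n using integrable_Re[OF int_phi[of n]] by simp
  have phi_B: "(\<integral>t. \<phi> n t \<partial>\<tau>) \<le> B" for n
    using B[of n] trace_I[OF int_phi[of n]] by simp
  have abs_phi_eq: "\<bar>\<phi> n t\<bar> = \<bar>t\<bar> ^ k * (y n * inverse (t + y n))" if t: "t \<ge> \<alpha>" for t n
    unfolding \<phi>_def abs_mult[of "t ^ k"] power_abs abs_of_nonneg[OF kernel_bounds(2)[OF t]] ..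
  \<comment> \<open>For odd \<open>k\<close> the integrand is negative on negative \<open>t\<close>,
    where its modulus is at most \<open>2 * \<bar>\<alpha>\<bar> ^ k\<close>. Adding twice that
    bound makes it dominate its modulus, so a bound for the signed integrals suffices for Fatou's
    lemma.\<close>
  have abs_phi: "\<bar>t\<bar> ^ k * (y n * inverse (t + y n)) \<le> \<phi> n t + 4 * \<bar>\<alpha>\<bar> ^ k" if t: "t \<ge> \<alpha>" for t n
  proof (cases "t \<ge> 0")
    case True
    then show ?thesis by (simp add: \<phi>_def)
  next
    case False
    then have "\<bar>t\<bar> ^ k \<le> \<bar>\<alpha>\<bar> ^ k" using t by (intro power_mono) auto
    then have b: "\<bar>t\<bar> ^ k * (y n * inverse (t + y n)) \<le> \<bar>\<alpha>\<bar> ^ k * 2"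
      using kernel_bounds[OF t, of n] by (intro mult_mono) auto
    then show ?thesis using abs_phi_eq[OF t, of n] by linarith
  qed
  define b where "b n = (\<integral>\<^sup>+t. ennreal (\<bar>t\<bar> ^ k * (y n * inverse (t + y n))) \<partial>\<tau>)" for n
  have b: "b n \<le> ennreal (B + 4 * \<bar>\<alpha>\<bar> ^ k * measure \<tau> (space \<tau>))" for n
  proof -
    have nn: "0 \<le> \<phi> n t + 4 * \<bar>\<alpha>\<bar> ^ k" if "t \<ge> \<alpha>" for t
      using abs_phi[OF that, of n] kernel_bounds(2)[OF that, of n] by (meson abs_ge_zero mult_nonneg_nonneg order_trans zero_le_power)
    have "b n \<le> (\<integral>\<^sup>+t. ennreal (\<phi> n t + 4 * \<bar>\<alpha>\<bar> ^ k) \<partial>\<tau>)"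
      unfolding b_def by (intro nn_integral_mono ennreal_leI abs_phi) simp
    also have "\<dots> = ennreal (\<integral>t. \<phi> n t + 4 * \<bar>\<alpha>\<bar> ^ k \<partial>\<tau>)"
      using int_phi' nn by (intro nn_integral_eq_integral) auto
    also have "\<dots> \<le> ennreal (B + 4 * \<bar>\<alpha>\<bar> ^ k * measure \<tau> (space \<tau>))"
      using int_phi'[of n] phi_B[of n] by (intro ennreal_leI) simp
    finally show ?thesis .
  qed
  have pm: "(\<lambda>t. \<bar>t\<bar> ^ k) \<in> borel_measurable \<tau>" by (rule measurable_trace_measure) measurable
  have "(\<integral>\<^sup>+t. ennreal (\<bar>t\<bar> ^ k) \<partial>\<tau>) = (\<integral>\<^sup>+t. liminf (\<lambda>n. ennreal (\<bar>t\<bar> ^ k * (y n * inverse (t + y n)))) \<partial>\<tau>)"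
  proof (rule nn_integral_cong)
    fix t
    have "(\<lambda>n. \<bar>t\<bar> ^ k * (y n * inverse (t + y n))) \<longlonglongrightarrow> \<bar>t\<bar> ^ k * 1"
      by (intro tendsto_intros kernel_lim)
    then have "(\<lambda>n. ennreal (\<bar>t\<bar> ^ k * (y n * inverse (t + y n)))) \<longlonglongrightarrow> ennreal (\<bar>t\<bar> ^ k)"
      by (intro tendsto_ennrealI) simp
    then show "ennreal (\<bar>t\<bar> ^ k) = liminf (\<lambda>n. ennreal (\<bar>t\<bar> ^ k * (y n * inverse (t + y n))))"
      by (intro lim_imp_Liminf[symmetric]) auto
  qed
  also have "\<dots> \<le> liminf b"
    unfolding b_def[abs_def]
    by (intro nn_integral_liminf measurable_compose[OF _ measurable_ennreal] measurable_trace_measure) measurable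
  also have "\<dots> \<le> liminf (\<lambda>n. ennreal (B + 4 * \<bar>\<alpha>\<bar> ^ k * measure \<tau> (space \<tau>)))"
    by (intro Liminf_mono always_eventually allI b)
  also have "\<dots> < \<infinity>" by (simp add: Liminf_const)
  finally have fin: "integrable \<tau> (\<lambda>t. \<bar>t\<bar> ^ k)" using pm by (intro integrableI_nonneg) auto
  have cm: "(\<lambda>t. complex_of_real t ^ k) \<in> borel_measurable \<tau>" by (rule measurable_trace_measure) measurable
  have int_k: "integrable \<tau> (\<lambda>t. complex_of_real t ^ k)"
    by (rule Bochner_Integration.integrable_bound[OF fin cm]) (simp add: norm_power)
  have "(\<lambda>n. I (\<lambda>t. complex_of_real (\<phi> n t))) \<longlonglongrightarrow> mom k"
    unfolding mom_def
  proof (rule I_dominated_convergence)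
    show "integrable \<tau> (\<lambda>t. 2 * \<bar>t\<bar> ^ k)" using fin by simp
    fix t assume t: "t \<ge> \<alpha>"
    show "norm (complex_of_real (\<phi> n t)) \<le> 2 * \<bar>t\<bar> ^ k" for n
      using kernel_bounds(3)[OF t, of n] unfolding norm_of_real abs_phi_eq[OF t]
      by (subst mult.commute) (intro mult_right_mono, auto)
    have "(\<lambda>n. complex_of_real (t ^ k * (y n * inverse (t + y n)))) \<longlonglongrightarrow> complex_of_real (t ^ k * 1)"
      by (intro tendsto_intros kernel_lim)
    then show "(\<lambda>n. complex_of_real (\<phi> n t)) \<longlonglongrightarrow> complex_of_real t ^ k" by (simp add: \<phi>_def)
  qed (use cm int_phi in \<open>auto intro: borel_measurable_integrable\<close>)
  with I_phi have "mom k = c k" by (intro LIMSEQ_unique)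
  with int_k show ?case by simp
qed

end


section \<open>Dependence of reciprocal sequences on their terms\<close>

lemma scaleR_cmat: "r *\<^sub>R A = of_real r *\<^sub>C (A :: complex ^ 'q ^ 'q::finite)"
  by (simp add: cmat_scale_def vec_eq_iff scaleR_conv_of_real[of _ "w :: complex" for w])

lemma reciprocal_seq_cong:
  "(\<And>j. j \<le> n \<Longrightarrow> u j = v j) \<Longrightarrow> reciprocal_seq u n = reciprocal_seq v n"
proof (induction n rule: less_induct)
  case (less n)
  show ?case
  proof (cases n)
    case (Suc i)
    have "(\<Sum>l=0..i. u (Suc i - l) ** reciprocal_seq u l) = (\<Sum>l=0..i. v (Suc i - l) ** reciprocal_seq v l)"
      using less Suc by (intro sum.cong refl arg_cong2[where f = "(**)"]) auto
    then show ?thesis using less.prems[of 0] by (simp add: Suc)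
  qed (use less.prems[of 0] in simp)
qed

text \<open>The last term \<open>u (Suc i)\<close> enters the recursion only through the summand
  \<open>l = 0\<close>, so changing it alone has an affine effect.\<close>

lemma reciprocal_seq_last:
  assumes "\<And>j. j \<le> i \<Longrightarrow> u j = v j"
  shows "reciprocal_seq u (Suc i) = reciprocal_seq v (Suc i) - mp_inverse (v 0) ** (u (Suc i) - v (Suc i)) ** mp_inverse (v 0)"
proof -
  have "(\<Sum>l=0..i. u (Suc i - l) ** reciprocal_seq u l) - (\<Sum>l=0..i. v (Suc i - l) ** reciprocal_seq v l)
      = (\<Sum>l=0..i. if l = 0 then (u (Suc i) - v (Suc i)) ** mp_inverse (v 0) else 0)"
    unfolding sum_subtractf[symmetric]
  proof (rule sum.cong[OF refl])
    fix l assume "l \<in> {0..i}"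
    then have "reciprocal_seq u l = reciprocal_seq v l" using assms by (intro reciprocal_seq_cong) auto
    then show "u (Suc i - l) ** reciprocal_seq u l - v (Suc i - l) ** reciprocal_seq v l =
        (if l = 0 then (u (Suc i) - v (Suc i)) ** mp_inverse (v 0) else 0)"
      using assms[of "Suc i - l"] assms[of 0] by (cases l) (auto simp: cmat_mult.diff_left)
  qed
  then have "(\<Sum>l=0..i. u (Suc i - l) ** reciprocal_seq u l) = (\<Sum>l=0..i. v (Suc i - l) ** reciprocal_seq v l) + (u (Suc i) - v (Suc i)) ** mp_inverse (v 0)"
    by (simp add: algebra_simps)
  then show ?thesis using assms[of 0] by (simp add: cmat_mult.add_right matrix_mul_assoc)
qed

section \<open>The expansion of the transform at minus infinity\<close>

locale stieltjes_expansion = stieltjes_transform \<alpha> \<sigma> F + asymptotics \<alpha> \<sigma> y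
  for \<alpha> :: real and \<sigma> :: "real set \<Rightarrow> complex ^ 'q ^ 'q::finite" and F and y +
  fixes m :: nat
  assumes integrable_power: "integrable \<tau> (\<lambda>t. complex_of_real t ^ m)"
begin

definition u :: "nat \<Rightarrow> complex ^ 'q ^ 'q" where "u = shifted_seq \<alpha> mom"
definition r :: "nat \<Rightarrow> complex ^ 'q ^ 'q" where "r = reciprocal_seq u"
abbreviation iz :: "nat \<Rightarrow> complex" where "iz n \<equiv> inverse (z n)"
text \<open>Up to sign, \<open>S\<close> and \<open>T\<close> are the truncated expansions of
  \<open>M (z n)\<close> and of its Moore-Penrose inverse \<open>X (z n)\<close> in powers of
  \<open>iz n\<close>.\<close>

definition S :: "nat \<Rightarrow> complex ^ 'q ^ 'q" where "S n = (\<Sum>j\<le>m. iz n ^ j *\<^sub>C u j)"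
definition T :: "nat \<Rightarrow> complex ^ 'q ^ 'q" where "T n = (\<Sum>l\<le>m. iz n ^ l *\<^sub>C r l)"

lemma mom_0: "mom 0 = s0" by (simp add: mom_def)

lemma H_F: "H n = F (z n)" by (simp add: H_def F_eq[OF z_slit])

lemma u_0: "u 0 = s0" by (simp add: u_def shifted_seq_def mom_0)

lemma u_Suc: "u (Suc j) = mom (Suc j) - of_real \<alpha> *\<^sub>C mom j"
  by (simp add: u_def shifted_seq_def scaleR_cmat)

lemma P_mom: "j \<le> m \<Longrightarrow> P ** mom j = mom j"
  unfolding mom_def by (rule P_I) (rule integrable_power_mono[OF integrable_power])

lemma P_u: "j \<le> m \<Longrightarrow> P ** u j = u j"
  by (cases j) (simp_all add: u_0 P_facts u_Suc cmat_mult.diff_right cmat_scale_mult_right P_mom)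

lemma r_0: "r 0 = R" by (simp add: r_def u_0 R_def)

lemma r_Suc: "r (Suc i) = - (R ** (\<Sum>l\<le>i. u (Suc i - l) ** r l))"
  by (simp add: r_def u_0 R_def atMost_atLeast0)

lemma P_r: "P ** r l = r l"
  by (cases l) (simp_all add: r_0 r_Suc P_facts cmat_mult.minus_right matrix_mul_assoc)

text \<open>By the recursion the summand \<open>l = k\<close> is \<open>- P\<close> times the sum of
  the others, and \<open>P\<close> fixes them because all moments have their range in that of
  \<open>s0\<close>. So \<open>u\<close> and \<open>r\<close> are reciprocal as power series, with
  \<open>P\<close> as the unit.\<close>

lemma convolution:
  assumes "k \<le> m"
  shows "(\<Sum>l\<le>k. u (k - l) ** r l) = (if k = 0 then P else 0)"
proof (cases k)
  case 0
  then show ?thesis by (simp add: u_0 r_0 P_def)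
next
  case (Suc i)
  let ?S = "\<Sum>l\<le>i. u (Suc i - l) ** r l"
  have "P ** ?S = ?S"
    unfolding cmat_mult.sum_right using assms Suc by (intro sum.cong refl) (simp add: matrix_mul_assoc P_u)
  then show ?thesis by (simp add: Suc r_Suc u_0 cmat_mult.minus_right matrix_mul_assoc flip: P_def)
qed

lemma T_lim: "T \<longlonglongrightarrow> R"
proof -
  have "T \<longlonglongrightarrow> (\<Sum>l\<le>m. 0 ^ l *\<^sub>C r l)"
    unfolding T_def by (intro tendsto_sum cmat_scale.tendsto tendsto_power inverse_z_lim tendsto_const)
  also have "(\<Sum>l\<le>m. 0 ^ l *\<^sub>C r l) = (\<Sum>l\<le>m. if l = 0 then R else 0)"
    by (intro sum.cong refl) (simp add: power_0_left r_0 cmat_scale.zero_left)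
  finally show ?thesis by simp
qed

lemma S_lim: "S \<longlonglongrightarrow> s0"
proof -
  have "S \<longlonglongrightarrow> (\<Sum>j\<le>m. 0 ^ j *\<^sub>C u j)"
    unfolding S_def by (intro tendsto_sum cmat_scale.tendsto tendsto_power inverse_z_lim tendsto_const)
  also have "(\<Sum>j\<le>m. 0 ^ j *\<^sub>C u j) = (\<Sum>j\<le>m. if j = 0 then s0 else 0)"
    by (intro sum.cong refl) (simp add: power_0_left u_0 cmat_scale.zero_left)
  finally show ?thesis by simp
qed

lemma power_z_iz: "z n ^ k * iz n ^ k = 1"
  unfolding power_mult_distrib[symmetric] using z_neq_0[of n] by simp

text \<open>In the product of the truncated series the terms of order at most \<open>m\<close> add
  up to \<open>P\<close>; each of the others keeps a positive power of \<open>iz n\<close> after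
  multiplication by \<open>z n ^ m\<close>.\<close>

lemma W_lim: "(\<lambda>n. z n ^ m *\<^sub>C (P - S n ** T n)) \<longlonglongrightarrow> 0"
proof -
  define g where "g n l j = iz n ^ (l + j) *\<^sub>C (u j ** r l)" for n l j
  let ?A = "{(l, j). l + j \<le> m}" and ?B = "{(l, j). l \<le> m \<and> j \<le> m \<and> m < l + j}"
  have fin: "finite ?A" "finite ?B"
    by (rule finite_subset[of _ "{..m} \<times> {..m}"]; auto)+
  have "S n ** T n = P + (\<Sum>(l, j)\<in>?B. g n l j)" for n
  proof -
    have "S n ** T n = (\<Sum>l\<le>m. \<Sum>j\<le>m. g n l j)"
      unfolding S_def T_def g_def cmat_mult.sum_left cmat_mult.sum_right
      by (simp add: cmat_scale_mult_left cmat_scale_mult_right cmat_scale_scale power_add)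
    also have "\<dots> = (\<Sum>(l, j)\<in>{..m} \<times> {..m}. g n l j)" by (rule sum.cartesian_product)
    also have "{..m} \<times> {..m} = ?A \<union> ?B" by auto
    also have "(\<Sum>(l, j)\<in>?A \<union> ?B. g n l j) = (\<Sum>(l, j)\<in>?A. g n l j) + (\<Sum>(l, j)\<in>?B. g n l j)"
      using fin by (intro sum.union_disjoint) auto
    also have "(\<Sum>(l, j)\<in>?A. g n l j) = (\<Sum>k\<le>m. \<Sum>l\<le>k. g n l (k - l))"
      by (rule sum.triangle_reindex_eq)
    also have "\<dots> = (\<Sum>k\<le>m. iz n ^ k *\<^sub>C (\<Sum>l\<le>k. u (k - l) ** r l))"
      unfolding cmat_scale.sum_right g_def by (intro sum.cong refl) auto
    also have "\<dots> = (\<Sum>k\<le>m. if k = 0 then P else 0)"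
      by (intro sum.cong refl) (auto simp: convolution cmat_scale.zero_right)
    finally show ?thesis by simp
  qed
  then have "z n ^ m *\<^sub>C (P - S n ** T n) = - (\<Sum>(l, j)\<in>?B. iz n ^ (l + j - m) *\<^sub>C (u j ** r l))" for n
  proof -
    have "z n ^ m * iz n ^ (l + j) = iz n ^ (l + j - m)" if "m < l + j" for l j
      using power_z_iz[of n m] power_add[of "iz n" m "l + j - m"] that by simp
    then have "z n ^ m *\<^sub>C (\<Sum>(l, j)\<in>?B. g n l j) = (\<Sum>(l, j)\<in>?B. iz n ^ (l + j - m) *\<^sub>C (u j ** r l))"
      unfolding cmat_scale.sum_right g_def by (intro sum.cong refl) (auto simp: cmat_scale_scale)
    then show ?thesis
      using \<open>\<And>n. S n ** T n = _\<close>[of n] by (simp add: cmat_scale.diff_right cmat_scale.add_right cmat_scale.minus_right)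
  qed
  moreover have "(\<lambda>n. - (\<Sum>(l, j)\<in>?B. iz n ^ (l + j - m) *\<^sub>C (u j ** r l))) \<longlonglongrightarrow> - (\<Sum>(l, j)\<in>?B. 0 ^ (l + j - m) *\<^sub>C (u j ** r l))"
    unfolding case_prod_unfold
    by (intro tendsto_minus tendsto_sum cmat_scale.tendsto tendsto_power inverse_z_lim tendsto_const)
  moreover have "(\<Sum>(l, j)\<in>?B. 0 ^ (l + j - m) *\<^sub>C (u j ** r l)) = 0"
    by (rule sum.neutral) (auto simp: zero_power cmat_scale.zero_left)
  ultimately show ?thesis by simp
qed

text \<open>Multiplication by \<open>z - \<alpha>\<close> turns the moment series into the series of
  \<open>u\<close>. The extra term arises because the truncation at \<open>k\<close> omits the part
  of \<open>u (k + 1)\<close> that contains \<open>mom k\<close>.\<close>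

lemma shifted_sum:
  "(\<Sum>j\<le>k. iz n ^ j *\<^sub>C u j) = (z n - of_real \<alpha>) *\<^sub>C (\<Sum>j\<le>k. iz n ^ (j + 1) *\<^sub>C mom j) + (of_real \<alpha> * iz n ^ (k + 1)) *\<^sub>C mom k"
proof (induction k)
  case 0
  have "(z n - of_real \<alpha>) * iz n + of_real \<alpha> * iz n = 1" using z_neq_0[of n] by (simp add: algebra_simps)
  then show ?case by (simp add: u_0 mom_0 cmat_scale_scale flip: cmat_scale.add_left)
next
  case (Suc k)
  have e: "(z n - of_real \<alpha>) * iz n ^ (Suc k + 1) + of_real \<alpha> * iz n ^ (Suc k + 1) = iz n ^ Suc k"
    using z_neq_0[of n] by (simp add: algebra_simps)
  have "(z n - of_real \<alpha>) *\<^sub>C (\<Sum>j\<le>Suc k. iz n ^ (j + 1) *\<^sub>C mom j) + (of_real \<alpha> * iz n ^ (Suc k + 1)) *\<^sub>C mom (Suc k) =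
      (z n - of_real \<alpha>) *\<^sub>C (\<Sum>j\<le>k. iz n ^ (j + 1) *\<^sub>C mom j) + ((z n - of_real \<alpha>) * iz n ^ (Suc k + 1) + of_real \<alpha> * iz n ^ (Suc k + 1)) *\<^sub>C mom (Suc k)"
    by (simp add: cmat_scale.add_right cmat_scale.add_left cmat_scale_scale)
  also have "\<dots> = (z n - of_real \<alpha>) *\<^sub>C (\<Sum>j\<le>k. iz n ^ (j + 1) *\<^sub>C mom j) + iz n ^ Suc k *\<^sub>C mom (Suc k)"
    unfolding e ..
  also have "\<dots> = (\<Sum>j\<le>Suc k. iz n ^ j *\<^sub>C u j)"
    unfolding sum.atMost_Suc Suc u_Suc by (simp add: cmat_scale.diff_right cmat_scale_scale mult.commute)
  finally show ?case by simp
qed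

text \<open>The factor \<open>z - \<alpha>\<close> in \<open>M\<close> costs one order, whence
  \<open>z n ^ m\<close> here against \<open>z n ^ (m + 1)\<close> for \<open>H\<close>.\<close>

lemma E_lim: "(\<lambda>n. z n ^ m *\<^sub>C (M (z n) + S n)) \<longlonglongrightarrow> 0"
proof -
  let ?D = "\<lambda>n. z n ^ (m + 1) *\<^sub>C (H n + (\<Sum>j\<le>m. iz n ^ (j + 1) *\<^sub>C mom j))"
  have "z n ^ m *\<^sub>C (M (z n) + S n) = (1 - of_real \<alpha> * iz n) *\<^sub>C ?D n + (of_real \<alpha> * iz n) *\<^sub>C mom m" for n
  proof -
    have 1: "(1 - of_real \<alpha> * iz n) * z n ^ (m + 1) = z n ^ m * (z n - of_real \<alpha>)"
      using z_neq_0[of n] by (simp add: algebra_simps)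
    have 2: "z n ^ m * (of_real \<alpha> * iz n ^ (m + 1)) = of_real \<alpha> * iz n"
      using power_z_iz[of n m] by (simp add: mult.commute mult.left_commute)
    have "M (z n) + S n = (z n - of_real \<alpha>) *\<^sub>C (H n + (\<Sum>j\<le>m. iz n ^ (j + 1) *\<^sub>C mom j)) + (of_real \<alpha> * iz n ^ (m + 1)) *\<^sub>C mom m"
      unfolding S_def shifted_sum M_def H_F cmat_scale.add_right by (simp only: add.assoc)
    then have "z n ^ m *\<^sub>C (M (z n) + S n) = (z n ^ m * (z n - of_real \<alpha>)) *\<^sub>C (H n + (\<Sum>j\<le>m. iz n ^ (j + 1) *\<^sub>C mom j)) + (z n ^ m * (of_real \<alpha> * iz n ^ (m + 1))) *\<^sub>C mom m"
      by (simp only: cmat_scale.add_right[of "z n ^ m"] cmat_scale_scale)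
    then show ?thesis unfolding cmat_scale_scale 1 2 .
  qed
  moreover have "(\<lambda>n. (1 - of_real \<alpha> * iz n) *\<^sub>C ?D n + (of_real \<alpha> * iz n) *\<^sub>C mom m) \<longlonglongrightarrow> (1 - of_real \<alpha> * 0) *\<^sub>C 0 + (of_real \<alpha> * 0) *\<^sub>C mom m"
    by (intro tendsto_add cmat_scale.tendsto tendsto_diff tendsto_mult tendsto_const inverse_z_lim expansion_lim integrable_power)
  ultimately show ?thesis by (simp add: cmat_scale.zero_left cmat_scale.zero_right)
qed

lemma N_lim: "(\<lambda>n. N (z n)) \<longlonglongrightarrow> 0"
proof -
  have "(\<lambda>n. iz n ^ m *\<^sub>C (z n ^ m *\<^sub>C (M (z n) + S n))) \<longlonglongrightarrow> 0 ^ m *\<^sub>C 0"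
    by (intro cmat_scale.tendsto tendsto_power inverse_z_lim E_lim)
  moreover have "iz n ^ m *\<^sub>C (z n ^ m *\<^sub>C (M (z n) + S n)) = M (z n) + S n" for n
    using power_z_iz[of n m] by (simp add: cmat_scale_scale mult.commute)
  ultimately have "(\<lambda>n. M (z n) + S n) \<longlonglongrightarrow> 0" by (simp add: cmat_scale.zero_right)
  then have "(\<lambda>n. M (z n) + S n - S n + s0) \<longlonglongrightarrow> 0 - s0 + s0" by (intro tendsto_intros S_lim)
  then show ?thesis by (simp add: M_N[OF z_slit])
qed

lemma X_Bfun: "Bfun (\<lambda>n. X (z n)) sequentially"
proof -
  obtain K where K: "K > 0" "\<And>(A :: complex ^ 'q ^ 'q) (B :: complex ^ 'q ^ 'q). norm (A ** B) \<le> norm A * norm B * K"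
    using cmat_mult.pos_bounded by blast
  have "(\<lambda>n. 2 * (norm (N (z n)) * norm R * K * K)) \<longlonglongrightarrow> 2 * (norm (0 :: complex ^ 'q ^ 'q) * norm R * K * K)"
    by (intro tendsto_intros N_lim)
  then have "eventually (\<lambda>n. 2 * (norm (N (z n)) * norm R * K * K) < 1) sequentially"
    by (rule order_tendstoD) simp
  then have "eventually (\<lambda>n. norm (X (z n)) \<le> 2 * norm R) sequentially"
  proof eventually_elim
    case (elim n)
    then show ?case by (intro X_bound[OF z_slit K]) auto
  qed
  then show ?thesis by (rule BfunI)
qed

text \<open>\<open>X + T = X (P - S T + (M + S) T)\<close>, because \<open>X M = P\<close> and
  \<open>P T = T\<close>. The bracket is small to the required order by \<open>W_lim\<close> and
  \<open>E_lim\<close>, and \<open>X\<close> stays bounded.\<close>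

lemma XT_lim: "(\<lambda>n. z n ^ m *\<^sub>C (X (z n) + T n)) \<longlonglongrightarrow> 0"
proof -
  let ?W = "\<lambda>n. z n ^ m *\<^sub>C (P - S n ** T n)" and ?E = "\<lambda>n. z n ^ m *\<^sub>C (M (z n) + S n)"
  have PT: "P ** T n = T n" for n
    unfolding T_def cmat_mult.sum_right by (simp add: cmat_scale_mult_right P_r)
  have "z n ^ m *\<^sub>C (X (z n) + T n) = X (z n) ** (?W n + ?E n ** T n)" for n
  proof -
    have "X (z n) ** (M (z n) ** T n) = T n" by (simp add: matrix_mul_assoc M_X[OF z_slit] PT)
    then have "X (z n) ** (P - S n ** T n + (M (z n) + S n) ** T n) = X (z n) + T n"
      by (simp add: cmat_distribs M_X[OF z_slit] del: matrix_mul_assoc)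
    then show ?thesis
      by (simp only: cmat_scale_mult_left cmat_scale_mult_right flip: cmat_scale.add_right)
  qed
  moreover have "(\<lambda>n. X (z n) ** (?W n + ?E n ** T n)) \<longlonglongrightarrow> 0"
  proof -
    have "(\<lambda>n. ?W n + ?E n ** T n) \<longlonglongrightarrow> 0 + 0 ** R"
      by (intro tendsto_add cmat_mult.tendsto W_lim E_lim T_lim)
    then have "Zfun (\<lambda>n. ?W n + ?E n ** T n) sequentially"
      by (simp add: tendsto_Zfun_iff cmat_mult.zero_left)
    then show ?thesis
      unfolding tendsto_Zfun_iff diff_zero by (rule cmat_mult.Bfun_prod_Zfun[OF X_Bfun])
  qed
  ultimately show ?thesis by simp
qed

text \<open>Multiply the expansion of \<open>X\<close> by \<open>s0\<close> on both sides. The term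
  of index 0 becomes \<open>s0 R s0 = s0\<close> and cancels the \<open>- s0\<close> in
  \<open>G\<close>, so the coefficients start with \<open>r 1\<close>; this is the index shift in
  \<open>S_transform\<close>.\<close>

theorem G_expansion:
  "(\<lambda>n. z n ^ m *\<^sub>C (G (z n) + (\<Sum>j<m. iz n ^ (j + 1) *\<^sub>C S_transform \<alpha> mom j))) \<longlonglongrightarrow> 0"
proof -
  have "z n ^ m *\<^sub>C (G (z n) + (\<Sum>j<m. iz n ^ (j + 1) *\<^sub>C S_transform \<alpha> mom j)) = - (s0 ** (z n ^ m *\<^sub>C (X (z n) + T n)) ** s0)" for n
  proof -
    have "s0 ** T n ** s0 = (\<Sum>l\<le>m. iz n ^ l *\<^sub>C (s0 ** r l ** s0))"
      unfolding T_def cmat_mult.sum_right cmat_mult.sum_left by (simp add: cmat_scale_mult_left cmat_scale_mult_right)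
    also have "\<dots> = s0 ** r 0 ** s0 + (\<Sum>j<m. iz n ^ Suc j *\<^sub>C (s0 ** r (Suc j) ** s0))"
      by (subst sum.atMost_shift) simp
    also have "s0 ** r 0 ** s0 = s0" by (simp add: r_0 P_facts flip: P_def)
    also have "(\<Sum>j<m. iz n ^ Suc j *\<^sub>C (s0 ** r (Suc j) ** s0)) = - (\<Sum>j<m. iz n ^ (j + 1) *\<^sub>C S_transform \<alpha> mom j)"
      unfolding sum_negf[symmetric] by (intro sum.cong refl) (simp add: S_transform_def mom_0 r_def u_def cmat_scale.minus_right)
    finally have "G (z n) + (\<Sum>j<m. iz n ^ (j + 1) *\<^sub>C S_transform \<alpha> mom j) = - (s0 ** (X (z n) + T n) ** s0)"
      by (simp add: G_eq[OF z_slit] cmat_distribs algebra_simps)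
    then show ?thesis by (simp add: cmat_scale.minus_right cmat_scale_mult_left cmat_scale_mult_right)
  qed
  moreover have "(\<lambda>n. - (s0 ** (z n ^ m *\<^sub>C (X (z n) + T n)) ** s0)) \<longlonglongrightarrow> - (s0 ** 0 ** s0)"
    by (intro tendsto_minus cmat_mult.tendsto tendsto_const XT_lim)
  ultimately show ?thesis by (simp add: cmat_mult.zero_left cmat_mult.zero_right)
qed

end

theorem theorem9p2:
  fixes \<alpha> :: real and m :: nat
    and s :: "nat \<Rightarrow> complex ^ 'q ^ 'q"
    and F :: "complex \<Rightarrow> complex ^ 'q ^ 'q"
  assumes "m \<ge> 1"
    and "s \<in> K_ge m \<alpha>"
    and "F \<in> S_class_le \<alpha> m s"
  shows "plus_transform \<alpha> (s 0) F \<in> S_class_le \<alpha> (m - 1) (S_transform \<alpha> s)"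
proof -
  have F: "F \<in> S0_class \<alpha>" "F \<in> S_class \<alpha>" using assms(3) by (auto simp: S_class_le_def S0_class_def)
  define \<sigma> where "\<sigma> = stieltjes_measure \<alpha> F"
  have ex: "\<And>j. j \<le> m \<Longrightarrow> moment_exists \<alpha> \<sigma> j" and eq: "\<And>j. j < m \<Longrightarrow> moment \<alpha> \<sigma> j = s j"
    and last: "nonneg_hermitian (s m - moment \<alpha> \<sigma> m)"
    using assms(3) by (auto simp: S_class_le_def \<sigma>_def)
  \<comment> \<open>The selected measure represents \<open>F\<close> only because some representing
    measure exists.\<close>
  have rep: "represents \<alpha> \<sigma> F"
    unfolding \<sigma>_def stieltjes_measure_def by (rule someI_ex[OF S0_class_represents[OF F(1)]])
  interpret nh_measure \<alpha> \<sigma>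
    using rep by unfold_locales (simp add: represents_def)
  have pm: "(\<lambda>t. complex_of_real t ^ j) \<in> borel_measurable \<tau>" for j
    by (rule measurable_trace_measure) measurable
  have int: "integrable \<tau> (\<lambda>t. complex_of_real t ^ j)" if "j \<le> m" for j
    using ex[OF that] matrix_integrable_iff[OF pm] by (simp add: moment_exists_def)
  interpret stieltjes_transform \<alpha> \<sigma> F
    using rep int[OF assms(1)] by unfold_locales (auto simp: represents_def)
  obtain y where "negative_sequence \<alpha> y" by (rule negative_sequence_ex)
  then interpret negative_sequence \<alpha> y .
  interpret stieltjes_expansion \<alpha> \<sigma> F y m
    using int by unfold_locales auto
  have mom: "mom j = moment \<alpha> \<sigma> j" for j by (simp add: mom_def moment_def)
  have s_0: "s 0 = s0" using eq[of 0] assms(1) mom mom_0 by simp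
  have G0: "G \<in> S0_class \<alpha>" by (rule G_S0_class[OF F(2)])
  define \<sigma>' where "\<sigma>' = stieltjes_measure \<alpha> G"
  have rep': "represents \<alpha> \<sigma>' G"
    unfolding \<sigma>'_def stieltjes_measure_def by (rule someI_ex[OF S0_class_represents[OF G0]])
  interpret G: nh_measure \<alpha> \<sigma>'
    using rep' by unfold_locales (simp add: represents_def)
  interpret G: asymptotics \<alpha> \<sigma>' y by unfold_locales
  \<comment> \<open>Along the sequence the Stieltjes transform of the measure of \<open>G\<close> is
    \<open>G\<close> itself, so the expansion of \<open>G\<close> determines its moments.\<close>
  have H: "G.H n = G (z n)" for n
    using rep' z_slit[of n] by (simp add: G.H_def represents_def)
  have G_moments: "integrable G.\<tau> (\<lambda>t. complex_of_real t ^ j) \<and> G.mom j = S_transform \<alpha> mom j" if "j < m" for j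
    using that G_expansion by (intro G.moments_from_expansion[of m]) (simp_all add: H)
  have G_mom: "moment \<alpha> \<sigma>' j = S_transform \<alpha> mom j" if "j < m" for j
    using G_moments[OF that] by (simp add: G.mom_def moment_def)
  have G_ex: "moment_exists \<alpha> \<sigma>' j" if "j < m" for j
  proof -
    have "(\<lambda>t. complex_of_real t ^ j) \<in> borel_measurable G.\<tau>" by (rule G.measurable_trace_measure) measurable
    from G.matrix_integrable_iff[OF this] show ?thesis using G_moments[OF that] by (simp add: moment_exists_def)
  qed
  have u_eq: "shifted_seq \<alpha> s j = u j" if "j < m" for j
    using that eq by (auto simp: u_def shifted_seq_def mom)
  \<comment> \<open>\<open>S_transform \<alpha> s j\<close> involves \<open>u\<close> up to index
    \<open>j + 1\<close>, and \<open>s\<close> is known to agree with the moments only below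
    \<open>m\<close>; the coefficient of index \<open>m - 1\<close> is left over.\<close>
  have low: "S_transform \<alpha> s j = S_transform \<alpha> mom j" if "j + 1 < m" for j
    using that u_eq unfolding S_transform_def mom_0 s_0 u_def[symmetric]
    by (subst reciprocal_seq_cong[of "j + 1" "shifted_seq \<alpha> s" u]) auto
  obtain i where i: "m = Suc i" using assms(1) by (cases m) auto
  let ?\<Delta> = "s m - mom m"
  have "shifted_seq \<alpha> s m - u m = ?\<Delta>"
    using eq[of i] i by (simp add: u_def shifted_seq_def mom)
  then have "reciprocal_seq (shifted_seq \<alpha> s) (Suc i) = r (Suc i) - R ** ?\<Delta> ** R"
    using reciprocal_seq_last[of i "shifted_seq \<alpha> s" u] u_eq i by (simp add: u_0 r_def R_def)
  then have "S_transform \<alpha> s i = S_transform \<alpha> mom i + s0 ** (R ** ?\<Delta> ** R) ** s0"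
    by (simp add: S_transform_def s_0 mom_0 r_def u_def cmat_distribs)
  \<comment> \<open>\<open>s0 ** R\<close> and \<open>R ** s0\<close> are both \<open>P\<close>, so
    the correction is a congruence of the non-negative matrix \<open>?\<Delta>\<close>, hence
    non-negative.\<close>
  also have "s0 ** (R ** ?\<Delta> ** R) ** s0 = P ** ?\<Delta> ** P"
    by (simp add: P_def P_facts(2)[unfolded P_def, symmetric] matrix_mul_assoc)
  finally have diff: "S_transform \<alpha> s i - moment \<alpha> \<sigma>' i = ctransp P ** ?\<Delta> ** P"
    using G_mom[of i] i by (simp add: P_facts)
  have "nonneg_hermitian (S_transform \<alpha> s (m - 1) - moment \<alpha> \<sigma>' (m - 1))"
    using last diff i unfolding nonneg_hermitian_iff mom by (simp add: qform_congruence)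
  then show ?thesis
    using G0 G_ex G_mom low i unfolding S_class_le_def s_0 mem_Collect_eq \<sigma>'_def[symmetric] by auto
qed

end
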